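(* Let $\sigma>0$, $\bar\gamma>0$, $c_\infty\ge0$, and let $\kappa:[0,\infty)\to\mathbb{R}$ be $L_\kappa$-Lipschitz with $\kappa(0)=0$ (extended to $\mathbb{R}$ in an arbitrary way); set $\tau_\gamma(w)=w+\gamma\kappa(w)$. Let $(\gamma_n)\subset(0,\bar\gamma]$ with $\gamma_n\to0$, $w_0\ge0$, and let $(W^{(n)}_k)_{k\in\mathbb{N}}$ be the Markov chain with $W^{(n)}_0=w_0$ and kernel $Q_{\gamma_n}$, where $$Q_\gamma(w,A)=\delta_0(A)\int_{\mathbb{R}}\bar p_{\sigma^2\gamma}(\tau_\gamma(w)+\gamma c_\infty,g)\varphi(g)dg+\int_{\mathbb{R}}\mathbb{1}_A(\tau_\gamma(w)+\gamma c_\infty-2\sigma\gamma^{1/2}g)\{1-\bar p_{\sigma^2\gamma}(\tau_\gamma(w)+\gamma c_\infty,g)\}\varphi(g)dg,$$ $\bar p_{\sigma^2\gamma}(a,g)=1\wedge\varphi_{\sigma^2\gamma}(a-\sigma\sqrt\gamma g)/\varphi_{\sigma^2\gamma}(\sigma\sqrt\gamma g)$. Let $\mathbf W^{(n)}_t=W^{(n)}_{\lfloor t/\gamma_n\rfloor}+\{W^{(n)}_{\lceil t/\gamma_n\rceil}-W^{(n)}_{\lfloor t/\gamma_n\rfloor}\}\{t/\gamma_n-\lfloor t/\gamma_n\rfloor\}$ and let $\mu_n$ be the law of $(\mathbf W^{(n)}_t)_{t\ge0}$ on $\mathbb W=C([0,\infty),\mathbb{R})$ (uniform topology on compacts, Borel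 $\sigma$-field $\mathcal W$). Let $(\mathrm W_t)_{t\ge0}$ be the canonical process on $\mathbb W$ and $(\mathcal W_t)_{t\ge0}$ its natural filtration. Let $\mu_\infty$ be a limit point (for convergence in distribution) of $(\mu_n)_{n\in\mathbb{N}}$. Then, on $(\mathbb W,\mathcal W,(\mathcal W_t)_{t\ge0},\mu_\infty)$, the processes $$M_t=\mathrm W_t-\mathrm W_0-\int_0^t\{c_\infty+\kappa(\mathrm W_u)\}du,\qquad N_t=M_t^2-4\sigma^2\int_0^t\mathbb{1}_{(0,\infty)}(\mathrm W_u)du$$ are $(\mathcal W_t)_{t\ge0}$-martingales.
   Context: $\varphi$ is the standard normal density and $\varphi_s(t)=(2\pi s)^{-1/2}e^{-t^2/(2s)}$. *)

theory Defs
  imports "HOL-Probability.Probability"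
begin

definition phi :: "real \<Rightarrow> real" where
  "phi t = std_normal_density t"

definition phi_var :: "real \<Rightarrow> real \<Rightarrow> real" where
  "phi_var s t = (2 * pi * s) powr (-1/2) * exp (- t\<^sup>2 / (2 * s))"

(* \<bar>p\<close>_s(a,g) = 1 \<and> phi_s(a - sqrt s g) / phi_s(sqrt s g); with s = sigma^2 gamma, sqrt s = sigma sqrt gamma *)
definition pbar :: "real \<Rightarrow> real \<Rightarrow> real \<Rightarrow> real" where
  "pbar s a g = min 1 (phi_var s (a - sqrt s * g) / phi_var s (sqrt s * g))"

definition tau :: "(real \<Rightarrow> real) \<Rightarrow> real \<Rightarrow> real \<Rightarrow> real" where
  "tau \<kappa> \<gamma> w = w + \<gamma> * \<kappa> w"

definition Qk :: "real \<Rightarrow> real \<Rightarrow> (real \<Rightarrow> real) \<Rightarrow> real \<Rightarrow> real \<Rightarrow> real set \<Rightarrow> real" where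
  "Qk \<sigma> c \<kappa> \<gamma> w A =
     (let a = tau \<kappa> \<gamma> w + \<gamma> * c in
       indicator A 0 * (LINT g|lborel. pbar (\<sigma>\<^sup>2 * \<gamma>) a g * phi g)
       + (LINT g|lborel. indicator A (a - 2 * \<sigma> * sqrt \<gamma> * g)
                          * (1 - pbar (\<sigma>\<^sup>2 * \<gamma>) a g) * phi g))"

(* Path space C([0,oo), R): continuous functions on [0,oo), normalised to 0 on (-oo,0) *)
definition Wpaths :: "(real \<Rightarrow> real) set" where
  "Wpaths = {w. continuous_on {0..} w \<and> (\<forall>t<0. w t = 0)}"

(* topology of uniform convergence on compacts, generated by the basic neighbourhoods *)
definition Wtop :: "(real \<Rightarrow> real) topology" where
  "Wtop = topology_generated_by
     {{v \<in> Wpaths. \<forall>t\<in>{0..T}. \<bar>v t - w t\<bar> < e} | w T e. w \<in> Wpaths \<and> T \<ge> 0 \<and> e > 0}"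

definition Wborel :: "(real \<Rightarrow> real) measure" where
  "Wborel = sigma (topspace Wtop) {U. openin Wtop U}"

definition Wfilt :: "real \<Rightarrow> (real \<Rightarrow> real) set set" where
  "Wfilt t = sigma_sets Wpaths {{w \<in> Wpaths. w s \<in> A} | s A. 0 \<le> s \<and> s \<le> t \<and> A \<in> sets borel}"

definition interp :: "real \<Rightarrow> (nat \<Rightarrow> real) \<Rightarrow> real \<Rightarrow> real" where
  "interp \<gamma> x t = (if t < 0 then 0 else
      x (nat \<lfloor>t / \<gamma>\<rfloor>) + (x (nat \<lceil>t / \<gamma>\<rceil>) - x (nat \<lfloor>t / \<gamma>\<rfloor>)) * (t / \<gamma> - of_int \<lfloor>t / \<gamma>\<rfloor>))"

definition weak_conv_top :: "'a topology \<Rightarrow> (nat \<Rightarrow> 'a measure) \<Rightarrow> 'a measure \<Rightarrow> bool" where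
  "weak_conv_top T \<mu>s \<mu> \<longleftrightarrow>
     (\<forall>f. continuous_map T euclideanreal f \<and> bounded (f ` topspace T) \<longrightarrow>
        (\<lambda>n. \<integral>x. f x \<partial>\<mu>s n) \<longlonglongrightarrow> (\<integral>x. f x \<partial>\<mu>))"

definition is_martingale :: "'a measure \<Rightarrow> (real \<Rightarrow> 'a set set) \<Rightarrow> (real \<Rightarrow> 'a \<Rightarrow> real) \<Rightarrow> bool" where
  "is_martingale M F X \<longleftrightarrow>
     (\<forall>t\<ge>0. integrable M (X t) \<and> X t \<in> measurable (sigma (space M) (F t)) borel) \<and>
     (\<forall>s t B. 0 \<le> s \<longrightarrow> s \<le> t \<longrightarrow> B \<in> F s \<longrightarrow>
        (\<integral>x\<in>B. X t x \<partial>M) = (\<integral>x\<in>B. X s x \<partial>M))"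

definition Mproc :: "real \<Rightarrow> (real \<Rightarrow> real) \<Rightarrow> real \<Rightarrow> (real \<Rightarrow> real) \<Rightarrow> real" where
  "Mproc c \<kappa> t w = w t - w 0 - (LINT u:{0..t}|lborel. c + \<kappa> (w u))"

definition Nproc :: "real \<Rightarrow> real \<Rightarrow> (real \<Rightarrow> real) \<Rightarrow> real \<Rightarrow> (real \<Rightarrow> real) \<Rightarrow> real" where
  "Nproc \<sigma> c \<kappa> t w = (Mproc c \<kappa> t w)\<^sup>2
      - 4 * \<sigma>\<^sup>2 * (LINT u:{0..t}|lborel. indicator {0<..} (w u))"

end

theory Submission
  imports Defs
begin

text \<open>One step of the chain is a Gaussian reflected in law: from a drifted position \<^term>\<open>a \<ge> 0\<close> the
  law of the next position is \<^term>\<open>q y - q (- y)\<close> on \<^term>\<open>y > 0\<close>, plus an atom at the origin, where \<^term>\<open>q\<close> is the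
  Gaussian density with mean \<^term>\<open>a\<close> and variance \<^term>\<open>4 * \<sigma>\<^sup>2 * \<gamma>\<close>. Hence the mean is exactly \<^term>\<open>a\<close>, and the
  variance is at most \<^term>\<open>4 * \<sigma>\<^sup>2 * \<gamma>\<close>, with a relative error of order \<^term>\<open>\<gamma> / a\<^sup>2\<close>. The compensated chain is
  therefore a martingale, and after interpolation and uniform fourth moment bounds this passes to the limit.
  For the bracket one has to know that no variance is accumulated while the chain is close to the origin.
  Testing the chain against a convex function that is quadratic on \<^term>\<open>{0..2 * \<delta>}\<close> and linear with slope
  \<^term>\<open>2 * \<delta>\<close> afterwards bounds the variance accumulated below \<^term>\<open>\<delta>\<close> by a multiple of \<^term>\<open>\<delta>\<close>, uniformly in the
  step size. So the bracket may be computed with a continuous approximation of the indicator of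
  \<^term>\<open>{0<..}\<close>, to which weak convergence applies.\<close>

section \<open>One step of the chain\<close>

text \<open>The mass that a step sends to the atom is, in terms of the proposed position, symmetric
  about 0: collapsing it there keeps the first moment and only lowers the second. The convex test
  works because over a bounded time its mean can grow only by a multiple of the slope
  \<open>2 * \<delta>\<close>, while every step from below \<delta> gains half its conditional
  variance in mean, up to drift costs and a fourth-moment term for jumps past
  \<open>2 * \<delta>\<close>. The estimates need the two limits in a fixed order. The error in the
  discrete bracket identity is
  \<open>Cvar1 t * \<delta> + Cvar2 s t \<delta> * sqrt \<gamma>\<close>, and \<open>Cvar2\<close>
  blows up as \<delta> shrinks. So \<gamma> tends to 0 at fixed \<delta>, where the functionals
  involved are continuous, and \<delta> tends to 0 only afterwards, under the limit law. The rate
  \<open>sqrt \<gamma>\<close> arises because passing from the path to the grid costs an error of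
  order \<gamma> in mean square. Weak convergence concerns bounded functionals; a uniform second
  moment of a functional makes up for its unboundedness. For the squared martingale this means
  fourth moments.\<close>

lemma has_bochner_integral_lborel_reflect:
  fixes f :: "real \<Rightarrow> real"
  assumes "has_bochner_integral lborel f x"
  shows "has_bochner_integral lborel (\<lambda>g. f (e - g)) x"
  using lborel_has_bochner_integral_real_affine_iff[of "-1" f x e] assms by simp

text \<open>Substituting \<open>e - g\<close> for \<open>g\<close> preserves Lebesgue measure and
  turns the integral into its negative. The oddness is about \<open>e / 2\<close>, the axis of
  symmetry of \<open>overlap e\<close>.\<close>

lemma integral_eq_0_if_odd:
  fixes f :: "real \<Rightarrow> real"
  assumes "\<And>g. f (e - g) = - f g"
  shows "(\<integral>g. f g \<partial>lborel) = 0"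
proof -
  have "(\<integral>g. f g \<partial>lborel) = (\<integral>g. f (e - g) \<partial>lborel)"
    using lborel_integral_real_affine[of "-1" f e] by simp
  then show ?thesis by (simp add: assms)
qed

section \<open>The Gaussian density, its moments, and the part of its mass sent to the
  origin\<close>

lemma phi_eq: "phi = std_normal_density"
  by (simp add: phi_def fun_eq_iff)

lemma phi_pos: "phi g > 0" and phi_nonneg: "phi g \<ge> 0"
  by (simp_all add: phi_eq normal_density_pos)

lemma phi_measurable[measurable]: "phi \<in> borel_measurable borel"
  by (simp add: phi_eq)

lemma phi_moments:
  shows "has_bochner_integral lborel phi 1"
    and "has_bochner_integral lborel (\<lambda>g. g * phi g) 0"
    and "has_bochner_integral lborel (\<lambda>g. g\<^sup>2 * phi g) 1"
    and "has_bochner_integral lborel (\<lambda>g. g^4 * phi g) 3"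
  using std_normal_moment_even[of 0] std_normal_moment_odd[of 0] std_normal_moment_even[of 1]
    std_normal_moment_even[of 2]
  by (simp_all add: phi_eq fact_numeral mult.commute)

lemma integrable_phi_power: "integrable lborel (\<lambda>g. g^k * phi g)"
  using integrable_normal_moment[of 1 0 k] by (simp add: phi_eq mult.commute)

lemma phi_le_iff: "phi x \<le> phi y \<longleftrightarrow> y\<^sup>2 \<le> x\<^sup>2"
  by (simp add: phi_eq std_normal_density_def divide_simps)

text \<open>The common mass of the normal densities with means 0 and \<open>e\<close>, as
  \<open>phi\<close> is even. With \<open>e\<close> the drifted position divided by
  \<open>\<sigma> * sqrt \<gamma>\<close> it is the sub-density of those Gaussian variables that
  send the chain to the origin (\<open>pbar_phi\<close>); its symmetry about \<open>e / 2\<close> is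
  the source of the exact mean.\<close>

definition overlap :: "real \<Rightarrow> real \<Rightarrow> real" where
  "overlap e g = min (phi g) (phi (e - g))"

lemma overlap_measurable[measurable]:
  "(\<lambda>x. overlap (f x) (g x)) \<in> borel_measurable M"
  if [measurable]: "f \<in> borel_measurable M" "g \<in> borel_measurable M"
  unfolding overlap_def by measurable

lemma overlap_nonneg: "0 \<le> overlap e g" and overlap_le: "overlap e g \<le> phi g"
  and overlap_reflect: "overlap e (e - g) = overlap e g"
  by (auto simp: overlap_def phi_nonneg)

text \<open>Beyond \<open>e / 2\<close> the point \<open>g\<close> is at least as far from 0 as from
  \<open>e\<close>. For the chain, \<open>e \<le> 2 * g\<close> says that the proposal
  \<open>a - 2 * r * g\<close> is not positive; such proposals are sent to the origin with
  certainty, so the chain never becomes negative.\<close>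

lemma overlap_eq_phi: "overlap e g = phi g" if "e \<ge> 0" "e \<le> 2 * g"
proof -
  have "(e - g)\<^sup>2 \<le> g\<^sup>2" using that by (intro power2_le_iff_abs_le[THEN iffD2]) auto
  then show ?thesis by (simp add: overlap_def phi_le_iff)
qed

lemma integrable_overlap_power: "integrable lborel (\<lambda>g. g^k * overlap e g)"
  by (rule Bochner_Integration.integrable_bound[OF integrable_phi_power[of k]])
     (auto simp: abs_mult overlap_nonneg overlap_le phi_nonneg intro!: mult_left_mono)

text \<open>Scaling by \<open>r = \<sigma> * sqrt \<gamma>\<close> turns both densities of variance
  \<open>r\<^sup>2\<close> into standard ones, and their normalising constants cancel in the ratio.
  Multiplying the minimum by the positive number \<open>phi g\<close> gives the overlap.\<close>

lemma pbar_phi: "pbar (\<sigma>\<^sup>2 * \<gamma>) a g * phi g = overlap (a / (\<sigma> * sqrt \<gamma>)) g"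
  if "\<sigma> > 0" "\<gamma> > 0"
proof -
  define r where "r = \<sigma> * sqrt \<gamma>"
  have r: "r > 0" "\<sigma>\<^sup>2 * \<gamma> = r\<^sup>2" using that by (auto simp: r_def power_mult_distrib)
  have c: "(2 * pi * r\<^sup>2) powr (-1/2) > 0" using r by simp
  have 1: "- (a - r * g)\<^sup>2 / (2 * r\<^sup>2) = - (a / r - g)\<^sup>2 / 2"
    using r by (simp add: field_simps power2_eq_square)
  have 2: "- (r * g)\<^sup>2 / (2 * r\<^sup>2) = - g\<^sup>2 / 2"
    using r by (simp add: field_simps power2_eq_square)
  have "phi_var (r\<^sup>2) (a - r * g) / phi_var (r\<^sup>2) (r * g) = phi (a / r - g) / phi g"
    unfolding phi_var_def 1 2 phi_eq std_normal_density_def using c by (simp add: divide_simps)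
  then have "pbar (r\<^sup>2) a g = min 1 (phi (a / r - g) / phi g)"
    using r by (simp add: pbar_def)
  then show ?thesis
    using phi_pos[of g] unfolding r(2)[symmetric] r_def[symmetric]
    by (auto simp: overlap_def r(2) min_def divide_simps split: if_splits)
qed

text \<open>The variance of one step of the chain is \<^term>\<open>\<sigma>\<^sup>2 * \<gamma> * step_var e\<close>, where \<^term>\<open>e\<close> is the
  drifted position divided by \<^term>\<open>\<sigma> * sqrt \<gamma>\<close>.\<close>

definition step_var :: "real \<Rightarrow> real" where
  "step_var e = 4 - (\<integral>g. (e - 2 * g)\<^sup>2 * overlap e g \<partial>lborel)"

lemma step_var_measurable[measurable]: "step_var \<in> borel_measurable borel"
  unfolding step_var_def by measurable

lemma integrable_overlap_sq: "integrable lborel (\<lambda>g. (e - 2 * g)\<^sup>2 * overlap e g)"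
proof -
  have "integrable lborel
    (\<lambda>g. e\<^sup>2 * (g^0 * overlap e g) - 4 * e * (g^1 * overlap e g) + 4 * (g^2 * overlap e g))"
    by (intro Bochner_Integration.integrable_add Bochner_Integration.integrable_diff
        integrable_mult_right integrable_overlap_power)
  then show ?thesis
    by (simp add: power2_eq_square algebra_simps)
qed

lemma step_var_le: "step_var e \<le> 4"
  unfolding step_var_def by (simp add: integral_nonneg_AE overlap_nonneg)

text \<open>One of \<open>g\<close> and \<open>e - g\<close>, called \<open>x\<close>, is at least
  \<open>e / 2\<close>, and the overlap is below the density at either point. Then
  \<open>e \<le> 2 * x\<close> and also \<open>\<bar>e - 2 * x\<bar> \<le> 2 * x\<close>, so four
  factors of this size are paid for by \<open>16 * x^4\<close>.\<close>

lemma overlap_tail: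
  assumes "e \<ge> 0"
  shows "e^4 * overlap e g \<le> 16 * (g^4 * phi g + (e - g)^4 * phi (e - g))"
    and "e\<^sup>2 * ((e - 2 * g)\<^sup>2 * overlap e g) \<le> 16 * (g^4 * phi g + (e - g)^4 * phi (e - g))"
proof -
  have *: "e^4 \<le> 16 * x^4" "e\<^sup>2 * (e - 2 * x)\<^sup>2 \<le> 16 * x^4" if "e \<le> 2 * x" for x
  proof -
    have "e^4 \<le> (2 * x)^4" using that assms by (intro power_mono) auto
    then show "e^4 \<le> 16 * x^4" by (simp add: power_mult_distrib)
    have "e\<^sup>2 * (e - 2 * x)\<^sup>2 \<le> (2 * x)\<^sup>2 * (2 * x)\<^sup>2"
      using that assms by (intro mult_mono power2_le_iff_abs_le[THEN iffD2]) auto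
    then show "e\<^sup>2 * (e - 2 * x)\<^sup>2 \<le> 16 * x^4" by (simp add: power_mult_distrib power2_eq_square power4_eq_xxxx)
  qed
  have p: "0 \<le> g^4 * phi g" "0 \<le> (e - g)^4 * phi (e - g)"
    by (simp_all add: phi_nonneg)
  have o: "overlap e g \<le> phi g" "overlap e g \<le> phi (e - g)" "0 \<le> overlap e g"
    by (auto simp: overlap_def phi_nonneg)
  have sq: "(e - 2 * (e - g))\<^sup>2 = (e - 2 * g)\<^sup>2"
    by (simp add: power2_eq_square algebra_simps)
  show "e^4 * overlap e g \<le> 16 * (g^4 * phi g + (e - g)^4 * phi (e - g))"
  proof (cases "e \<le> 2 * g")
    case True
    have "e^4 * overlap e g \<le> (16 * g^4) * phi g"
      using *[OF True] o by (intro mult_mono) auto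
    then show ?thesis using p by simp
  next
    case False
    have "e^4 * overlap e g \<le> (16 * (e - g)^4) * phi (e - g)"
      using *[of "e - g"] False o by (intro mult_mono) auto
    then show ?thesis using p by simp
  qed
  show "e\<^sup>2 * ((e - 2 * g)\<^sup>2 * overlap e g) \<le> 16 * (g^4 * phi g + (e - g)^4 * phi (e - g))"
  proof (cases "e \<le> 2 * g")
    case True
    have "(e\<^sup>2 * (e - 2 * g)\<^sup>2) * overlap e g \<le> (16 * g^4) * phi g"
      using *[OF True] o by (intro mult_mono[of "e\<^sup>2 * (e - 2 * g)\<^sup>2"]) auto
    then show ?thesis using p by simp
  next
    case False
    have "(e\<^sup>2 * (e - 2 * g)\<^sup>2) * overlap e g \<le> (16 * (e - g)^4) * phi (e - g)"
      using *(2)[of "e - g"] False o by (intro mult_mono[of "e\<^sup>2 * (e - 2 * g)\<^sup>2"]) (auto simp: sq power2_commute[of "2 * g"])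
    then show ?thesis using p by simp
  qed
qed

text \<open>The constant is \<open>16 * (3 + 3)\<close>, where 3 is the fourth moment of the
  standard normal law.\<close>

lemma overlap_tail_integral:
  "has_bochner_integral lborel (\<lambda>g. 16 * (g^4 * phi g + (e - g)^4 * phi (e - g))) 96"
proof -
  have "has_bochner_integral lborel (\<lambda>g. 16 * (g^4 * phi g + (e - g)^4 * phi (e - g))) (16 * (3 + 3))"
    by (intro has_bochner_integral_mult_right has_bochner_integral_add phi_moments
        has_bochner_integral_lborel_reflect[where f = "\<lambda>g. g^4 * phi g"])
  then show ?thesis by simp
qed

text \<open>The integral is the probability of a jump to the origin from the scaled position
  \<open>e\<close>. Its decay of order four compensates the factor \<open>a^4\<close> that such a
  jump contributes in \<open>nn_step_law_4\<close>.\<close>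

lemma integral_overlap_le: "e^4 * (\<integral>g. overlap e g \<partial>lborel) \<le> 96" if "e \<ge> 0"
proof -
  have "(\<integral>g. e^4 * overlap e g \<partial>lborel) \<le> (\<integral>g. 16 * (g^4 * phi g + (e - g)^4 * phi (e - g)) \<partial>lborel)"
    using overlap_tail_integral[of e] integrable_overlap_power[of 0 e] overlap_tail(1)[OF that]
    by (intro integral_mono) (auto simp: has_bochner_integral_iff)
  then show ?thesis using overlap_tail_integral[of e] by (simp add: has_bochner_integral_iff)
qed

text \<open>The defect \<open>4 - step_var e\<close> is the integral whose integrand
  \<open>overlap_tail\<close> bounds; thus the full Gaussian variance is recovered away from the
  origin.\<close>

lemma step_var_ge: "step_var e \<ge> 4 - 96 / e\<^sup>2" if "e > 0"
proof -
  have "(\<integral>g. e\<^sup>2 * ((e - 2 * g)\<^sup>2 * overlap e g) \<partial>lborel)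
      \<le> (\<integral>g. 16 * (g^4 * phi g + (e - g)^4 * phi (e - g)) \<partial>lborel)"
    using overlap_tail_integral[of e] integrable_overlap_sq[of e] overlap_tail(2)[of e] that
    by (intro integral_mono) (auto simp: has_bochner_integral_iff)
  then have "e\<^sup>2 * (\<integral>g. (e - 2 * g)\<^sup>2 * overlap e g \<partial>lborel) \<le> 96"
    using overlap_tail_integral[of e] by (simp add: has_bochner_integral_iff)
  then show ?thesis using that by (simp add: step_var_def field_simps)
qed

text \<open>The mixture of an atom and a continuous part is encoded as the image of a single density
  on \<open>bool\<close> times the line, the flag \<open>b\<close> marking a jump to the origin. All
  parameters then enter through measurable functions on a fixed product space;
  \<open>nn_integral_step\<close> uses the same encoding for the joint law.\<close>

definition step_law :: "real \<Rightarrow> real \<Rightarrow> real measure" where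
  "step_law r a = distr
     (density (count_space UNIV \<Otimes>\<^sub>M lborel)
       (\<lambda>(b, g). ennreal (if b then overlap (a / r) g else phi g - overlap (a / r) g)))
     borel (\<lambda>(b, g). if b then 0 else a - 2 * r * g)"

lemma sets_step_law[simp, measurable_cong]: "sets (step_law r a) = sets borel"
  and space_step_law[simp]: "space (step_law r a) = UNIV"
  by (simp_all add: step_law_def)

lemma nn_integral_step_law_pair:
  assumes [measurable]: "h \<in> borel_measurable borel"
  shows "(\<integral>\<^sup>+y. h y \<partial>step_law r a) = (\<integral>\<^sup>+(b, g).
      ennreal (if b then overlap (a / r) g else phi g - overlap (a / r) g)
      * h (if b then 0 else a - 2 * r * g) \<partial>(count_space UNIV \<Otimes>\<^sub>M lborel))"
proof -
  have [measurable]: "(\<lambda>(b, g). ennreal (if b then overlap (a / r) g else phi g - overlap (a / r) g))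
      \<in> borel_measurable (count_space UNIV \<Otimes>\<^sub>M lborel)"
    by measurable
  have [measurable]: "(\<lambda>(b, g). if b then 0 else a - 2 * r * g)
      \<in> borel_measurable (count_space UNIV \<Otimes>\<^sub>M lborel)"
    by measurable
  show ?thesis
    unfolding step_law_def
    by (subst nn_integral_distr, simp, simp, subst nn_integral_density)
       (auto intro!: nn_integral_cong)
qed

lemma nn_integral_step_law:
  assumes [measurable]: "h \<in> borel_measurable borel"
  shows "(\<integral>\<^sup>+y. h y \<partial>step_law r a) =
    (\<integral>\<^sup>+g. h 0 * ennreal (overlap (a / r) g)
       + h (a - 2 * r * g) * ennreal (phi g - overlap (a / r) g) \<partial>lborel)"
proof -
  have "(\<integral>\<^sup>+y. h y \<partial>step_law r a) = (\<integral>\<^sup>+(b, g).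
      ennreal (if b then overlap (a / r) g else phi g - overlap (a / r) g)
      * h (if b then 0 else a - 2 * r * g) \<partial>(count_space UNIV \<Otimes>\<^sub>M lborel))"
    by (rule nn_integral_step_law_pair) simp
  also have "\<dots> = (\<integral>\<^sup>+b. \<integral>\<^sup>+g. 
      ennreal (if b then overlap (a / r) g else phi g - overlap (a / r) g)
      * h (if b then 0 else a - 2 * r * g) \<partial>lborel \<partial>count_space UNIV)"
    by (subst lborel.nn_integral_fst[symmetric]) simp_all
  also have "\<dots> = (\<integral>\<^sup>+g. h 0 * ennreal (overlap (a / r) g)
       + h (a - 2 * r * g) * ennreal (phi g - overlap (a / r) g) \<partial>lborel)"
    by (subst nn_integral_count_space_finite)
       (simp_all add: UNIV_bool nn_integral_add mult.commute add.commute)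
  finally show ?thesis .
qed

section \<open>Moments of one step from a nonnegative drifted position\<close>

context
  fixes r a :: real
  assumes r: "r > 0" and a: "a \<ge> 0"
begin

lemma scaled_nonneg: "a / r \<ge> 0" using r a by simp

text \<open>Nonnegativity of \<open>h\<close> on the half-line suffices, because where
  \<open>a - 2 * r * g\<close> could be negative the weight \<open>phi g - overlap (a / r) g\<close>
  vanishes. In particular \<open>h\<close> may be the identity.\<close>

lemma nn_integral_step_law_real:
  assumes [measurable]: "h \<in> borel_measurable borel"
    and pos: "\<And>y. y \<ge> 0 \<Longrightarrow> h y \<ge> 0"
    and int: "has_bochner_integral lborel (\<lambda>g. h 0 * overlap (a / r) g
       + h (a - 2 * r * g) * (phi g - overlap (a / r) g)) I"
  shows "(\<integral>\<^sup>+y. ennreal (h y) \<partial>step_law r a) = ennreal I"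
proof -
  have *: "ennreal (h 0) * ennreal (overlap (a / r) g)
       + ennreal (h (a - 2 * r * g)) * ennreal (phi g - overlap (a / r) g) =
     ennreal (h 0 * overlap (a / r) g + h (a - 2 * r * g) * (phi g - overlap (a / r) g))"
    and nn: "0 \<le> h 0 * overlap (a / r) g + h (a - 2 * r * g) * (phi g - overlap (a / r) g)" for g
  proof -
    have "ennreal (h 0) * ennreal (overlap (a / r) g)
       + ennreal (h (a - 2 * r * g)) * ennreal (phi g - overlap (a / r) g) =
      ennreal (h 0 * overlap (a / r) g + h (a - 2 * r * g) * (phi g - overlap (a / r) g)) \<and>
      0 \<le> h 0 * overlap (a / r) g + h (a - 2 * r * g) * (phi g - overlap (a / r) g)"
    proof (cases "a / r \<le> 2 * g")
      case True
      then show ?thesis using overlap_eq_phi[OF scaled_nonneg True] pos[of 0]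
        by (simp add: ennreal_mult phi_nonneg)
    next
      case False
      then have "a - 2 * r * g \<ge> 0" using r by (simp add: field_simps)
      then show ?thesis using pos[of "a - 2 * r * g"] pos[of 0] overlap_le[of "a / r" g] 
          overlap_nonneg[of "a / r" g]
        by (simp add: ennreal_mult ennreal_plus)
    qed
    then show "ennreal (h 0) * ennreal (overlap (a / r) g)
       + ennreal (h (a - 2 * r * g)) * ennreal (phi g - overlap (a / r) g) =
      ennreal (h 0 * overlap (a / r) g + h (a - 2 * r * g) * (phi g - overlap (a / r) g))"
      "0 \<le> h 0 * overlap (a / r) g + h (a - 2 * r * g) * (phi g - overlap (a / r) g)" by auto
  qed
  have "(\<integral>\<^sup>+y. ennreal (h y) \<partial>step_law r a) =
    (\<integral>\<^sup>+g. ennreal (h 0 * overlap (a / r) g + h (a - 2 * r * g) * (phi g - overlap (a / r) g)) \<partial>lborel)"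
    by (subst nn_integral_step_law) (simp_all add: *)
  also have "\<dots> = ennreal I"
    using int nn by (subst nn_integral_eq_integral) (auto simp: has_bochner_integral_iff)
  finally show ?thesis .
qed

lemma prob_space_step_law: "prob_space (step_law r a)"
proof
  have "has_bochner_integral lborel (\<lambda>g. 1 * overlap (a / r) g + 1 * (phi g - overlap (a / r) g)) 1"
    using phi_moments(1) by simp
  from nn_integral_step_law_real[of "\<lambda>_. 1", OF _ _ this]
  show "emeasure (step_law r a) (space (step_law r a)) = 1"
    by simp
qed

interpretation K: prob_space "step_law r a" by (rule prob_space_step_law)

lemma AE_step_law_nonneg: "AE y in step_law r a. y \<ge> 0"
proof (rule AE_I')
  have *: "(indicator {..<0::real} (a - 2 * r * g) :: ennreal) * ennreal (phi g - overlap (a / r) g) = 0" for g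
  proof (cases "a / r \<le> 2 * g")
    case True
    then show ?thesis using overlap_eq_phi[OF scaled_nonneg True] by simp
  next
    case False
    then have "a - 2 * r * g \<ge> 0" using r by (simp add: field_simps)
    then show ?thesis by simp
  qed
  have "emeasure (step_law r a) {..<0} = (\<integral>\<^sup>+y. indicator {..<0} y \<partial>step_law r a)"
    by simp
  also have "\<dots> = 0"
    by (subst nn_integral_step_law) (simp_all add: *)
  finally show "{..<0} \<in> null_sets (step_law r a)" by (simp add: null_sets_def)
qed auto

lemma integral_odd_overlap: "(\<integral>g. (a / r - 2 * g) * overlap (a / r) g \<partial>lborel) = 0"
  by (rule integral_eq_0_if_odd[where e = "a / r"]) (simp add: overlap_reflect algebra_simps)

lemma integrable_overlap_1: "integrable lborel (\<lambda>g. g * overlap (a / r) g)"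
  and integrable_overlap_0: "integrable lborel (\<lambda>g. overlap (a / r) g)"
  and integrable_overlap_2: "integrable lborel (\<lambda>g. g\<^sup>2 * overlap (a / r) g)"
  and integrable_overlap_4: "integrable lborel (\<lambda>g. g^4 * overlap (a / r) g)"
  using integrable_overlap_power[of 1] integrable_overlap_power[of 0] 
    integrable_overlap_power[of 2] integrable_overlap_power[of 4] by simp_all

lemma integral_id_overlap: "2 * (\<integral>g. g * overlap (a / r) g \<partial>lborel) = a / r * (\<integral>g. overlap (a / r) g \<partial>lborel)"
proof -
  have "(\<integral>g. (a / r - 2 * g) * overlap (a / r) g \<partial>lborel)
     = (\<integral>g. a / r * overlap (a / r) g - 2 * (g * overlap (a / r) g) \<partial>lborel)"
    by (simp add: left_diff_distrib mult.assoc)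
  also have "\<dots> = a / r * (\<integral>g. overlap (a / r) g \<partial>lborel) - 2 * (\<integral>g. g * overlap (a / r) g \<partial>lborel)"
    using integrable_overlap_1 integrable_overlap_0 by simp
  finally show ?thesis using integral_odd_overlap by simp
qed

text \<open>The mass collapsed to the origin is the image of \<open>overlap (a / r)\<close> under
  \<open>a - 2 * r * g\<close>, which is symmetric about 0. Its first moment vanishes, so the mean
  of the uncollapsed Gaussian survives.\<close>

lemma nn_step_law_mean: "(\<integral>\<^sup>+y. ennreal y \<partial>step_law r a) = ennreal a"
proof (rule nn_integral_step_law_real)
  let ?o = "overlap (a / r)"
  have "has_bochner_integral lborel
     (\<lambda>g. (a * phi g - 2 * r * (g * phi g)) - (a * ?o g - 2 * r * (g * ?o g)))
     ((a * 1 - 2 * r * 0) - (a * (\<integral>g. ?o g \<partial>lborel) - 2 * r * (\<integral>g. g * ?o g \<partial>lborel)))"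
    using integrable_overlap_1 integrable_overlap_0
    by (intro has_bochner_integral_diff has_bochner_integral_mult_right phi_moments)
       (auto simp: has_bochner_integral_iff)
  also have "a * 1 - 2 * r * 0 - (a * (\<integral>g. ?o g \<partial>lborel) - 2 * r * (\<integral>g. g * ?o g \<partial>lborel)) = a"
    using integral_id_overlap r by (simp add: field_simps)
  finally show "has_bochner_integral lborel (\<lambda>g. 0 * ?o g + (a - 2 * r * g) * (phi g - ?o g)) a"
    by (simp add: algebra_simps)
qed auto

text \<open>As collapsing keeps the mean, the variance is the Gaussian one,
  \<open>4 * r\<^sup>2\<close>, minus the second moment about 0 of the collapsed mass. That second
  moment is \<open>r\<^sup>2\<close> times the integral in \<open>step_var\<close>.\<close>

lemma step_law_var_aux:
  "has_bochner_integral lborel (\<lambda>g. (0 - a)\<^sup>2 * overlap (a / r) g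
     + (a - 2 * r * g - a)\<^sup>2 * (phi g - overlap (a / r) g)) (r\<^sup>2 * step_var (a / r))"
proof -
  let ?o = "overlap (a / r)"
  let ?I = "\<lambda>k. \<integral>g. g^k * ?o g \<partial>lborel"
  have "has_bochner_integral lborel
     (\<lambda>g. 4 * r\<^sup>2 * (g\<^sup>2 * phi g) - 4 * r\<^sup>2 * (g\<^sup>2 * ?o g) + a\<^sup>2 * ?o g)
     (4 * r\<^sup>2 * 1 - 4 * r\<^sup>2 * ?I 2 + a\<^sup>2 * (\<integral>g. ?o g \<partial>lborel))"
    using integrable_overlap_2 integrable_overlap_0
    by (intro has_bochner_integral_diff has_bochner_integral_add has_bochner_integral_mult_right phi_moments)
       (auto simp: has_bochner_integral_iff)
  also have "(\<lambda>g. 4 * r\<^sup>2 * (g\<^sup>2 * phi g) - 4 * r\<^sup>2 * (g\<^sup>2 * ?o g) + a\<^sup>2 * ?o g) =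
     (\<lambda>g. (0 - a)\<^sup>2 * ?o g + (a - 2 * r * g - a)\<^sup>2 * (phi g - ?o g))"
    by (simp add: power2_eq_square algebra_simps fun_eq_iff)
  also have "4 * r\<^sup>2 * 1 - 4 * r\<^sup>2 * ?I 2 + a\<^sup>2 * (\<integral>g. ?o g \<partial>lborel) = r\<^sup>2 * step_var (a / r)"
  proof -
    have "(\<integral>g. (a / r - 2 * g)\<^sup>2 * ?o g \<partial>lborel)
      = (\<integral>g. (a / r)\<^sup>2 * ?o g - (4 * (a / r)) * (g * ?o g) + 4 * (g\<^sup>2 * ?o g) \<partial>lborel)"
      by (simp add: power2_eq_square algebra_simps)
    also have "\<dots> = (a / r)\<^sup>2 * (\<integral>g. ?o g \<partial>lborel) - (4 * (a / r)) * (\<integral>g. g * ?o g \<partial>lborel) + 4 * ?I 2"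
      using integrable_overlap_2 integrable_overlap_1 integrable_overlap_0 
      by (subst Bochner_Integration.integral_add Bochner_Integration.integral_diff, simp, simp)+ simp
    \<comment> \<open>By \<open>integral_id_overlap\<close> the mixed term equals minus twice the
      term in \<open>(a / r)\<^sup>2\<close>.\<close>
    also have "\<dots> = 4 * ?I 2 - (a / r)\<^sup>2 * (\<integral>g. ?o g \<partial>lborel)"
      using arg_cong[OF integral_id_overlap, of "\<lambda>x. 2 * (a / r) * x"] 
      by (simp add: algebra_simps power2_eq_square)
    finally have "step_var (a / r) = 4 - (4 * ?I 2 - (a / r)\<^sup>2 * (\<integral>g. ?o g \<partial>lborel))"
      by (simp add: step_var_def)
    then show ?thesis using r by (simp add: right_diff_distrib power_divide)
  qed
  finally show ?thesis .
qed

lemma step_var_nonneg: "step_var (a / r) \<ge> 0"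
proof -
  have "0 \<le> r\<^sup>2 * step_var (a / r)"
    using step_law_var_aux
    by (auto simp: has_bochner_integral_iff overlap_nonneg overlap_le intro!: integral_nonneg_AE
        elim!: subst)
  then show ?thesis using r by (simp add: zero_le_mult_iff)
qed

lemma nn_step_law_var: "(\<integral>\<^sup>+y. ennreal ((y - a)\<^sup>2) \<partial>step_law r a) = ennreal (r\<^sup>2 * step_var (a / r))"
  by (rule nn_integral_step_law_real[OF _ _ step_law_var_aux]) auto

text \<open>The constant is \<open>16 * 3 + 96\<close>: the continuous part moves by
  \<open>2 * r * g\<close>, and a jump to the origin covers the distance \<open>a\<close> with a
  probability bounded by \<open>integral_overlap_le\<close>.\<close>

lemma nn_step_law_4: "(\<integral>\<^sup>+y. ennreal ((y - a)^4) \<partial>step_law r a) \<le> ennreal (144 * r^4)"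
proof -
  let ?o = "overlap (a / r)"
  let ?I = "\<lambda>k. \<integral>g. g^k * ?o g \<partial>lborel"
  have "has_bochner_integral lborel
     (\<lambda>g. 16 * r^4 * (g^4 * phi g) - 16 * r^4 * (g^4 * ?o g) + a^4 * ?o g)
     (16 * r^4 * 3 - 16 * r^4 * ?I 4 + a^4 * (\<integral>g. ?o g \<partial>lborel))"
    using integrable_overlap_4 integrable_overlap_0
    by (intro has_bochner_integral_diff has_bochner_integral_add has_bochner_integral_mult_right phi_moments)
       (auto simp: has_bochner_integral_iff)
  also have "(\<lambda>g. 16 * r^4 * (g^4 * phi g) - 16 * r^4 * (g^4 * ?o g) + a^4 * ?o g) =
     (\<lambda>g. (0 - a)^4 * ?o g + (a - 2 * r * g - a)^4 * (phi g - ?o g))"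
    by (simp add: power_mult_distrib algebra_simps fun_eq_iff)
  finally have "(\<integral>\<^sup>+y. ennreal ((y - a)^4) \<partial>step_law r a) =
      ennreal (16 * r^4 * 3 - 16 * r^4 * ?I 4 + a^4 * (\<integral>g. ?o g \<partial>lborel))"
    by (intro nn_integral_step_law_real) auto
  also have "\<dots> \<le> ennreal (144 * r^4)"
  proof (rule ennreal_leI)
    have "r^4 * ((a / r)^4 * (\<integral>g. ?o g \<partial>lborel)) \<le> r^4 * 96"
      using integral_overlap_le[OF scaled_nonneg] r by (intro mult_left_mono) auto
    then have 1: "a^4 * (\<integral>g. ?o g \<partial>lborel) \<le> 96 * r^4"
      using r by (simp add: power_divide)
    have "0 \<le> r^4 * ?I 4"
      using r by (intro mult_nonneg_nonneg integral_nonneg_AE) (auto simp: overlap_nonneg)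
    then show "16 * r^4 * 3 - 16 * r^4 * ?I 4 + a^4 * (\<integral>g. ?o g \<partial>lborel) \<le> 144 * r^4"
      using 1 by simp
  qed
  finally show ?thesis .
qed

text \<open>One step of a discrete Gronwall argument. The linear term has mean zero because
  \<open>a\<close> is the mean, the others are of order \<open>r\<^sup>2\<close> and
  \<open>r^4\<close>, and \<open>b \<ge> 1\<close> lets all of them be absorbed into a factor in
  front of \<open>b^4\<close>.\<close>

lemma step_law_powers:
  assumes b: "b \<ge> 1"
  shows "(\<integral>\<^sup>+y. ennreal ((b + (y - a))^4) \<partial>step_law r a) \<le> ennreal (exp (32 * r\<^sup>2) * b^4)"
proof -
  have m4: "integrable (step_law r a) (\<lambda>y. (y - a)^4)"
    using nn_step_law_4 by (intro integrableI_bounded) (auto simp: le_less_trans)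
  have m1: "integrable (step_law r a) (\<lambda>y. y)"
  proof (rule integrableI_bounded)
    have "(\<integral>\<^sup>+y. ennreal (norm y) \<partial>step_law r a) = (\<integral>\<^sup>+y. ennreal y \<partial>step_law r a)"
      by (intro nn_integral_cong_AE) (use AE_step_law_nonneg in auto)
    then show "(\<integral>\<^sup>+y. ennreal (norm y) \<partial>step_law r a) < \<infinity>" by (simp add: nn_step_law_mean)
  qed simp
  have m2: "integrable (step_law r a) (\<lambda>y. (y - a)^2)"
    using nn_step_law_var by (intro integrableI_bounded) (auto simp: le_less_trans)
  have i1: "(\<integral>y. y \<partial>step_law r a) = a"
    using nn_step_law_mean AE_step_law_nonneg a by (intro integral_eq_nn_integral[THEN trans]) auto
  have i2: "(\<integral>y. (y - a)^2 \<partial>step_law r a) \<le> 4 * r\<^sup>2"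
    using nn_step_law_var step_var_le[of "a / r"] r 
    by (subst integral_eq_nn_integral) (auto simp: enn2real_leI mult.commute)
  have i4: "(\<integral>y. (y - a)^4 \<partial>step_law r a) \<le> 144 * r^4"
    using nn_step_law_4 r by (subst integral_eq_nn_integral) (auto simp: enn2real_leI)
  \<comment> \<open>This trades the cubic term of the binomial expansion for larger even ones; the
    slack is \<open>2 * D\<^sup>2 * (b - D)\<^sup>2\<close>.\<close>
  have pw: "(b + D)^4 \<le> b^4 + 4 * b^3 * D + 8 * b\<^sup>2 * D\<^sup>2 + 3 * D^4" for D :: real
  proof -
    have "b^4 + 4 * b^3 * D + 8 * b\<^sup>2 * D\<^sup>2 + 3 * D^4 - (b + D)^4 = 2 * D\<^sup>2 * (b - D)\<^sup>2"
      by (simp add: power2_eq_square power3_eq_cube power4_eq_xxxx algebra_simps)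
    then show ?thesis by (metis diff_ge_0_iff_ge mult_nonneg_nonneg zero_le_numeral zero_le_power2)
  qed
  let ?h = "\<lambda>y. b^4 + 4 * b^3 * (y - a) + 8 * b\<^sup>2 * (y - a)\<^sup>2 + 3 * (y - a)^4"
  have int: "integrable (step_law r a) ?h"
    using m1 m2 m4 by (intro Bochner_Integration.integrable_add integrable_mult_right) auto
  have hpos: "?h y \<ge> 0" for y
    using pw[of "y - a"] by (meson order_trans zero_le_even_power even_numeral)
  have "(\<integral>\<^sup>+y. ennreal ((b + (y - a))^4) \<partial>step_law r a) \<le> (\<integral>\<^sup>+y. ennreal (?h y) \<partial>step_law r a)"
    using pw by (intro nn_integral_mono ennreal_leI) simp
  also have "\<dots> = ennreal (\<integral>y. ?h y \<partial>step_law r a)"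
    by (intro nn_integral_eq_integral int AE_I2 hpos)
  also have "(\<integral>y. ?h y \<partial>step_law r a) = b^4 + 4 * b^3 * ((\<integral>y. y \<partial>step_law r a) - a) 
     + 8 * b\<^sup>2 * (\<integral>y. (y - a)\<^sup>2 \<partial>step_law r a) + 3 * (\<integral>y. (y - a)^4 \<partial>step_law r a)"
    using m1 m2 m4 by (simp add: K.prob_space[simplified])
  also have "\<dots> \<le> b^4 + 8 * b\<^sup>2 * (4 * r\<^sup>2) + 3 * (144 * r^4)"
    unfolding i1 using i2 i4 by (intro add_mono mult_left_mono) auto
  \<comment> \<open>Since \<open>3 * 144 = 432\<close> is below \<open>32\<^sup>2 / 2 = 512\<close>,
    the second-order Taylor polynomial of \<open>exp (32 * r\<^sup>2)\<close> dominates.\<close>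
  also have "\<dots> \<le> b^4 * (1 + 32 * r\<^sup>2 + (32 * r\<^sup>2)\<^sup>2 / 2)"
  proof -
    have "b\<^sup>2 \<le> b^4" "1 \<le> b^4" using b by (auto intro: power_increasing)
    then have "b\<^sup>2 * (32 * r\<^sup>2) \<le> b^4 * (32 * r\<^sup>2)" "1 * (432 * r^4) \<le> b^4 * (512 * r^4)"
      using r by (auto intro!: mult_mono)
    then show ?thesis by (simp add: algebra_simps power2_eq_square power4_eq_xxxx)
  qed
  also have "\<dots> \<le> b^4 * exp (32 * r\<^sup>2)"
    using exp_lower_Taylor_quadratic[of "32 * r\<^sup>2"] r by (intro mult_left_mono) auto
  finally show ?thesis by (simp add: mult.commute ennreal_leI)
qed

end

section \<open>The Markov chain\<close>

text \<open>One chain with a fixed step size. Along a null sequence the bounds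
  \<open>\<gamma> \<le> 1\<close> and \<open>\<gamma> * L \<le> 1\<close> hold from some index on;
  the second one keeps drifted positions nonnegative.\<close>

locale sticky_chain = prob_space P for P :: "'a measure" +
  fixes \<sigma> c L w0 \<gamma> :: real and \<kappa> :: "real \<Rightarrow> real" and X :: "nat \<Rightarrow> 'a \<Rightarrow> real"
  assumes sigma_pos: "\<sigma> > 0" and c_nonneg: "c \<ge> 0"
    and lipschitz: "L-lipschitz_on {0..} \<kappa>" and kappa_0: "\<kappa> 0 = 0"
    and kappa_measurable[measurable]: "\<kappa> \<in> borel_measurable borel"
    and gamma_pos: "\<gamma> > 0" and gamma_le_1: "\<gamma> \<le> 1" and gamma_L: "\<gamma> * L \<le> 1"
    and w0_nonneg: "w0 \<ge> 0"
    and X_measurable[measurable]: "\<And>k. X k \<in> borel_measurable P"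
    and X_0: "\<And>\<omega>. \<omega> \<in> space P \<Longrightarrow> X 0 \<omega> = w0"
    and markov: "\<And>k A B. A \<in> sets borel \<Longrightarrow>
       B \<in> sigma_sets (space P) {X i -` D \<inter> space P | i D. i \<le> k \<and> D \<in> sets borel} \<Longrightarrow>
       measure P (B \<inter> {\<omega> \<in> space P. X (Suc k) \<omega> \<in> A}) = (\<integral>\<omega>\<in>B. Qk \<sigma> c \<kappa> \<gamma> (X k \<omega>) A \<partial>P)"
begin

definition r :: real where "r = \<sigma> * sqrt \<gamma>"

lemma r_pos: "r > 0" and r_sq: "r\<^sup>2 = \<sigma>\<^sup>2 * \<gamma>" and r_4: "r^4 = \<sigma>^4 * \<gamma>\<^sup>2"
proof -
  show "r > 0" and *: "r\<^sup>2 = \<sigma>\<^sup>2 * \<gamma>"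
    using sigma_pos gamma_pos by (auto simp: r_def power_mult_distrib)
  have "r^4 = (r\<^sup>2)\<^sup>2" by simp
  then show "r^4 = \<sigma>^4 * \<gamma>\<^sup>2" unfolding * by (simp add: power_mult_distrib)
qed

lemma L_nonneg: "L \<ge> 0" using lipschitz by (rule lipschitz_on_nonneg)

text \<open>The natural filtration, packaged as measure spaces so that dependence on the past
  becomes ordinary measurability.\<close>

definition Fil :: "nat \<Rightarrow> 'a measure" where
  "Fil k = sigma (space P) {X i -` D \<inter> space P | i D. i \<le> k \<and> D \<in> sets borel}"

lemma space_Fil[simp]: "space (Fil k) = space P"
  and sets_Fil: "sets (Fil k) = sigma_sets (space P) {X i -` D \<inter> space P | i D. i \<le> k \<and> D \<in> sets borel}"
  unfolding Fil_def by (auto simp: space_measure_of_conv intro!: sets_measure_of)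

lemma subalgebra_Fil: "subalgebra P (Fil k)"
  unfolding subalgebra_def sets_Fil
  by (auto intro!: sets.sigma_sets_subset measurable_sets[OF X_measurable])

lemma Fil_measurable: "f \<in> measurable (Fil k) N \<Longrightarrow> f \<in> measurable P N"
  by (rule measurable_from_subalg[OF subalgebra_Fil])

lemma X_Fil: "i \<le> k \<Longrightarrow> X i \<in> borel_measurable (Fil k)"
  by (rule measurableI) (auto simp: sets_Fil)

lemma Fil_mono: "j \<le> k \<Longrightarrow> f \<in> measurable (Fil j) N \<Longrightarrow> f \<in> measurable (Fil k) N"
proof -
  assume jk: "j \<le> k" and f: "f \<in> measurable (Fil j) N"
  have "subalgebra (Fil k) (Fil j)"
    unfolding subalgebra_def using jk by (force simp: sets_Fil intro!: sigma_sets_mono')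
  then show ?thesis using f by (rule measurable_from_subalg)
qed

definition drift :: "nat \<Rightarrow> 'a \<Rightarrow> real" where
  "drift k \<omega> = tau \<kappa> \<gamma> (X k \<omega>) + \<gamma> * c"

lemma drift_Fil: "i \<le> k \<Longrightarrow> drift i \<in> borel_measurable (Fil k)"
  unfolding drift_def[abs_def] tau_def using X_Fil[of i k] by measurable

lemma drift_measurable[measurable]: "drift k \<in> borel_measurable P"
  using drift_Fil[of k k] by (auto intro: Fil_measurable)

lemma Qk_eq:
  assumes [measurable]: "A \<in> sets borel" and a_def: "a = tau \<kappa> \<gamma> w + \<gamma> * c"
  shows "Qk \<sigma> c \<kappa> \<gamma> w A = (\<integral>g. indicator A 0 * overlap (a / r) g
      + indicator A (a - 2 * r * g) * (phi g - overlap (a / r) g) \<partial>lborel)"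
    and "integrable lborel (\<lambda>g. indicator A 0 * overlap (a / r) g
      + indicator A (a - 2 * r * g) * (phi g - overlap (a / r) g))"
proof -
  have o: "integrable lborel (\<lambda>g. overlap (a / r) g)"
    using integrable_overlap_power[of 0] by simp
  have i: "integrable lborel (\<lambda>g. indicator A (a - 2 * r * g) * (phi g - overlap (a / r) g))"
  proof (rule Bochner_Integration.integrable_bound)
    show "integrable lborel phi" using phi_moments(1) by (simp add: has_bochner_integral_iff)
    have "\<bar>indicator A (a - 2 * r * g) * (phi g - overlap (a / r) g)\<bar> \<le> \<bar>phi g\<bar>" for g
      using overlap_le[of "a / r" g] overlap_nonneg[of "a / r" g] by (simp split: split_indicator)
    then show "AE g in lborel. norm (indicator A (a - 2 * r * g) * (phi g - overlap (a / r) g)) \<le> norm (phi g)"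
      by simp
  qed measurable
  have 1: "pbar (\<sigma>\<^sup>2 * \<gamma>) a g * phi g = overlap (a / r) g" for g
    unfolding r_def using sigma_pos gamma_pos by (rule pbar_phi)
  have 2: "indicator A (a - 2 * \<sigma> * sqrt \<gamma> * g) * (1 - pbar (\<sigma>\<^sup>2 * \<gamma>) a g) * phi g =
     indicator A (a - 2 * r * g) * (phi g - overlap (a / r) g)" for g
    unfolding 1[symmetric] by (simp add: r_def algebra_simps)
  show "Qk \<sigma> c \<kappa> \<gamma> w A = (\<integral>g. indicator A 0 * overlap (a / r) g
      + indicator A (a - 2 * r * g) * (phi g - overlap (a / r) g) \<partial>lborel)"
    unfolding Qk_def Let_def a_def[symmetric] 1 2 using o i by simp
  show "integrable lborel (\<lambda>g. indicator A 0 * overlap (a / r) g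
      + indicator A (a - 2 * r * g) * (phi g - overlap (a / r) g))"
    using o i by simp
qed

lemma Qk_step_law:
  assumes [measurable]: "A \<in> sets borel"
  shows "ennreal (Qk \<sigma> c \<kappa> \<gamma> (X k \<omega>) A) = (\<integral>\<^sup>+y. indicator A y \<partial>step_law r (drift k \<omega>))"
    and "0 \<le> Qk \<sigma> c \<kappa> \<gamma> (X k \<omega>) A" and "Qk \<sigma> c \<kappa> \<gamma> (X k \<omega>) A \<le> 1"
proof -
  let ?a = "drift k \<omega>"
  let ?f = "\<lambda>g. indicator A 0 * overlap (?a / r) g
      + indicator A (?a - 2 * r * g) * (phi g - overlap (?a / r) g)"
  have Q: "Qk \<sigma> c \<kappa> \<gamma> (X k \<omega>) A = (\<integral>g. ?f g \<partial>lborel)" "integrable lborel ?f"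
    using Qk_eq[OF assms drift_def] by auto
  have f: "0 \<le> ?f g" "?f g \<le> phi g" for g
    using overlap_le[of "?a / r" g] overlap_nonneg[of "?a / r" g] by (auto split: split_indicator)
  show "0 \<le> Qk \<sigma> c \<kappa> \<gamma> (X k \<omega>) A" unfolding Q by (intro integral_nonneg_AE) (use f in auto)
  have "(\<integral>g. ?f g \<partial>lborel) \<le> (\<integral>g. phi g \<partial>lborel)"
    using Q f phi_moments(1) by (intro integral_mono) (auto simp: has_bochner_integral_iff)
  then show "Qk \<sigma> c \<kappa> \<gamma> (X k \<omega>) A \<le> 1"
    unfolding Q using phi_moments(1) by (simp add: has_bochner_integral_iff)
  have "(\<integral>\<^sup>+y. indicator A y \<partial>step_law r ?a) = (\<integral>\<^sup>+g. ennreal (?f g) \<partial>lborel)"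
    by (subst nn_integral_step_law)
       (auto intro!: nn_integral_cong split: split_indicator simp: overlap_le overlap_nonneg 
         ennreal_plus[symmetric] simp del: ennreal_plus)
  also have "\<dots> = ennreal (Qk \<sigma> c \<kappa> \<gamma> (X k \<omega>) A)"
    unfolding Q using Q(2) f by (intro nn_integral_eq_integral) auto
  finally show "ennreal (Qk \<sigma> c \<kappa> \<gamma> (X k \<omega>) A) = (\<integral>\<^sup>+y. indicator A y \<partial>step_law r ?a)" ..
qed

text \<open>The Markov property is given for events \<open>B\<close> of the past and sets
  \<open>A\<close> of next positions. The rectangles \<open>B \<times> A\<close> form an
  intersection-stable generator, so it determines the joint law of the past and the next position,
  and with it the integral of every nonnegative jointly measurable function.\<close>

lemma nn_integral_step:
  assumes f: "f \<in> borel_measurable (Fil k \<Otimes>\<^sub>M borel)"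
  shows "(\<integral>\<^sup>+\<omega>. f (\<omega>, X (Suc k) \<omega>) \<partial>P) = (\<integral>\<^sup>+\<omega>. \<integral>\<^sup>+y. f (\<omega>, y) \<partial>step_law r (drift k \<omega>) \<partial>P)"
proof -
  let ?F = "Fil k \<Otimes>\<^sub>M (borel :: real measure)"
  let ?Z = "count_space (UNIV :: bool set) \<Otimes>\<^sub>M (lborel :: real measure)"
  interpret Z: sigma_finite_measure ?Z
    by (intro sigma_finite_pair_measure sigma_finite_measure_count_space_countable 
        lborel.sigma_finite_measure_axioms) simp
  \<comment> \<open>The first coordinate is observed through \<open>Fil k\<close> only, because the
    Markov property covers rectangles over past events and not over general events of
    \<open>P\<close>.\<close>
  have idF: "(\<lambda>x. x) \<in> measurable P (Fil k)"
    using subalgebra_Fil by (auto simp: measurable_def subalgebra_def)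
  define d where "d = (\<lambda>(\<omega>, b, g). ennreal (if b then overlap (drift k \<omega> / r) g
     else phi g - overlap (drift k \<omega> / r) g))"
  define T where "T = (\<lambda>(\<omega>, b, g). (\<omega>, if b then 0 else drift k \<omega> - 2 * r * g))"
  have d[measurable]: "d \<in> borel_measurable (P \<Otimes>\<^sub>M ?Z)" unfolding d_def by measurable
  have T[measurable]: "T \<in> measurable (P \<Otimes>\<^sub>M ?Z) ?F" 
  proof -
    have "(\<lambda>x. fst x) \<in> measurable (P \<Otimes>\<^sub>M ?Z) (Fil k)"
      by (rule measurable_compose[OF measurable_fst idF])
    then show ?thesis
      unfolding T_def split_beta by (rule measurable_Pair) measurable
  qed
  have pr[measurable]: "(\<lambda>\<omega>. (\<omega>, X (Suc k) \<omega>)) \<in> measurable P ?F"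
    using idF by (rule measurable_Pair) measurable
  \<comment> \<open>The candidate joint law: the flag and the Gaussian variable of
    \<open>step_law\<close> are adjoined to \<open>P\<close>. Integrating them out at a fixed
    \<omega> gives \<open>step_law r (drift k \<omega>)\<close>.\<close>
  define N where "N = distr (density (P \<Otimes>\<^sub>M ?Z) d) ?F T"
  have N: "(\<integral>\<^sup>+x. h x \<partial>N) = (\<integral>\<^sup>+\<omega>. \<integral>\<^sup>+y. h (\<omega>, y) \<partial>step_law r (drift k \<omega>) \<partial>P)"
    if [measurable]: "h \<in> borel_measurable ?F" for h
  proof -
    have "(\<integral>\<^sup>+x. h x \<partial>N) = (\<integral>\<^sup>+x. d x * h (T x) \<partial>(P \<Otimes>\<^sub>M ?Z))"
      unfolding N_def by (simp add: nn_integral_distr nn_integral_density)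
    also have "\<dots> = (\<integral>\<^sup>+\<omega>. \<integral>\<^sup>+z. d (\<omega>, z) * h (T (\<omega>, z)) \<partial>?Z \<partial>P)"
      by (subst Z.nn_integral_fst[symmetric]) simp_all
    also have "\<dots> = (\<integral>\<^sup>+\<omega>. \<integral>\<^sup>+y. h (\<omega>, y) \<partial>step_law r (drift k \<omega>) \<partial>P)"
    proof (rule nn_integral_cong)
      fix \<omega> assume "\<omega> \<in> space P"
      then have hm: "(\<lambda>y. h (\<omega>, y)) \<in> borel_measurable borel"
        using measurable_compose[OF measurable_Pair1' that, of \<omega>] by simp
      show "(\<integral>\<^sup>+z. d (\<omega>, z) * h (T (\<omega>, z)) \<partial>?Z) = (\<integral>\<^sup>+y. h (\<omega>, y) \<partial>step_law r (drift k \<omega>))"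
        unfolding nn_integral_step_law_pair[OF hm]
        by (rule nn_integral_cong) (simp add: d_def T_def split_beta)
    qed
    finally show ?thesis .
  qed
  have "distr P ?F (\<lambda>\<omega>. (\<omega>, X (Suc k) \<omega>)) = N"
  proof (rule measure_eqI_generator_eq[OF Int_stable_pair_measure_generator[of "Fil k" borel], where 
        \<Omega> = "space ?F" and A = "\<lambda>_. space P \<times> UNIV"])
    show "{a \<times> b |a b. a \<in> sets (Fil k) \<and> b \<in> sets borel} \<subseteq> Pow (space ?F)"
      using sets.space_closed[of "Fil k"] by (auto simp: space_pair_measure)
    show "sets (distr P ?F (\<lambda>\<omega>. (\<omega>, X (Suc k) \<omega>))) = 
        sigma_sets (space ?F) {a \<times> b |a b. a \<in> sets (Fil k) \<and> b \<in> sets borel}"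
      "sets N = sigma_sets (space ?F) {a \<times> b |a b. a \<in> sets (Fil k) \<and> b \<in> sets borel}"
      by (simp_all add: N_def sets_pair_measure space_pair_measure)
    show "range (\<lambda>_. space P \<times> UNIV) \<subseteq> {a \<times> b |a b. a \<in> sets (Fil k) \<and> b \<in> sets (borel :: real measure)}"
      using sets.top[of "Fil k"]
      by (intro image_subsetI CollectI exI[of _ "space P"] exI[of _ UNIV]) simp
    show "(\<Union>i. space P \<times> UNIV) = space ?F" by (simp add: space_pair_measure)
    show "emeasure (distr P ?F (\<lambda>\<omega>. (\<omega>, X (Suc k) \<omega>))) (space P \<times> UNIV) \<noteq> \<infinity>"
      using finite_measure.emeasure_finite[OF finite_measure_distr[OF pr]] by auto
    fix E assume "E \<in> {a \<times> b |a b. a \<in> sets (Fil k) \<and> b \<in> sets (borel :: real measure)}"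
    then obtain B A where E: "E = B \<times> A" and B: "B \<in> sets (Fil k)" and A[measurable]: "A \<in> sets borel"
      by auto
    have BP[measurable]: "B \<in> sets P" using B subalgebra_Fil by (auto simp: subalgebra_def)
    have E'[measurable]: "E \<in> sets ?F" unfolding E using B A by auto
    have "emeasure N E = (\<integral>\<^sup>+x. indicator E x \<partial>N)" by (simp add: N_def)
    also have "\<dots> = (\<integral>\<^sup>+\<omega>. \<integral>\<^sup>+y. indicator E (\<omega>, y) \<partial>step_law r (drift k \<omega>) \<partial>P)"
      by (rule N) simp
    also have "\<dots> = (\<integral>\<^sup>+\<omega>. indicator B \<omega> * ennreal (Qk \<sigma> c \<kappa> \<gamma> (X k \<omega>) A) \<partial>P)"
    proof (rule nn_integral_cong)
      fix \<omega>
      show "(\<integral>\<^sup>+y. indicator E (\<omega>, y) \<partial>step_law r (drift k \<omega>)) = indicator B \<omega> * ennreal (Qk \<sigma> c \<kappa> \<gamma> (X k \<omega>) A)"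
        unfolding Qk_step_law(1)[OF A] E indicator_times by (cases "\<omega> \<in> B") simp_all
    qed
    finally have N_E: "emeasure N E = (\<integral>\<^sup>+\<omega>. indicator B \<omega> * ennreal (Qk \<sigma> c \<kappa> \<gamma> (X k \<omega>) A) \<partial>P)" .
    have Qm[measurable]: "(\<lambda>\<omega>. Qk \<sigma> c \<kappa> \<gamma> (X k \<omega>) A) \<in> borel_measurable P"
    proof -
      have "(\<lambda>\<omega>. \<integral>g. indicator A 0 * overlap (drift k \<omega> / r) g
         + indicator A (drift k \<omega> - 2 * r * g) * (phi g - overlap (drift k \<omega> / r) g) \<partial>lborel) \<in> borel_measurable P"
        by measurable
      then show ?thesis by (simp add: Qk_eq(1)[OF A drift_def])
    qed
    have "emeasure (distr P ?F (\<lambda>\<omega>. (\<omega>, X (Suc k) \<omega>))) E 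
        = measure P (B \<inter> {\<omega> \<in> space P. X (Suc k) \<omega> \<in> A})"
      using sets.sets_into_space[OF BP]
      by (subst emeasure_distr[OF pr E']) (auto simp: E emeasure_eq_measure intro!: arg_cong[where f="measure P"])
    also have "\<dots> = ennreal (\<integral>\<omega>. indicator B \<omega> * Qk \<sigma> c \<kappa> \<gamma> (X k \<omega>) A \<partial>P)"
      using markov[OF A] B unfolding sets_Fil set_lebesgue_integral_def by simp
    also have "\<dots> = (\<integral>\<^sup>+\<omega>. ennreal (indicator B \<omega> * Qk \<sigma> c \<kappa> \<gamma> (X k \<omega>) A) \<partial>P)"
      by (intro nn_integral_eq_integral[symmetric] integrable_const_bound[of _ 1])
         (auto simp: Qk_step_law(2,3)[OF A] split: split_indicator)
    also have "\<dots> = emeasure N E"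
      unfolding N_E by (auto split: split_indicator intro!: nn_integral_cong)
    finally show "emeasure (distr P ?F (\<lambda>\<omega>. (\<omega>, X (Suc k) \<omega>))) E = emeasure N E" .
  qed
  from arg_cong[OF this, of "\<lambda>M. \<integral>\<^sup>+x. f x \<partial>M"] show ?thesis
    using f by (simp add: nn_integral_distr N)
qed

end

section \<open>Nonnegativity of the chain and moment bounds uniform in the step size\<close>

context sticky_chain
begin

lemma kappa_bound: "w \<ge> 0 \<Longrightarrow> \<bar>\<kappa> w\<bar> \<le> L * w"
  using lipschitz_onD[OF lipschitz, of w 0] by (simp add: kappa_0 dist_real_def)

text \<open>As \<open>\<kappa> 0 = 0\<close>, the Lipschitz bound shows that a position
  \<open>w \<ge> 0\<close> is moved down by at most \<open>\<gamma> * L * w\<close>, which is at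
  most \<open>w\<close>.\<close>

lemma drift_nonneg: "X k \<omega> \<ge> 0 \<Longrightarrow> drift k \<omega> \<ge> 0"
proof -
  assume X: "X k \<omega> \<ge> 0"
  have "\<gamma> * \<bar>\<kappa> (X k \<omega>)\<bar> \<le> \<gamma> * (L * X k \<omega>)"
    using kappa_bound[OF X] gamma_pos by (intro mult_left_mono) auto
  also have "\<dots> \<le> 1 * X k \<omega>" unfolding mult.assoc[symmetric] using gamma_L X by (intro mult_right_mono)
  finally have "- (\<gamma> * \<kappa> (X k \<omega>)) \<le> X k \<omega>"
    using gamma_pos mult_left_mono[OF abs_ge_minus_self[of "\<kappa> (X k \<omega>)"], of \<gamma>] by simp
  then show ?thesis using gamma_pos c_nonneg by (simp add: drift_def tau_def)
qed

lemma drift_diff: "X k \<omega> \<ge> 0 \<Longrightarrow> \<bar>drift k \<omega> - X k \<omega>\<bar> \<le> \<gamma> * (L + c) * (1 + X k \<omega>)"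
proof -
  assume X: "X k \<omega> \<ge> 0"
  have "\<bar>\<kappa> (X k \<omega>) + c\<bar> \<le> (L + c) * (1 + X k \<omega>)"
    using kappa_bound[OF X] c_nonneg X L_nonneg mult_nonneg_nonneg[OF c_nonneg X]
    unfolding distrib_left distrib_right by linarith
  then have "\<gamma> * \<bar>\<kappa> (X k \<omega>) + c\<bar> \<le> \<gamma> * ((L + c) * (1 + X k \<omega>))"
    using gamma_pos by (intro mult_left_mono) auto
  moreover have "drift k \<omega> - X k \<omega> = \<gamma> * (\<kappa> (X k \<omega>) + c)"
    by (simp add: drift_def tau_def distrib_left)
  then have "\<bar>drift k \<omega> - X k \<omega>\<bar> = \<gamma> * \<bar>\<kappa> (X k \<omega>) + c\<bar>"
    using gamma_pos by (simp add: abs_mult)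
  ultimately show ?thesis by (simp add: mult.assoc)
qed

text \<open>By induction: a nonnegative position has a nonnegative drifted position, and from there
  \<open>step_law\<close> charges only the half-line.\<close>

lemma AE_X_nonneg: "AE \<omega> in P. X k \<omega> \<ge> 0"
proof (induction k)
  case 0
  then show ?case using X_0 w0_nonneg by auto
next
  case (Suc k)
  have "(\<integral>\<^sup>+\<omega>. indicator {..<0} (X (Suc k) \<omega>) \<partial>P) =
    (\<integral>\<^sup>+\<omega>. \<integral>\<^sup>+y. indicator {..<0} y \<partial>step_law r (drift k \<omega>) \<partial>P)"
    using nn_integral_step[of "\<lambda>(\<omega>, y). indicator {..<0} y" k] by simp
  also have "\<dots> = (\<integral>\<^sup>+\<omega>. 0 \<partial>P)"
  proof (rule nn_integral_cong_AE)
    show "AE \<omega> in P. (\<integral>\<^sup>+y. indicator {..<0} y \<partial>step_law r (drift k \<omega>)) = 0"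
      using Suc
    proof eventually_elim
      case (elim \<omega>)
      have "AE y in step_law r (drift k \<omega>). indicator {..<0} y = (0 :: ennreal)"
        using AE_step_law_nonneg[OF r_pos drift_nonneg[OF elim]] by eventually_elim simp
      then show ?case by (subst nn_integral_0_iff_AE) auto
    qed
  qed
  finally have "AE \<omega> in P. indicator {..<0} (X (Suc k) \<omega>) = (0 :: ennreal)"
    by (subst nn_integral_0_iff_AE[symmetric]) auto
  then show ?case by eventually_elim (auto simp: indicator_def split: if_splits)
qed

lemma AE_X_all_nonneg: "AE \<omega> in P. \<forall>k. X k \<omega> \<ge> 0"
  using AE_X_nonneg by (simp add: AE_all_countable)

text \<open>A bound for the fourth moment of \<open>1 + X k\<close> up to time \<open>T\<close>. Per
  unit of time the exponent collects \<open>4 * (L + c)\<close>, from the fourth power of the drift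
  factor \<open>exp (\<gamma> * (L + c))\<close>, and \<open>32 * \<sigma>\<^sup>2\<close>, from
  \<open>step_law_powers\<close>. It is free of the step size, which is what the limit
  requires.\<close>

definition mom :: "real \<Rightarrow> real" where
  "mom T = exp ((4 * (L + c) + 32 * \<sigma>\<^sup>2) * T) * (1 + w0)^4"

lemma mom_mono: "s \<le> t \<Longrightarrow> mom s \<le> mom t"
  using L_nonneg c_nonneg by (auto simp: mom_def intro!: mult_right_mono mult_left_mono)

lemma mom_nonneg: "mom t \<ge> 0"
  by (simp add: mom_def)

text \<open>Discrete Gronwall, carried out with nonnegative integrals since integrability of the
  fourth power is a consequence of this bound.\<close>

lemma nn_X_moment: "(\<integral>\<^sup>+\<omega>. ennreal ((1 + X k \<omega>)^4) \<partial>P) \<le> ennreal (mom (\<gamma> * k))"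
proof (induction k)
  case 0
  have "(\<integral>\<^sup>+\<omega>. ennreal ((1 + X 0 \<omega>)^4) \<partial>P) = (\<integral>\<^sup>+\<omega>. ennreal ((1 + w0)^4) \<partial>P)"
    by (intro nn_integral_cong) (simp add: X_0)
  then show ?case by (simp add: mom_def emeasure_space_1)
next
  case (Suc k)
  let ?q = "exp ((4 * (L + c) + 32 * \<sigma>\<^sup>2) * \<gamma>)"
  have "(\<integral>\<^sup>+\<omega>. ennreal ((1 + X (Suc k) \<omega>)^4) \<partial>P) =
     (\<integral>\<^sup>+\<omega>. \<integral>\<^sup>+y. ennreal ((1 + y)^4) \<partial>step_law r (drift k \<omega>) \<partial>P)"
    using nn_integral_step[of "\<lambda>(\<omega>, y). ennreal ((1 + y)^4)" k] by simp
  also have "\<dots> \<le> (\<integral>\<^sup>+\<omega>. ennreal ?q * ennreal ((1 + X k \<omega>)^4) \<partial>P)"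
  proof (rule nn_integral_mono_AE)
    show "AE \<omega> in P. (\<integral>\<^sup>+y. ennreal ((1 + y)^4) \<partial>step_law r (drift k \<omega>)) \<le> ennreal ?q * ennreal ((1 + X k \<omega>)^4)"
      using AE_X_nonneg[of k]
    proof eventually_elim
      case (elim \<omega>)
      note a = drift_nonneg[OF elim]
      have "1 + drift k \<omega> \<le> (1 + \<gamma> * (L + c)) * (1 + X k \<omega>)"
        using drift_diff[OF elim] by (simp add: algebra_simps)
      also have "\<dots> \<le> exp (\<gamma> * (L + c)) * (1 + X k \<omega>)"
        using elim by (intro mult_right_mono exp_ge_add_one_self) auto
      finally have "(1 + drift k \<omega>)^4 \<le> (exp (\<gamma> * (L + c)) * (1 + X k \<omega>))^4"
        using a by (intro power_mono) auto
      also have "\<dots> = exp (4 * (\<gamma> * (L + c))) * (1 + X k \<omega>)^4"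
        by (simp add: power_mult_distrib exp_of_nat_mult[of 4, simplified])
      finally have "exp (32 * r\<^sup>2) * (1 + drift k \<omega>)^4 \<le> exp (32 * r\<^sup>2) * (exp (4 * (\<gamma> * (L + c))) * (1 + X k \<omega>)^4)"
        by simp
      also have "\<dots> = ?q * (1 + X k \<omega>)^4"
        by (simp add: r_sq exp_add[symmetric] algebra_simps)
      finally have *: "exp (32 * r\<^sup>2) * (1 + drift k \<omega>)^4 \<le> ?q * (1 + X k \<omega>)^4" .
      have "(\<integral>\<^sup>+y. ennreal ((1 + y)^4) \<partial>step_law r (drift k \<omega>)) \<le> ennreal (exp (32 * r\<^sup>2) * (1 + drift k \<omega>)^4)"
        using step_law_powers[OF r_pos a, of "1 + drift k \<omega>"] a by simp
      also have "\<dots> \<le> ennreal (?q * (1 + X k \<omega>)^4)" using * by (rule ennreal_leI)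
      finally show ?case by (simp add: ennreal_mult)
    qed
  qed
  also have "\<dots> = ennreal ?q * (\<integral>\<^sup>+\<omega>. ennreal ((1 + X k \<omega>)^4) \<partial>P)"
    by (rule nn_integral_cmult) measurable
  also have "\<dots> \<le> ennreal ?q * ennreal (mom (\<gamma> * k))"
    using Suc by (intro mult_left_mono) auto
  also have "\<dots> = ennreal (mom (\<gamma> * Suc k))"
    by (simp add: ennreal_mult[symmetric] mom_def exp_add[symmetric] algebra_simps)
  finally show ?case .
qed

lemma integrable_X4: "integrable P (\<lambda>\<omega>. (1 + X k \<omega>)^4)"
  using nn_X_moment[of k] by (intro integrableI_bounded) (auto simp: le_less_trans)

lemma X_moment: "\<gamma> * k \<le> T \<Longrightarrow> (\<integral>\<omega>. (1 + X k \<omega>)^4 \<partial>P) \<le> mom T"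
  using nn_X_moment[of k] mom_mono[of "\<gamma> * k" T] mom_nonneg[of "\<gamma> * k"] 
  by (subst integral_eq_nn_integral) (auto simp: enn2real_leI intro: order_trans[rotated])

lemma one_le_X4: "X k \<omega> \<ge> 0 \<Longrightarrow> 1 + X k \<omega> \<le> (1 + X k \<omega>)^4" "X k \<omega> \<ge> 0 \<Longrightarrow> (1 + X k \<omega>)\<^sup>2 \<le> (1 + X k \<omega>)^4"
  using self_le_power[of "1 + X k \<omega>" 4] power_increasing[of 2 4 "1 + X k \<omega>"] by auto

lemma integrable_X4_bound:
  assumes [measurable]: "f \<in> borel_measurable P"
    and "\<And>\<omega>. X k \<omega> \<ge> 0 \<Longrightarrow> \<bar>f \<omega>\<bar> \<le> C * (1 + X k \<omega>)^4"
  shows "integrable P f"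
proof (rule Bochner_Integration.integrable_bound[of _ "\<lambda>\<omega>. C * (1 + X k \<omega>)^4"])
  show "AE \<omega> in P. norm (f \<omega>) \<le> norm (C * (1 + X k \<omega>)^4)"
    using AE_X_nonneg[of k]
  proof eventually_elim
    case (elim \<omega>)
    show ?case using assms(2)[OF elim] by (simp add: order_trans[OF _ abs_ge_self])
  qed
qed (simp_all add: integrable_X4)

lemma integrable_X: "integrable P (X k)" and integrable_X2: "integrable P (\<lambda>\<omega>. (X k \<omega>)\<^sup>2)"
  and integrable_1X2: "integrable P (\<lambda>\<omega>. (1 + X k \<omega>)\<^sup>2)"
proof -
  have "X k \<omega> \<ge> 0 \<Longrightarrow> \<bar>X k \<omega>\<bar> \<le> 1 * (1 + X k \<omega>)^4" "X k \<omega> \<ge> 0 \<Longrightarrow> \<bar>(X k \<omega>)\<^sup>2\<bar> \<le> 1 * (1 + X k \<omega>)^4"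
    "X k \<omega> \<ge> 0 \<Longrightarrow> \<bar>(1 + X k \<omega>)\<^sup>2\<bar> \<le> 1 * (1 + X k \<omega>)^4" for \<omega>
    using one_le_X4[of k \<omega>] power_mono[of "X k \<omega>" "1 + X k \<omega>" 2] 
    by (simp_all, linarith?)
  then show "integrable P (X k)" "integrable P (\<lambda>\<omega>. (X k \<omega>)\<^sup>2)" "integrable P (\<lambda>\<omega>. (1 + X k \<omega>)\<^sup>2)"
    by (auto intro!: integrable_X4_bound[where k = k and C = 1])
qed

lemma X_moment_1: "\<gamma> * k \<le> T \<Longrightarrow> (\<integral>\<omega>. 1 + X k \<omega> \<partial>P) \<le> mom T"
proof -
  assume T: "\<gamma> * k \<le> T"
  have "(\<integral>\<omega>. 1 + X k \<omega> \<partial>P) \<le> (\<integral>\<omega>. (1 + X k \<omega>)^4 \<partial>P)"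
    using AE_X_nonneg[of k] integrable_X[of k] integrable_X4[of k]
    by (intro integral_mono_AE) (auto simp: one_le_X4)
  then show ?thesis using X_moment[OF T] by linarith
qed

lemma X_moment_2: "\<gamma> * k \<le> T \<Longrightarrow> (\<integral>\<omega>. (1 + X k \<omega>)\<^sup>2 \<partial>P) \<le> mom T"
proof -
  assume T: "\<gamma> * k \<le> T"
  have "(\<integral>\<omega>. (1 + X k \<omega>)\<^sup>2 \<partial>P) \<le> (\<integral>\<omega>. (1 + X k \<omega>)^4 \<partial>P)"
    using AE_X_nonneg[of k] integrable_1X2[of k] integrable_X4[of k]
    by (intro integral_mono_AE) (auto simp: one_le_X4)
  then show ?thesis using X_moment[OF T] by linarith
qed

lemma integrable_drift2: "integrable P (\<lambda>\<omega>. (drift k \<omega>)\<^sup>2)"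
proof -
  have *: "\<bar>drift k \<omega>\<bar> \<le> (1 + \<gamma> * (L + c)) * (1 + X k \<omega>)" if "X k \<omega> \<ge> 0" for \<omega>
    using drift_diff[OF that] drift_nonneg[OF that] that by (simp add: algebra_simps)
  have 2: "\<bar>(drift k \<omega>)\<^sup>2\<bar> \<le> (1 + \<gamma> * (L + c))\<^sup>2 * (1 + X k \<omega>)^4" if "X k \<omega> \<ge> 0" for \<omega>
  proof -
    have "(drift k \<omega>)\<^sup>2 \<le> ((1 + \<gamma> * (L + c)) * (1 + X k \<omega>))\<^sup>2"
      using *[OF that] by (intro power2_le_iff_abs_le[THEN iffD2]) (auto intro: order_trans[OF abs_ge_zero])
    also have "\<dots> \<le> (1 + \<gamma> * (L + c))\<^sup>2 * (1 + X k \<omega>)^4"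
      unfolding power_mult_distrib using one_le_X4[OF that] by (intro mult_left_mono) auto
    finally show ?thesis by simp
  qed
  show ?thesis
    using 2 by (auto intro!: integrable_X4_bound[where k = k])
qed

section \<open>Conditional moments of the compensated increments, tested against functions of the
  past\<close>

definition D :: "nat \<Rightarrow> 'a \<Rightarrow> real" where
  "D k \<omega> = X (Suc k) \<omega> - drift k \<omega>"

lemma D_measurable[measurable]: "D k \<in> borel_measurable P"
  unfolding D_def[abs_def] by measurable

lemma D_Fil: "k < m \<Longrightarrow> D k \<in> borel_measurable (Fil m)"
  unfolding D_def[abs_def] using X_Fil[of "Suc k" m] drift_Fil[of k m] by measurable

text \<open>The past enters through the drifted position and one weight \<open>H\<close>. Letting
  \<open>H\<close> range over functions of the past replaces conditional expectations
  throughout.\<close>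

lemma nn_integral_stepF:
  assumes f: "(\<lambda>(a, y, h). f a y h) \<in> borel_measurable (borel \<Otimes>\<^sub>M borel \<Otimes>\<^sub>M borel)"
    and H: "H \<in> borel_measurable (Fil k)"
  shows "(\<integral>\<^sup>+\<omega>. f (drift k \<omega>) (X (Suc k) \<omega>) (H \<omega> :: real) \<partial>P)
       = (\<integral>\<^sup>+\<omega>. \<integral>\<^sup>+y. f (drift k \<omega>) y (H \<omega>) \<partial>step_law r (drift k \<omega>) \<partial>P)"
proof -
  note [measurable] = H drift_Fil[of k k, OF order.refl]
  have "(\<lambda>(\<omega>, y). (drift k \<omega>, y, H \<omega>)) \<in> measurable (Fil k \<Otimes>\<^sub>M borel) (borel \<Otimes>\<^sub>M borel \<Otimes>\<^sub>M borel)"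
    by measurable
  from measurable_compose[OF this f]
  have "(\<lambda>(\<omega>, y). f (drift k \<omega>) y (H \<omega>)) \<in> borel_measurable (Fil k \<Otimes>\<^sub>M borel)"
    by (simp add: split_beta')
  from nn_integral_step[OF this] show ?thesis by simp
qed

lemma D4: "integrable P (\<lambda>\<omega>. (D k \<omega>)^4)" "(\<integral>\<omega>. (D k \<omega>)^4 \<partial>P) \<le> 144 * r^4"
proof -
  have "(\<integral>\<^sup>+\<omega>. ennreal ((D k \<omega>)^4) \<partial>P) = (\<integral>\<^sup>+\<omega>. \<integral>\<^sup>+y. ennreal ((y - drift k \<omega>)^4) \<partial>step_law r (drift k \<omega>) \<partial>P)"
    using nn_integral_stepF[of "\<lambda>a y h. ennreal ((y - a)^4)" "\<lambda>_. 0" k] by (simp add: D_def)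
  also have "\<dots> \<le> (\<integral>\<^sup>+\<omega>. ennreal (144 * r^4) \<partial>P)"
    using AE_X_nonneg[of k]
    by (intro nn_integral_mono_AE) (auto elim!: eventually_mono intro!: nn_step_law_4 r_pos drift_nonneg)
  also have "\<dots> = ennreal (144 * r^4)" by (simp add: emeasure_space_1)
  finally have *: "(\<integral>\<^sup>+\<omega>. ennreal ((D k \<omega>)^4) \<partial>P) \<le> ennreal (144 * r^4)" .
  show "integrable P (\<lambda>\<omega>. (D k \<omega>)^4)"
    using * by (intro integrableI_bounded) (auto simp: le_less_trans)
  show "(\<integral>\<omega>. (D k \<omega>)^4 \<partial>P) \<le> 144 * r^4"
    using * by (subst integral_eq_nn_integral) (auto simp: enn2real_leI)
qed

text \<open>The conditional variance of \<open>D k\<close> given the past, in view of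
  \<open>nn_step_law_var\<close>.\<close>

definition V :: "nat \<Rightarrow> 'a \<Rightarrow> real" where
  "V k \<omega> = r\<^sup>2 * step_var (drift k \<omega> / r)"

lemma V_measurable[measurable]: "V k \<in> borel_measurable P"
  unfolding V_def[abs_def] by measurable

lemma V_bounds: "X k \<omega> \<ge> 0 \<Longrightarrow> 0 \<le> V k \<omega>" "V k \<omega> \<le> 4 * r\<^sup>2"
  using step_var_nonneg[OF r_pos drift_nonneg] mult_left_mono[OF step_var_le[of "drift k \<omega> / r"], of "r\<^sup>2"]
  by (auto simp: V_def)

lemma D2:
  assumes H: "H \<in> borel_measurable (Fil k)" and b: "\<And>\<omega>. 0 \<le> H \<omega>" "\<And>\<omega>. H \<omega> \<le> 1"
  shows "integrable P (\<lambda>\<omega>. H \<omega> * (D k \<omega>)\<^sup>2)" "integrable P (\<lambda>\<omega>. H \<omega> * V k \<omega>)"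
    "(\<integral>\<omega>. H \<omega> * (D k \<omega>)\<^sup>2 \<partial>P) = (\<integral>\<omega>. H \<omega> * V k \<omega> \<partial>P)"
proof -
  have [measurable]: "H \<in> borel_measurable P" using H by (rule Fil_measurable)
  have "(\<integral>\<^sup>+\<omega>. ennreal (H \<omega> * (D k \<omega>)\<^sup>2) \<partial>P)
     = (\<integral>\<^sup>+\<omega>. \<integral>\<^sup>+y. ennreal (H \<omega> * (y - drift k \<omega>)\<^sup>2) \<partial>step_law r (drift k \<omega>) \<partial>P)"
    using nn_integral_stepF[of "\<lambda>a y h. ennreal (h * (y - a)\<^sup>2)" H k] H by (simp add: D_def)
  also have "\<dots> = (\<integral>\<^sup>+\<omega>. ennreal (H \<omega> * V k \<omega>) \<partial>P)"
  proof (rule nn_integral_cong_AE)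
    show "AE \<omega> in P. (\<integral>\<^sup>+y. ennreal (H \<omega> * (y - drift k \<omega>)\<^sup>2) \<partial>step_law r (drift k \<omega>)) = ennreal (H \<omega> * V k \<omega>)"
      using AE_X_nonneg[of k]
    proof eventually_elim
      case (elim \<omega>)
      have "(\<integral>\<^sup>+y. ennreal (H \<omega> * (y - drift k \<omega>)\<^sup>2) \<partial>step_law r (drift k \<omega>)) =
        ennreal (H \<omega>) * (\<integral>\<^sup>+y. ennreal ((y - drift k \<omega>)\<^sup>2) \<partial>step_law r (drift k \<omega>))"
        by (subst nn_integral_cmult[symmetric]) (auto simp: ennreal_mult b)
      then show ?case
        using nn_step_law_var[OF r_pos drift_nonneg[OF elim]] V_bounds(1)[OF elim]
        by (simp add: V_def ennreal_mult b)
    qed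
  qed
  finally have *: "(\<integral>\<^sup>+\<omega>. ennreal (H \<omega> * (D k \<omega>)\<^sup>2) \<partial>P) = (\<integral>\<^sup>+\<omega>. ennreal (H \<omega> * V k \<omega>) \<partial>P)" .
  have HV: "AE \<omega> in P. 0 \<le> H \<omega> * V k \<omega> \<and> H \<omega> * V k \<omega> \<le> 4 * r\<^sup>2"
    using AE_X_nonneg[of k]
  proof eventually_elim
    case (elim \<omega>)
    have "H \<omega> * V k \<omega> \<le> 1 * (4 * r\<^sup>2)"
      using V_bounds(1)[OF elim] V_bounds(2)[of k \<omega>] b by (intro mult_mono) auto
    then show ?case using V_bounds(1)[OF elim] b by simp
  qed
  show "integrable P (\<lambda>\<omega>. H \<omega> * V k \<omega>)"
    using HV by (intro integrable_const_bound[of _ "4 * r\<^sup>2"]) auto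
  then have "(\<integral>\<^sup>+\<omega>. ennreal (H \<omega> * V k \<omega>) \<partial>P) = ennreal (\<integral>\<omega>. H \<omega> * V k \<omega> \<partial>P)"
    using HV by (intro nn_integral_eq_integral) auto
  then have fin: "(\<integral>\<^sup>+\<omega>. ennreal (H \<omega> * (D k \<omega>)\<^sup>2) \<partial>P) = ennreal (\<integral>\<omega>. H \<omega> * V k \<omega> \<partial>P)" using * by simp
  show int: "integrable P (\<lambda>\<omega>. H \<omega> * (D k \<omega>)\<^sup>2)"
    using fin b by (intro integrableI_bounded) auto
  show "(\<integral>\<omega>. H \<omega> * (D k \<omega>)\<^sup>2 \<partial>P) = (\<integral>\<omega>. H \<omega> * V k \<omega> \<partial>P)"
    using fin b HV by (subst integral_eq_nn_integral) (auto intro!: enn2real_ennreal integral_nonneg_AE)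
qed

lemma D_sq: "integrable P (\<lambda>\<omega>. (D k \<omega>)\<^sup>2)" "(\<integral>\<omega>. (D k \<omega>)\<^sup>2 \<partial>P) \<le> 4 * r\<^sup>2"
proof -
  show "integrable P (\<lambda>\<omega>. (D k \<omega>)\<^sup>2)" using D2(1)[of "\<lambda>_. 1" k] by simp
  have "(\<integral>\<omega>. (D k \<omega>)\<^sup>2 \<partial>P) = (\<integral>\<omega>. V k \<omega> \<partial>P)" using D2(3)[of "\<lambda>_. 1" k] by simp
  also have "\<dots> \<le> (\<integral>\<omega>. 4 * r\<^sup>2 \<partial>P)"
    using D2(2)[of "\<lambda>_. 1" k] V_bounds(2) by (intro integral_mono) auto
  finally show "(\<integral>\<omega>. (D k \<omega>)\<^sup>2 \<partial>P) \<le> 4 * r\<^sup>2" by (simp add: prob_space)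
qed

lemma integrable_mult_sq:
  fixes f g :: "'a \<Rightarrow> real"
  assumes [measurable]: "f \<in> borel_measurable P" "g \<in> borel_measurable P"
    and "integrable P (\<lambda>\<omega>. (f \<omega>)\<^sup>2)" "integrable P (\<lambda>\<omega>. (g \<omega>)\<^sup>2)"
  shows "integrable P (\<lambda>\<omega>. f \<omega> * g \<omega>)"
proof (rule Bochner_Integration.integrable_bound)
  show "integrable P (\<lambda>\<omega>. (f \<omega>)\<^sup>2 + (g \<omega>)\<^sup>2)" using assms by simp
  have "\<bar>x * y\<bar> \<le> \<bar>x\<^sup>2 + y\<^sup>2\<bar>" for x y :: real
    using sum_squares_bound[of "\<bar>x\<bar>" "\<bar>y\<bar>"] mult_nonneg_nonneg[OF abs_ge_zero abs_ge_zero, of x y]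
    unfolding abs_mult power2_abs by linarith
  then show "AE \<omega> in P. norm (f \<omega> * g \<omega>) \<le> norm ((f \<omega>)\<^sup>2 + (g \<omega>)\<^sup>2)" by simp
qed measurable

text \<open>Both products are almost surely nonnegative, so the one-step formula and the exact mean
  of \<open>step_law\<close> apply directly; \<open>D_mean\<close> passes to signed weights.\<close>

lemma D_mean_pos:
  assumes H: "H \<in> borel_measurable (Fil k)" and b: "\<And>\<omega>. 0 \<le> H \<omega>" and i: "integrable P (\<lambda>\<omega>. (H \<omega>)\<^sup>2)"
  shows "(\<integral>\<omega>. H \<omega> * X (Suc k) \<omega> \<partial>P) = (\<integral>\<omega>. H \<omega> * drift k \<omega> \<partial>P)"
proof -
  have [measurable]: "H \<in> borel_measurable P" using H by (rule Fil_measurable)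
  have "(\<integral>\<^sup>+\<omega>. ennreal (H \<omega> * X (Suc k) \<omega>) \<partial>P)
     = (\<integral>\<^sup>+\<omega>. \<integral>\<^sup>+y. ennreal (H \<omega> * y) \<partial>step_law r (drift k \<omega>) \<partial>P)"
    using nn_integral_stepF[of "\<lambda>a y h. ennreal (h * y)" H k] H by simp
  also have "\<dots> = (\<integral>\<^sup>+\<omega>. ennreal (H \<omega> * drift k \<omega>) \<partial>P)"
  proof (rule nn_integral_cong_AE)
    show "AE \<omega> in P. (\<integral>\<^sup>+y. ennreal (H \<omega> * y) \<partial>step_law r (drift k \<omega>)) = ennreal (H \<omega> * drift k \<omega>)"
      using AE_X_nonneg[of k]
    proof eventually_elim
      case (elim \<omega>)
      have "(\<integral>\<^sup>+y. ennreal (H \<omega> * y) \<partial>step_law r (drift k \<omega>)) =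
        ennreal (H \<omega>) * (\<integral>\<^sup>+y. ennreal y \<partial>step_law r (drift k \<omega>))"
        by (subst nn_integral_cmult[symmetric]) (auto simp: ennreal_mult' b)
      then show ?case
        using nn_step_law_mean[OF r_pos drift_nonneg[OF elim]] by (simp add: ennreal_mult' b)
    qed
  qed
  finally have *: "(\<integral>\<^sup>+\<omega>. ennreal (H \<omega> * X (Suc k) \<omega>) \<partial>P) = (\<integral>\<^sup>+\<omega>. ennreal (H \<omega> * drift k \<omega>) \<partial>P)" .
  have 1: "AE \<omega> in P. 0 \<le> H \<omega> * X (Suc k) \<omega>" using AE_X_nonneg[of "Suc k"] b by auto
  have 2: "AE \<omega> in P. 0 \<le> H \<omega> * drift k \<omega>" using AE_X_nonneg[of k] b by (auto simp: drift_nonneg)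
  show ?thesis using * 1 2 by (simp add: integral_eq_nn_integral)
qed

text \<open>The martingale difference property in weak form. Square integrability of
  \<open>H\<close> makes its products with \<open>X (Suc k)\<close> and \<open>drift k\<close>
  integrable, so the positive and the negative part of \<open>H\<close> can be treated
  separately.\<close>

lemma D_mean:
  assumes H: "H \<in> borel_measurable (Fil k)" and i: "integrable P (\<lambda>\<omega>. (H \<omega>)\<^sup>2)"
  shows "integrable P (\<lambda>\<omega>. H \<omega> * D k \<omega>)" "(\<integral>\<omega>. H \<omega> * D k \<omega> \<partial>P) = 0"
proof -
  have Hm[measurable]: "H \<in> borel_measurable P" using H by (rule Fil_measurable)
  show "integrable P (\<lambda>\<omega>. H \<omega> * D k \<omega>)" by (intro integrable_mult_sq i D_sq) measurable
  define Hp where "Hp = (\<lambda>\<omega>. max 0 (H \<omega>))"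
  define Hn where "Hn = (\<lambda>\<omega>. max 0 (- H \<omega>))"
  have HF: "Hp \<in> borel_measurable (Fil k)" "Hn \<in> borel_measurable (Fil k)"
    unfolding Hp_def Hn_def by (intro borel_measurable_max borel_measurable_uminus borel_measurable_const H)+
  have [measurable]: "Hp \<in> borel_measurable P" "Hn \<in> borel_measurable P"
    using HF by (auto intro: Fil_measurable)
  have sq: "integrable P (\<lambda>\<omega>. (Hp \<omega>)\<^sup>2)" "integrable P (\<lambda>\<omega>. (Hn \<omega>)\<^sup>2)"
    by (rule Bochner_Integration.integrable_bound[OF i]; simp add: Hp_def Hn_def max_def)+
  have s1: "integrable P (\<lambda>\<omega>. G \<omega> * X (Suc k) \<omega>)" "integrable P (\<lambda>\<omega>. G \<omega> * drift k \<omega>)" 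
    if "G \<in> borel_measurable P" "integrable P (\<lambda>\<omega>. (G \<omega>)\<^sup>2)" for G
    using that by (auto intro!: integrable_mult_sq integrable_X2 integrable_drift2)
  have z: "(\<integral>\<omega>. G \<omega> * D k \<omega> \<partial>P) = 0" "integrable P (\<lambda>\<omega>. G \<omega> * D k \<omega>)"
    if "G \<in> borel_measurable (Fil k)" "\<And>\<omega>. 0 \<le> G \<omega>" "integrable P (\<lambda>\<omega>. (G \<omega>)\<^sup>2)" for G
    using D_mean_pos[OF that] s1[OF Fil_measurable[OF that(1)] that(3)]
    by (auto simp: D_def right_diff_distrib)
  have "(\<integral>\<omega>. H \<omega> * D k \<omega> \<partial>P) = (\<integral>\<omega>. Hp \<omega> * D k \<omega> - Hn \<omega> * D k \<omega> \<partial>P)"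
    by (intro Bochner_Integration.integral_cong) (auto simp: Hp_def Hn_def max_def)
  also have "\<dots> = 0" 
    using z[OF HF(1) _ sq(1)] z[OF HF(2) _ sq(2)] by (subst Bochner_Integration.integral_diff) (auto simp: Hp_def Hn_def)
  finally show "(\<integral>\<omega>. H \<omega> * D k \<omega> \<partial>P) = 0" .
qed

end

section \<open>Discrete martingale and occupation near the origin\<close>

definition huber :: "real \<Rightarrow> real \<Rightarrow> real" where
  "huber \<delta> x = (if x \<le> 2 * \<delta> then x\<^sup>2 / 2 else 2 * \<delta> * x - 2 * \<delta>\<^sup>2)"

definition huber' :: "real \<Rightarrow> real \<Rightarrow> real" where
  "huber' \<delta> x = min x (2 * \<delta>)"

lemma huber_measurable[measurable]: "huber \<delta> \<in> borel_measurable borel"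
  and huber'_measurable[measurable]: "huber' \<delta> \<in> borel_measurable borel"
  unfolding huber_def huber'_def by measurable

lemma huber_convex:
  assumes "\<delta> > 0" "x \<ge> 0" "y \<ge> 0"
  shows "huber \<delta> x + huber' \<delta> x * (y - x) \<le> huber \<delta> y"
proof -
  consider "x \<le> 2 * \<delta>" "y \<le> 2 * \<delta>" | "x \<le> 2 * \<delta>" "y > 2 * \<delta>" | "x > 2 * \<delta>" "y \<le> 2 * \<delta>"
    | "x > 2 * \<delta>" "y > 2 * \<delta>" by linarith
  then show ?thesis
  proof cases
    case 1
    have "0 \<le> (y - x)\<^sup>2" by simp
    then show ?thesis using 1 by (simp add: huber_def huber'_def power2_eq_square algebra_simps)
  next
    case 2
    \<comment> \<open>Half of this product is the gap between the two sides of the claim.\<close>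
    have "0 \<le> (2 * \<delta> - x) * ((2 * y - x) - 2 * \<delta>)" using 2 by (intro mult_nonneg_nonneg) auto
    then show ?thesis using 2 by (simp add: huber_def huber'_def power2_eq_square algebra_simps)
  next
    case 3
    have "0 \<le> (2 * \<delta> - y)\<^sup>2" by simp
    then show ?thesis using 3 by (simp add: huber_def huber'_def power2_eq_square algebra_simps)
  next
    case 4
    then show ?thesis by (simp add: huber_def huber'_def algebra_simps)
  qed
qed

text \<open>The break at \<open>2 * \<delta>\<close> leaves room \<delta> above the starting point.
  If \<open>y\<close> stays below the break, the function is quadratic and its second-order
  expansion is exact. Otherwise the jump exceeds \<delta>, so its square is at most its fourth power
  over \<open>\<delta>\<^sup>2\<close>, whose mean is of order \<open>\<gamma>\<^sup>2\<close> for
  the chain.\<close>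

lemma huber_gain:
  assumes "\<delta> > 0" "x \<ge> 0" "y \<ge> 0" "x \<le> \<delta>"
  shows "huber \<delta> x + huber' \<delta> x * (y - x) + (y - x)\<^sup>2 / 2 \<le> huber \<delta> y + (y - x)^4 / (2 * \<delta>\<^sup>2)"
proof (cases "y \<le> 2 * \<delta>")
  case True
  have "huber \<delta> x + huber' \<delta> x * (y - x) + (y - x)\<^sup>2 / 2 = huber \<delta> y"
    using True assms by (simp add: huber_def huber'_def power2_eq_square field_simps)
  then show ?thesis by simp
next
  case False
  then have "\<delta>\<^sup>2 \<le> (y - x)\<^sup>2" using assms by (intro power_mono) auto
  then have "\<delta>\<^sup>2 * (y - x)\<^sup>2 \<le> (y - x)\<^sup>2 * (y - x)\<^sup>2" by (intro mult_right_mono) auto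
  then have "(y - x)\<^sup>2 / 2 \<le> (y - x)^4 / (2 * \<delta>\<^sup>2)"
    using assms by (simp add: field_simps power2_eq_square power4_eq_xxxx)
  then show ?thesis using huber_convex[OF assms(1-3)] by linarith
qed

lemma huber_nonneg: "\<delta> > 0 \<Longrightarrow> x \<ge> 0 \<Longrightarrow> huber \<delta> x \<ge> 0"
  using huber_convex[of \<delta> 0 x] by (simp add: huber_def huber'_def)

lemma huber_le: "huber \<delta> x \<le> 2 * \<delta> * x" if "\<delta> > 0" "x \<ge> 0"
proof (cases "x \<le> 2 * \<delta>")
  case True
  have "x * x \<le> (2 * \<delta>) * x" using True that by (intro mult_right_mono) auto
  moreover have "0 \<le> \<delta> * x" using that by simp
  ultimately show ?thesis using True by (simp add: huber_def power2_eq_square mult.assoc)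
qed (simp add: huber_def)

lemma huber'_bounds: "\<delta> > 0 \<Longrightarrow> x \<ge> 0 \<Longrightarrow> 0 \<le> huber' \<delta> x \<and> huber' \<delta> x \<le> 2 * \<delta>"
  by (auto simp: huber'_def)

lemma huber_lipschitz: "huber \<delta> y - huber \<delta> x \<le> 2 * \<delta> * \<bar>y - x\<bar>" if "\<delta> > 0" "x \<ge> 0" "y \<ge> 0"
proof -
  have "huber \<delta> y - huber \<delta> x \<le> huber' \<delta> y * (y - x)"
    using huber_convex[of \<delta> y x] that by (simp add: algebra_simps)
  also have "\<dots> \<le> \<bar>huber' \<delta> y\<bar> * \<bar>y - x\<bar>"
    unfolding abs_mult[symmetric] by (rule abs_ge_self)
  also have "\<dots> \<le> 2 * \<delta> * \<bar>y - x\<bar>"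
    using huber'_bounds[of \<delta> y] that by (intro mult_right_mono) auto
  finally show ?thesis .
qed

section \<open>The compensated chain as a discrete martingale, and its bracket\<close>

context sticky_chain
begin

definition Mart :: "nat \<Rightarrow> 'a \<Rightarrow> real" where
  "Mart k \<omega> = X k \<omega> - X 0 \<omega> - (\<Sum>j<k. \<gamma> * (c + \<kappa> (X j \<omega>)))"

lemma Mart_0[simp]: "Mart 0 \<omega> = 0"
  by (simp add: Mart_def)

lemma Mart_Suc: "Mart (Suc k) \<omega> = Mart k \<omega> + D k \<omega>"
  by (simp add: Mart_def D_def drift_def tau_def algebra_simps)

lemma Mart_Fil: "Mart k \<in> borel_measurable (Fil k)"
proof (induction k)
  case (Suc k)
  have "(\<lambda>\<omega>. Mart k \<omega> + D k \<omega>) \<in> borel_measurable (Fil (Suc k))"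
    by (intro borel_measurable_add D_Fil Fil_mono[OF _ Suc]) auto
  then show ?case by (simp add: Mart_Suc[abs_def])
qed (simp add: Mart_def)

lemma Mart_measurable[measurable]: "Mart k \<in> borel_measurable P"
  by (rule Fil_measurable[OF Mart_Fil])

text \<open>Orthogonality of increments: the mixed term has mean zero by \<open>D_mean\<close>,
  whose square integrability premise is the induction hypothesis, and each increment adds at most
  \<open>4 * r\<^sup>2\<close>.\<close>

lemma Mart_sq: "integrable P (\<lambda>\<omega>. (Mart k \<omega>)\<^sup>2) \<and> (\<integral>\<omega>. (Mart k \<omega>)\<^sup>2 \<partial>P) \<le> 4 * r\<^sup>2 * k"
proof (induction k)
  case (Suc k)
  have i: "integrable P (\<lambda>\<omega>. Mart k \<omega> * D k \<omega>)" and z: "(\<integral>\<omega>. Mart k \<omega> * D k \<omega> \<partial>P) = 0"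
    using D_mean[OF Mart_Fil] Suc by auto
  have eq: "(\<lambda>\<omega>. (Mart (Suc k) \<omega>)\<^sup>2) = (\<lambda>\<omega>. (Mart k \<omega>)\<^sup>2 + 2 * (Mart k \<omega> * D k \<omega>) + (D k \<omega>)\<^sup>2)"
    by (simp add: Mart_Suc power2_eq_square algebra_simps)
  show ?case
    unfolding eq using i z Suc D_sq[of k] by (simp add: algebra_simps)
qed simp

lemma integrable_Mart: "integrable P (Mart k)"
  using integrable_mult_sq[of "Mart k" "\<lambda>_. 1"] Mart_sq[of k] by simp

lemma integrable_bounded_mult:
  fixes f G :: "'a \<Rightarrow> real"
  assumes "integrable P f" "G \<in> borel_measurable P" "\<And>\<omega>. 0 \<le> G \<omega>" "\<And>\<omega>. G \<omega> \<le> 1"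
  shows "integrable P (\<lambda>\<omega>. G \<omega> * f \<omega>)"
  using assms by (intro Bochner_Integration.integrable_bound[OF assms(1)])
    (auto simp: abs_mult intro!: mult_left_le_one_le)

context
  fixes G :: "'a \<Rightarrow> real" and J :: nat
  assumes G: "G \<in> borel_measurable (Fil J)" and G_bounds: "\<And>\<omega>. 0 \<le> G \<omega>" "\<And>\<omega>. G \<omega> \<le> 1"
begin

lemma G_measurable: "G \<in> borel_measurable P" using G by (rule Fil_measurable)

lemma G_Fil_le: "J \<le> k \<Longrightarrow> G \<in> borel_measurable (Fil k)"
  using G by (rule Fil_mono[rotated])

lemma Mart_increment: "J \<le> k \<Longrightarrow> (\<integral>\<omega>. G \<omega> * (Mart k \<omega> - Mart J \<omega>) \<partial>P) = 0"
proof (induction k rule: dec_induct)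
  case (step k)
  have i: "integrable P (\<lambda>\<omega>. (G \<omega>)\<^sup>2)"
    using G_bounds G_measurable by (intro integrable_const_bound[of _ 1]) (auto simp: abs_square_le_1)
  have eq: "(\<lambda>\<omega>. G \<omega> * (Mart (Suc k) \<omega> - Mart J \<omega>)) = (\<lambda>\<omega>. G \<omega> * (Mart k \<omega> - Mart J \<omega>) + G \<omega> * D k \<omega>)"
    by (simp add: Mart_Suc algebra_simps)
  have "integrable P (\<lambda>\<omega>. G \<omega> * (Mart k \<omega> - Mart J \<omega>))"
    by (intro integrable_bounded_mult G_measurable G_bounds Bochner_Integration.integrable_diff integrable_Mart)
  then show ?case
    unfolding eq using step D_mean[OF G_Fil_le[OF step(1)] i] by simp
qed simp

text \<open>In the expanded square the mixed term vanishes because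
  \<open>G \<omega> * Mart k \<omega>\<close> is a square-integrable function of the past, and
  \<open>D2\<close> replaces the squared increment by its conditional variance.\<close>

lemma Mart_sq_increment:
  "J \<le> k \<Longrightarrow> (\<integral>\<omega>. G \<omega> * ((Mart k \<omega>)\<^sup>2 - (Mart J \<omega>)\<^sup>2) \<partial>P) = (\<Sum>j\<in>{J..<k}. \<integral>\<omega>. G \<omega> * V j \<omega> \<partial>P)"
proof (induction k rule: dec_induct)
  case (step k)
  note [measurable] = G_measurable
  have i1: "integrable P (\<lambda>\<omega>. G \<omega> * ((Mart k \<omega>)\<^sup>2 - (Mart J \<omega>)\<^sup>2))"
    using Mart_sq by (intro integrable_bounded_mult G_measurable G_bounds Bochner_Integration.integrable_diff) auto
  have "integrable P (\<lambda>\<omega>. (G \<omega> * Mart k \<omega>)\<^sup>2)"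
  proof (rule Bochner_Integration.integrable_bound[of _ "\<lambda>\<omega>. (Mart k \<omega>)\<^sup>2"])
    show "integrable P (\<lambda>\<omega>. (Mart k \<omega>)\<^sup>2)" using Mart_sq by auto
    show "AE \<omega> in P. norm ((G \<omega> * Mart k \<omega>)\<^sup>2) \<le> norm ((Mart k \<omega>)\<^sup>2)"
      using G_bounds by (auto simp: power_mult_distrib abs_square_le_1 intro!: mult_left_le_one_le)
  qed measurable
  moreover have "(\<lambda>\<omega>. G \<omega> * Mart k \<omega>) \<in> borel_measurable (Fil k)"
    using G_Fil_le[OF step(1)] Mart_Fil by (rule borel_measurable_times)
  ultimately have i2: "integrable P (\<lambda>\<omega>. G \<omega> * Mart k \<omega> * D k \<omega>)" "(\<integral>\<omega>. G \<omega> * Mart k \<omega> * D k \<omega> \<partial>P) = 0"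
    using D_mean by auto
  have i3: "integrable P (\<lambda>\<omega>. G \<omega> * (D k \<omega>)\<^sup>2)" "(\<integral>\<omega>. G \<omega> * (D k \<omega>)\<^sup>2 \<partial>P) = (\<integral>\<omega>. G \<omega> * V k \<omega> \<partial>P)"
    using D2[OF G_Fil_le[OF step(1)] G_bounds] by auto
  have eq: "(\<lambda>\<omega>. G \<omega> * ((Mart (Suc k) \<omega>)\<^sup>2 - (Mart J \<omega>)\<^sup>2)) =
     (\<lambda>\<omega>. G \<omega> * ((Mart k \<omega>)\<^sup>2 - (Mart J \<omega>)\<^sup>2) + 2 * (G \<omega> * Mart k \<omega> * D k \<omega>) + G \<omega> * (D k \<omega>)\<^sup>2)"
    by (simp add: Mart_Suc power2_eq_square algebra_simps)
  show ?case
    unfolding eq using i1 i2 i3 step by simp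
qed simp

end

text \<open>The martingale part contributes a term of order \<gamma>, the drift part one of order
  \<open>\<gamma>\<^sup>2\<close>, which is at most \<gamma>.\<close>

lemma step_sq_moment:
  assumes "\<gamma> * k \<le> T"
  shows "integrable P (\<lambda>\<omega>. (X (Suc k) \<omega> - X k \<omega>)\<^sup>2)"
    and "(\<integral>\<omega>. (X (Suc k) \<omega> - X k \<omega>)\<^sup>2 \<partial>P) \<le> (8 * \<sigma>\<^sup>2 + 2 * (L + c)\<^sup>2 * mom T) * \<gamma>"
proof -
  show i: "integrable P (\<lambda>\<omega>. (X (Suc k) \<omega> - X k \<omega>)\<^sup>2)"
  proof (rule Bochner_Integration.integrable_bound[of _ "\<lambda>\<omega>. 2 * (X (Suc k) \<omega>)\<^sup>2 + 2 * (X k \<omega>)\<^sup>2"])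
    have "(x - y)\<^sup>2 \<le> 2 * x\<^sup>2 + 2 * y\<^sup>2" for x y :: real
      using zero_le_power2[of "x + y"] by (simp add: power2_eq_square algebra_simps)
    then show "AE \<omega> in P. norm ((X (Suc k) \<omega> - X k \<omega>)\<^sup>2) \<le> norm (2 * (X (Suc k) \<omega>)\<^sup>2 + 2 * (X k \<omega>)\<^sup>2)"
      by simp
  qed (auto simp: integrable_X2)
  have "(\<integral>\<omega>. (X (Suc k) \<omega> - X k \<omega>)\<^sup>2 \<partial>P) \<le> (\<integral>\<omega>. 2 * (D k \<omega>)\<^sup>2 + 2 * (\<gamma>\<^sup>2 * (L + c)\<^sup>2) * (1 + X k \<omega>)\<^sup>2 \<partial>P)"
  proof (rule integral_mono_AE[OF i])
    show "integrable P (\<lambda>\<omega>. 2 * (D k \<omega>)\<^sup>2 + 2 * (\<gamma>\<^sup>2 * (L + c)\<^sup>2) * (1 + X k \<omega>)\<^sup>2)"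
      using D_sq(1) integrable_1X2 by simp
    show "AE \<omega> in P. (X (Suc k) \<omega> - X k \<omega>)\<^sup>2 \<le> 2 * (D k \<omega>)\<^sup>2 + 2 * (\<gamma>\<^sup>2 * (L + c)\<^sup>2) * (1 + X k \<omega>)\<^sup>2"
      using AE_X_nonneg[of k]
    proof eventually_elim
      case (elim \<omega>)
      have "(x + y)\<^sup>2 \<le> 2 * x\<^sup>2 + 2 * y\<^sup>2" for x y :: real
        using zero_le_power2[of "x - y"] by (simp add: power2_eq_square algebra_simps)
      from this[of "D k \<omega>" "drift k \<omega> - X k \<omega>"]
      have "(X (Suc k) \<omega> - X k \<omega>)\<^sup>2 \<le> 2 * (D k \<omega>)\<^sup>2 + 2 * (drift k \<omega> - X k \<omega>)\<^sup>2"
        by (simp add: D_def)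
      moreover have "(drift k \<omega> - X k \<omega>)\<^sup>2 \<le> (\<gamma> * (L + c) * (1 + X k \<omega>))\<^sup>2"
        using drift_diff[OF elim] by (intro power2_le_iff_abs_le[THEN iffD2]) (auto intro: order_trans[OF abs_ge_zero])
      ultimately show ?case by (simp add: power_mult_distrib)
    qed
  qed
  also have "\<dots> = 2 * (\<integral>\<omega>. (D k \<omega>)\<^sup>2 \<partial>P) + 2 * (\<gamma>\<^sup>2 * (L + c)\<^sup>2) * (\<integral>\<omega>. (1 + X k \<omega>)\<^sup>2 \<partial>P)"
    using D_sq(1) integrable_1X2 by simp
  also have "\<dots> \<le> 2 * (4 * r\<^sup>2) + 2 * (\<gamma> * (L + c)\<^sup>2) * mom T"
  proof (intro add_mono mult_left_mono mult_mono mult_nonneg_nonneg)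
    show "\<gamma>\<^sup>2 \<le> \<gamma>" using gamma_pos gamma_le_1 by (simp add: power2_eq_square mult_left_le)
  qed (use D_sq(2) X_moment_2[OF assms] gamma_pos in auto)
  also have "\<dots> = (8 * \<sigma>\<^sup>2 + 2 * (L + c)\<^sup>2 * mom T) * \<gamma>"
    by (simp add: r_sq algebra_simps)
  finally show "(\<integral>\<omega>. (X (Suc k) \<omega> - X k \<omega>)\<^sup>2 \<partial>P) \<le> (8 * \<sigma>\<^sup>2 + 2 * (L + c)\<^sup>2 * mom T) * \<gamma>" .
qed

text \<open>The variance accumulated near the origin is controlled by applying a convex function of slope at most \<^term>\<open>2 * \<delta>\<close> to the chain.\<close>

lemma integrable_huber: "\<delta> > 0 \<Longrightarrow> integrable P (\<lambda>\<omega>. huber \<delta> (X k \<omega>))"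
  by (rule integrable_X4_bound[where k = k and C = "2 * \<delta>"], measurable)
     (auto simp: abs_of_nonneg huber_nonneg intro!: order_trans[OF huber_le] mult_left_mono 
       order_trans[OF _ one_le_X4(1)])

text \<open>\<open>huber \<delta>\<close> is expanded at the drifted position. The linear term has
  mean zero; below \<delta> the quadratic term leaves half the conditional variance by
  \<open>huber_gain\<close>, and above \<delta> convexity is enough. Moving the base point back to
  \<open>X k\<close> costs the slope \<open>2 * \<delta>\<close> times the size of the
  drift.\<close>

lemma occupation_step:
  assumes \<delta>: "\<delta> > 0" and T: "\<gamma> * k \<le> T"
  shows "(\<integral>\<omega>. indicator {..\<delta>} (drift k \<omega>) * V k \<omega> \<partial>P) \<le>
    2 * ((\<integral>\<omega>. huber \<delta> (X (Suc k) \<omega>) \<partial>P) - (\<integral>\<omega>. huber \<delta> (X k \<omega>) \<partial>P))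
    + 4 * \<delta> * (\<gamma> * (L + c)) * mom T + 144 * r^4 / \<delta>\<^sup>2"
proof -
  let ?H = "\<lambda>\<omega>. indicator {..\<delta>} (drift k \<omega>) :: real"
  have HF: "?H \<in> borel_measurable (Fil k)" using drift_Fil[of k k] by measurable
  note H = D2[OF HF]
  \<comment> \<open>\<open>max 0\<close> makes the weight bounded everywhere and changes it only on
    a null set.\<close>
  have hF: "(\<lambda>\<omega>. huber' \<delta> (max 0 (drift k \<omega>))) \<in> borel_measurable (Fil k)"
    using drift_Fil[of k k] by measurable
  have hi: "integrable P (\<lambda>\<omega>. (huber' \<delta> (max 0 (drift k \<omega>)))\<^sup>2)"
  proof (rule integrable_const_bound[of _ "(2 * \<delta>)\<^sup>2"])
    have "(huber' \<delta> (max 0 (drift k \<omega>)))\<^sup>2 \<le> (2 * \<delta>)\<^sup>2" for \<omega>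
      using huber'_bounds[OF \<delta>, of "max 0 (drift k \<omega>)"] by (intro power_mono) auto
    then show "AE \<omega> in P. norm ((huber' \<delta> (max 0 (drift k \<omega>)))\<^sup>2) \<le> (2 * \<delta>)\<^sup>2" by simp
  qed measurable
  note z = D_mean[OF hF hi]
  let ?f = "\<lambda>\<omega>. huber \<delta> (X k \<omega>) - 2 * \<delta> * (\<gamma> * (L + c)) * (1 + X k \<omega>)
     + huber' \<delta> (max 0 (drift k \<omega>)) * D k \<omega> + (?H \<omega> * (D k \<omega>)\<^sup>2) / 2"
  let ?g = "\<lambda>\<omega>. huber \<delta> (X (Suc k) \<omega>) + (D k \<omega>)^4 / (2 * \<delta>\<^sup>2)"
  have i: "integrable P ?f" "integrable P ?g"
    using \<delta> H(1) z(1) D4(1) integrable_X integrable_huber by auto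
  have "(\<integral>\<omega>. ?f \<omega> \<partial>P) \<le> (\<integral>\<omega>. ?g \<omega> \<partial>P)"
  proof (rule integral_mono_AE[OF i])
    show "AE \<omega> in P. ?f \<omega> \<le> ?g \<omega>"
      using AE_X_nonneg[of k] AE_X_nonneg[of "Suc k"]
    proof eventually_elim
      case (elim \<omega>)
      note a = drift_nonneg[OF elim(1)]
      have "huber \<delta> (X k \<omega>) - huber \<delta> (drift k \<omega>) \<le> 2 * \<delta> * \<bar>X k \<omega> - drift k \<omega>\<bar>"
        using \<delta> a elim by (intro huber_lipschitz)
      also have "\<dots> \<le> 2 * \<delta> * (\<gamma> * (L + c) * (1 + X k \<omega>))"
        using drift_diff[OF elim(1)] \<delta> by (intro mult_left_mono) (auto simp: abs_minus_commute)
      finally have 1: "huber \<delta> (X k \<omega>) - 2 * \<delta> * (\<gamma> * (L + c)) * (1 + X k \<omega>) \<le> huber \<delta> (drift k \<omega>)"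
        by (simp add: mult.assoc)
      have 2: "huber \<delta> (drift k \<omega>) + huber' \<delta> (max 0 (drift k \<omega>)) * D k \<omega> + (?H \<omega> * (D k \<omega>)\<^sup>2) / 2 \<le> ?g \<omega>"
      proof (cases "drift k \<omega> \<le> \<delta>")
        case True
        then show ?thesis using huber_gain[OF \<delta> a elim(2) True] a by (simp add: D_def)
      next
        case False
        then show ?thesis using huber_convex[OF \<delta> a elim(2)] a by (simp add: D_def add_increasing2)
      qed
      show ?case using 1 2 by linarith
    qed
  qed
  moreover have "(\<integral>\<omega>. ?f \<omega> \<partial>P) = (\<integral>\<omega>. huber \<delta> (X k \<omega>) \<partial>P)
     - 2 * \<delta> * (\<gamma> * (L + c)) * (\<integral>\<omega>. 1 + X k \<omega> \<partial>P) + 0 + (\<integral>\<omega>. ?H \<omega> * V k \<omega> \<partial>P) / 2"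
    using \<delta> H z integrable_X integrable_huber[of \<delta> k] by (simp add: prob_space)
  moreover have "(\<integral>\<omega>. ?g \<omega> \<partial>P) = (\<integral>\<omega>. huber \<delta> (X (Suc k) \<omega>) \<partial>P) + (\<integral>\<omega>. (D k \<omega>)^4 \<partial>P) / (2 * \<delta>\<^sup>2)"
    using \<delta> D4(1) integrable_huber[of \<delta> "Suc k"] by simp
  moreover have "(\<integral>\<omega>. (D k \<omega>)^4 \<partial>P) / (2 * \<delta>\<^sup>2) \<le> (144 * r^4 / \<delta>\<^sup>2) / 2"
    using D4(2) \<delta> by (simp add: field_simps)
  moreover have "2 * \<delta> * (\<gamma> * (L + c)) * (\<integral>\<omega>. 1 + X k \<omega> \<partial>P) \<le> 2 * \<delta> * (\<gamma> * (L + c)) * mom T"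
    using X_moment_1[OF T] \<delta> gamma_pos L_nonneg c_nonneg by (intro mult_left_mono) auto
  moreover have "4 * \<delta> * (\<gamma> * (L + c)) * mom T = 2 * (2 * \<delta> * (\<gamma> * (L + c)) * mom T)" by simp
  moreover have "F \<le> E \<Longrightarrow> F = u - b + 0 + h / 2 \<Longrightarrow> E = u' + d \<Longrightarrow> d \<le> e / 2 \<Longrightarrow> b \<le> q \<Longrightarrow> q' = 2 * q
      \<Longrightarrow> h \<le> 2 * (u' - u) + q' + e" for F E u b h u' d e q q' :: real
    by argo
  ultimately show ?thesis by blast
qed

text \<open>The increments of the test function telescope to at most
  \<open>2 * \<delta> * mom T\<close>. As \<open>\<gamma> * k \<le> T\<close>, the drift costs add
  up to order \<delta>, and the jump terms, with \<open>r^4 = \<sigma>^4 * \<gamma>\<^sup>2\<close>,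
  to order \<open>\<gamma> / \<delta>\<^sup>2\<close>.\<close>

lemma occupation:
  assumes \<delta>: "\<delta> > 0" and T: "\<gamma> * k \<le> T"
  shows "(\<Sum>j<k. \<integral>\<omega>. indicator {..\<delta>} (drift j \<omega>) * V j \<omega> \<partial>P) \<le>
    4 * (1 + T * (L + c)) * mom T * \<delta> + 144 * T * \<sigma>^4 / \<delta>\<^sup>2 * \<gamma>"
proof -
  let ?h = "\<lambda>j. \<integral>\<omega>. huber \<delta> (X j \<omega>) \<partial>P"
  have "(\<Sum>j<k. \<integral>\<omega>. indicator {..\<delta>} (drift j \<omega>) * V j \<omega> \<partial>P) \<le>
    (\<Sum>j<k. 2 * (?h (Suc j) - ?h j) + (4 * \<delta> * (\<gamma> * (L + c)) * mom T + 144 * r^4 / \<delta>\<^sup>2))"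
  proof (rule sum_mono)
    fix j assume "j \<in> {..<k}"
    then have "\<gamma> * j \<le> T" using T gamma_pos by (smt (verit) lessThan_iff mult_less_cancel_left_pos of_nat_less_iff)
    from occupation_step[OF \<delta> this]
    show "(\<integral>\<omega>. indicator {..\<delta>} (drift j \<omega>) * V j \<omega> \<partial>P) \<le>
        2 * (?h (Suc j) - ?h j) + (4 * \<delta> * (\<gamma> * (L + c)) * mom T + 144 * r^4 / \<delta>\<^sup>2)"
      by simp
  qed
  also have "\<dots> = 2 * (\<Sum>j<k. ?h (Suc j) - ?h j) + k * (4 * \<delta> * (\<gamma> * (L + c)) * mom T + 144 * r^4 / \<delta>\<^sup>2)"
    by (simp add: sum.distrib sum_distrib_left)
  also have "(\<Sum>j<k. ?h (Suc j) - ?h j) = ?h k - ?h 0"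
    by (rule sum_lessThan_telescope)
  also have "?h k - ?h 0 \<le> 2 * \<delta> * mom T"
  proof -
    have "?h k \<le> (\<integral>\<omega>. 2 * \<delta> * (1 + X k \<omega>) \<partial>P)"
      using AE_X_nonneg[of k] \<delta> integrable_X integrable_huber[OF \<delta>]
      by (intro integral_mono_AE) (auto elim!: eventually_mono intro!: order_trans[OF huber_le])
    also have "\<dots> = 2 * \<delta> * (\<integral>\<omega>. 1 + X k \<omega> \<partial>P)" by (rule integral_mult_right_zero)
    also have "\<dots> \<le> 2 * \<delta> * mom T" using X_moment_1[OF T] \<delta> by (intro mult_left_mono) auto
    finally have "?h k \<le> 2 * \<delta> * mom T" .
    moreover have "?h 0 \<ge> 0" using AE_X_nonneg[of 0] \<delta>
      by (intro integral_nonneg_AE) (auto elim!: eventually_mono simp: huber_nonneg)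
    ultimately show ?thesis by linarith
  qed
  also have "k * (4 * \<delta> * (\<gamma> * (L + c)) * mom T + 144 * r^4 / \<delta>\<^sup>2) =
     (\<gamma> * k) * (4 * \<delta> * (L + c) * mom T + 144 * \<sigma>^4 / \<delta>\<^sup>2 * \<gamma>)"
    by (simp add: r_4 power2_eq_square algebra_simps)
  also have "\<dots> \<le> T * (4 * \<delta> * (L + c) * mom T + 144 * \<sigma>^4 / \<delta>\<^sup>2 * \<gamma>)"
    using T \<delta> L_nonneg c_nonneg mom_nonneg gamma_pos by (intro mult_right_mono) auto
  finally show ?thesis by (simp add: algebra_simps)
qed

end

section \<open>Path space\<close>

definition path_ball :: "(real \<Rightarrow> real) \<Rightarrow> real \<Rightarrow> real \<Rightarrow> (real \<Rightarrow> real) set" where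
  "path_ball w T e = {v \<in> Wpaths. \<forall>t\<in>{0..T}. \<bar>v t - w t\<bar> < e}"

lemma Wtop_alt: "Wtop = topology_generated_by {path_ball w T e | w T e. w \<in> Wpaths \<and> T \<ge> 0 \<and> e > 0}"
  by (simp add: Wtop_def path_ball_def)

lemma path_ball_center: "w \<in> Wpaths \<Longrightarrow> e > 0 \<Longrightarrow> w \<in> path_ball w T e"
  by (simp add: path_ball_def)

lemma topspace_Wtop[simp]: "topspace Wtop = Wpaths"
  unfolding Wtop_alt topology_generated_by_topspace
proof
  show "Wpaths \<subseteq> \<Union>{path_ball w T e |w T e. w \<in> Wpaths \<and> 0 \<le> T \<and> 0 < e}"
    using path_ball_center[of _ 1 0] by (force intro!: zero_less_one)
qed (auto simp: path_ball_def)

lemma openin_path_ball: "w \<in> Wpaths \<Longrightarrow> T \<ge> 0 \<Longrightarrow> e > 0 \<Longrightarrow> openin Wtop (path_ball w T e)"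
  unfolding Wtop_alt by (rule topology_generated_by_Basis) auto

text \<open>The balls centred at \<open>w\<close> itself are among the generating open sets, so an
  epsilon-delta condition at each path suffices.\<close>

lemma continuous_map_WtopI:
  assumes "\<And>w \<epsilon>. w \<in> Wpaths \<Longrightarrow> \<epsilon> > 0 \<Longrightarrow>
    \<exists>T\<ge>0. \<exists>e>0. \<forall>v\<in>path_ball w T e. \<bar>F v - F w\<bar> < (\<epsilon>::real)"
  shows "continuous_map Wtop euclideanreal F"
  unfolding continuous_map_def
proof (intro conjI allI impI)
  fix U :: "real set" assume U: "openin euclideanreal U"
  show "openin Wtop {w \<in> topspace Wtop. F w \<in> U}"
  proof (subst openin_subopen, intro ballI)
    fix w assume w: "w \<in> {w \<in> topspace Wtop. F w \<in> U}"
    then obtain \<epsilon> where \<epsilon>: "\<epsilon> > 0" "\<And>y. \<bar>y - F w\<bar> < \<epsilon> \<Longrightarrow> y \<in> U"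
      using U by (auto simp: open_dist dist_real_def)
    obtain T e where "T \<ge> 0" "e > 0" "\<forall>v\<in>path_ball w T e. \<bar>F v - F w\<bar> < \<epsilon>"
      using assms[of w \<epsilon>] w \<epsilon> by auto
    then show "\<exists>S. openin Wtop S \<and> w \<in> S \<and> S \<subseteq> {w \<in> topspace Wtop. F w \<in> U}"
      using w \<epsilon> by (intro exI[of _ "path_ball w T e"])
        (auto simp: openin_path_ball path_ball_center, auto simp: path_ball_def)
  qed
qed auto

lemma continuous_map_eval: "t \<ge> 0 \<Longrightarrow> continuous_map Wtop euclideanreal (\<lambda>w. w t)"
  by (rule continuous_map_WtopI) (force simp: path_ball_def)

lemma Wpaths_continuous: "w \<in> Wpaths \<Longrightarrow> continuous_on {a..b} w" if "a \<ge> 0"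
  using that by (auto simp: Wpaths_def intro: continuous_on_subset)

lemma LINT_eq_integral:
  fixes f :: "real \<Rightarrow> real"
  assumes "continuous_on {a..b} f"
  shows "(LINT u:{a..b}|lborel. f u) = integral {a..b} f"
  using assms by (intro set_borel_integral_eq_integral borel_integrable_atLeastAtMost')

lemma lipschitz_imp_continuous_comp:
  fixes \<psi> :: "real \<Rightarrow> real"
  assumes "\<Lambda>-lipschitz_on UNIV \<psi>" "continuous_on S f"
  shows "continuous_on S (\<lambda>u. \<psi> (f u))"
  using assms by (intro continuous_on_compose2[OF lipschitz_on_continuous_on[OF assms(1)]]) auto

lemma continuous_map_path_integral:
  fixes \<psi> :: "real \<Rightarrow> real"
  assumes \<psi>: "\<Lambda>-lipschitz_on UNIV \<psi>" and t: "t \<ge> 0"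
  shows "continuous_map Wtop euclideanreal (\<lambda>w. LINT u:{0..t}|lborel. \<psi> (w u))"
proof (rule continuous_map_WtopI)
  fix w and \<epsilon> :: real assume w: "w \<in> Wpaths" and \<epsilon>: "\<epsilon> > 0"
  have \<Lambda>: "\<Lambda> \<ge> 0" using \<psi> by (rule lipschitz_on_nonneg)
  \<comment> \<open>The added 1 keeps the denominator positive and makes the final inequality
    strict, also when \<open>t * \<Lambda> = 0\<close>.\<close>
  define e where "e = \<epsilon> / (t * \<Lambda> + 1)"
  have d: "t * \<Lambda> + 1 > 0" using t \<Lambda> by (simp add: add_nonneg_pos)
  have e: "e > 0" using d \<epsilon> by (simp add: e_def)
  show "\<exists>T\<ge>0. \<exists>e>0. \<forall>v\<in>path_ball w T e.
      \<bar>(LINT u:{0..t}|lborel. \<psi> (v u)) - (LINT u:{0..t}|lborel. \<psi> (w u))\<bar> < \<epsilon>"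
  proof (rule exI[of _ t], rule conjI[OF t], rule exI[of _ e], rule conjI[OF e], rule ballI)
    fix v assume v: "v \<in> path_ball w t e"
    then have vW: "v \<in> Wpaths" by (simp add: path_ball_def)
    note cv = lipschitz_imp_continuous_comp[OF \<psi> Wpaths_continuous[OF order.refl vW, of t]]
      and cw = lipschitz_imp_continuous_comp[OF \<psi> Wpaths_continuous[OF order.refl w, of t]]
    have "(LINT u:{0..t}|lborel. \<psi> (v u)) - (LINT u:{0..t}|lborel. \<psi> (w u)) =
       integral {0..t} (\<lambda>u. \<psi> (v u) - \<psi> (w u))"
      using cv cw by (simp add: LINT_eq_integral integrable_continuous_interval Henstock_Kurzweil_Integration.integral_diff)
    also have "norm \<dots> \<le> (\<Lambda> * e) * (t - 0)"
    proof (rule integral_bound[OF t])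
      show "continuous_on {0..t} (\<lambda>u. \<psi> (v u) - \<psi> (w u))" using cv cw by (rule continuous_on_diff)
      fix u assume u: "u \<in> {0..t}"
      have "norm (\<psi> (v u) - \<psi> (w u)) \<le> \<Lambda> * \<bar>v u - w u\<bar>"
        using lipschitz_onD[OF \<psi>, of "v u" "w u"] by (simp add: dist_real_def)
      also have "\<dots> \<le> \<Lambda> * e" using v u \<Lambda> by (intro mult_left_mono) (auto simp: path_ball_def less_imp_le)
      finally show "norm (\<psi> (v u) - \<psi> (w u)) \<le> \<Lambda> * e" .
    qed
    also have "\<dots> = e * (t * \<Lambda>)" by simp
    also have "\<dots> < e * (t * \<Lambda> + 1)" using e by (intro mult_strict_left_mono) auto
    also have "\<dots> = \<epsilon>" using d by (simp add: e_def)
    finally show "\<bar>(LINT u:{0..t}|lborel. \<psi> (v u)) - (LINT u:{0..t}|lborel. \<psi> (w u))\<bar> < \<epsilon>" by simp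
  qed
qed

lemma space_Wborel[simp]: "space Wborel = Wpaths"
  by (simp add: Wborel_def space_measure_of_conv)

lemma sets_Wborel: "sets Wborel = sigma_sets Wpaths {U. openin Wtop U}"
  unfolding Wborel_def topspace_Wtop[symmetric]
  by (rule sets_measure_of) (use openin_subset in blast)

lemma continuous_map_measurable_Wborel:
  assumes "continuous_map Wtop euclideanreal F"
  shows "F \<in> borel_measurable Wborel"
proof (rule borel_measurableI)
  fix S :: "real set" assume "open S"
  then have "openin Wtop {w \<in> topspace Wtop. F w \<in> S}"
    using assms by (simp add: continuous_map_def)
  then show "F -` S \<inter> space Wborel \<in> sets Wborel"
    unfolding sets_Wborel by (intro sigma_sets.Basic) (simp add: vimage_def Int_def conj_commute)
qed

section \<open>Linear interpolation as a continuous map from sequences to paths\<close>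

lemma interp_segment:
  assumes \<gamma>: "\<gamma> > 0" and t: "\<gamma> * real k \<le> t" "t \<le> \<gamma> * (real k + 1)"
  shows "interp \<gamma> x t = x k + (x (Suc k) - x k) * (t / \<gamma> - real k)"
proof -
  have 1: "real k \<le> t / \<gamma>" "t / \<gamma> \<le> real k + 1" using \<gamma> t by (auto simp: field_simps)
  have 0: "\<not> t < 0" using t \<gamma> by (smt (verit) mult_nonneg_nonneg of_nat_0_le_iff)
  \<comment> \<open>A grid point belongs to two segments. At the right end floor and ceiling are
    both \<open>Suc k\<close>, and the formula of segment \<open>k\<close> still returns
    \<open>x (Suc k)\<close>.\<close>
  consider "t / \<gamma> = real k" | "real k < t / \<gamma>" "t / \<gamma> < real k + 1" | "t / \<gamma> = real (Suc k)"
    using 1 by fastforce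
  then show ?thesis
  proof cases
    case 1
    then show ?thesis using 0 unfolding interp_def by simp
  next
    case 2
    then have "\<lfloor>t / \<gamma>\<rfloor> = int k" "\<lceil>t / \<gamma>\<rceil> = int (Suc k)"
      by (auto intro!: floor_unique ceiling_unique)
    then show ?thesis using 0 unfolding interp_def by (simp add: nat_add_distrib)
  next
    case 3
    then have "\<lfloor>t / \<gamma>\<rfloor> = int (Suc k)" "\<lceil>t / \<gamma>\<rceil> = int (Suc k)"
      by (auto intro!: floor_unique ceiling_unique)
    then show ?thesis using 0 3 unfolding interp_def by (simp add: nat_add_distrib)
  qed
qed

lemma ex_segment:
  assumes "\<gamma> > 0" "t \<ge> 0"
  obtains k where "\<gamma> * real k \<le> t" "t \<le> \<gamma> * (real k + 1)" "k = nat \<lfloor>t / \<gamma>\<rfloor>"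
proof
  have *: "real (nat \<lfloor>t / \<gamma>\<rfloor>) = of_int \<lfloor>t / \<gamma>\<rfloor>" using assms by simp
  show "\<gamma> * real (nat \<lfloor>t / \<gamma>\<rfloor>) \<le> t" "t \<le> \<gamma> * (real (nat \<lfloor>t / \<gamma>\<rfloor>) + 1)"
    unfolding * mult.commute[of \<gamma>]
    using assms(1) pos_le_divide_eq[THEN iffD1, OF _ of_int_floor_le]
      pos_divide_le_eq[THEN iffD1, OF _ real_of_int_floor_add_one_ge] by blast+
qed simp

text \<open>The weight depends on the time only and not on the sequence, so interpolations of
  different sequences can be compared.\<close>

lemma interp_convex:
  assumes \<gamma>: "\<gamma> > 0" and t: "\<gamma> * real k \<le> t" "t \<le> \<gamma> * (real k + 1)"
  obtains \<theta> where "0 \<le> \<theta>" "\<theta> \<le> 1" "\<And>x. interp \<gamma> x t = (1 - \<theta>) * x k + \<theta> * x (Suc k)"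
proof
  show "0 \<le> t / \<gamma> - real k" "t / \<gamma> - real k \<le> 1" using \<gamma> t by (auto simp: field_simps)
  show "interp \<gamma> x t = (1 - (t / \<gamma> - real k)) * x k + (t / \<gamma> - real k) * x (Suc k)" for x
    unfolding interp_segment[OF assms] by (simp add: algebra_simps)
qed

text \<open>Each increment carries a clamped linear function of time: 1 once its step is completed,
  a fraction while it runs, 0 before. On a bounded time range this is one finite sum of continuous
  functions, which gives continuity without gluing at grid points.\<close>

lemma interp_sum:
  assumes \<gamma>: "\<gamma> > 0" and t: "0 \<le> t" "t < \<gamma> * real N"
  shows "interp \<gamma> x t = x 0 + (\<Sum>k<N. (x (Suc k) - x k) * min 1 (max 0 (t / \<gamma> - real k)))"
proof -
  obtain m where m: "\<gamma> * real m \<le> t" "t \<le> \<gamma> * (real m + 1)"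
    using ex_segment[OF \<gamma> t(1)] .
  have m': "real m \<le> t / \<gamma>" "t / \<gamma> \<le> real m + 1" using m \<gamma> by (auto simp: field_simps)
  have "\<gamma> * real m < \<gamma> * real N" using m t by linarith
  then have mN: "m < N" using \<gamma> by simp
  have "(\<Sum>k<N. (x (Suc k) - x k) * min 1 (max 0 (t / \<gamma> - real k))) =
    (\<Sum>k<Suc m. (x (Suc k) - x k) * min 1 (max 0 (t / \<gamma> - real k)))"
  proof (rule sum.mono_neutral_right)
    show "\<forall>k\<in>{..<N} - {..<Suc m}. (x (Suc k) - x k) * min 1 (max 0 (t / \<gamma> - real k)) = 0"
    proof
      fix k assume "k \<in> {..<N} - {..<Suc m}"
      then have "real m + 1 \<le> real k" by auto
      then have "t / \<gamma> - real k \<le> 0" using m' by linarith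
      then show "(x (Suc k) - x k) * min 1 (max 0 (t / \<gamma> - real k)) = 0" by simp
    qed
  qed (use mN in auto)
  also have "\<dots> = (\<Sum>k<m. x (Suc k) - x k) + (x (Suc m) - x m) * (t / \<gamma> - real m)"
  proof -
    have "(x (Suc k) - x k) * min 1 (max 0 (t / \<gamma> - real k)) = x (Suc k) - x k" if "k < m" for k
    proof -
      have "real k + 1 \<le> real m" using that by linarith
      then have "1 \<le> t / \<gamma> - real k" using m' by linarith
      then show ?thesis by simp
    qed
    moreover have "min 1 (max 0 (t / \<gamma> - real m)) = t / \<gamma> - real m" using m' by simp
    ultimately show ?thesis by simp
  qed
  also have "(\<Sum>k<m. x (Suc k) - x k) = x m - x 0" by (rule sum_lessThan_telescope)
  finally show ?thesis using interp_segment[OF \<gamma> m] by simp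
qed

lemma interp_Wpaths: "interp \<gamma> x \<in> Wpaths" if \<gamma>: "\<gamma> > 0"
proof -
  have "continuous (at t within {0..}) (interp \<gamma> x)" if t: "t \<in> {0..}" for t
  proof -
    obtain N where "t / \<gamma> < real N" using reals_Archimedean2 by blast
    then have N: "t < \<gamma> * real N" using \<gamma> by (simp add: field_simps)
    let ?f = "\<lambda>t. x 0 + (\<Sum>k<N. (x (Suc k) - x k) * min 1 (max 0 (t / \<gamma> - real k)))"
    have "continuous_on {0..} ?f" using \<gamma> by (intro continuous_intros) auto
    then have "continuous (at t within {0..}) ?f" using t by (simp add: continuous_on_eq_continuous_within)
    moreover have "\<forall>\<^sub>F s in at t within {0..}. interp \<gamma> x s = ?f s"
    proof -
      have "\<forall>\<^sub>F s in at t within {0..}. s < \<gamma> * real N"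
        using N by (intro order_tendstoD[OF tendsto_ident_at])
      moreover have "\<forall>\<^sub>F s in at t within {0..}. s \<in> {0..}" by (simp add: eventually_at_topological) blast
      ultimately show ?thesis by eventually_elim (use interp_sum[OF \<gamma>] in auto)
    qed
    ultimately show ?thesis
      using t N interp_sum[OF \<gamma> _ N, of x] unfolding continuous_within
      by (subst tendsto_cong) auto
  qed
  then show ?thesis by (auto simp: Wpaths_def continuous_on_eq_continuous_within interp_def)
qed

text \<open>Sequences carry the product topology. Up to time \<open>T\<close> the path involves
  finitely many coordinates and is a convex combination of two of them at each time, so coordinates
  within \<eta> yield paths within \<eta>.\<close>

lemma continuous_interp: "continuous_map euclidean Wtop (interp \<gamma>)" if \<gamma>: "\<gamma> > 0"
  unfolding Wtop_alt
proof (rule continuous_on_generated_topo)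
  show "interp \<gamma> ` topspace euclidean \<subseteq> \<Union>{path_ball w T e |w T e. w \<in> Wpaths \<and> 0 \<le> T \<and> 0 < e}"
    using interp_Wpaths[OF \<gamma>] topspace_Wtop unfolding Wtop_alt by auto
  fix U assume "U \<in> {path_ball w T e |w T e. w \<in> Wpaths \<and> 0 \<le> T \<and> 0 < e}"
  then obtain w T e where U: "U = path_ball w T e" and w: "w \<in> Wpaths" and T: "0 \<le> T" and e: "0 < e"
    by auto
  have "open (interp \<gamma> -` U)"
  proof (subst open_subopen, intro ballI)
    fix x assume "x \<in> interp \<gamma> -` U"
    then have x: "\<bar>interp \<gamma> x t - w t\<bar> < e" if "t \<in> {0..T}" for t
      using that by (auto simp: U path_ball_def)
    have "continuous_on {0..T} (\<lambda>t. \<bar>interp \<gamma> x t - w t\<bar>)"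
      by (intro continuous_intros Wpaths_continuous interp_Wpaths \<gamma> w) auto
    then obtain s where s: "s \<in> {0..T}" "\<forall>t\<in>{0..T}. \<bar>interp \<gamma> x t - w t\<bar> \<le> \<bar>interp \<gamma> x s - w s\<bar>"
      using continuous_attains_sup[of "{0..T}"] T by fastforce
    \<comment> \<open>On the compact interval the distance attains its maximum, which is below
      \<open>e\<close>; the difference is a margin valid at all times.\<close>
    define \<eta> where "\<eta> = e - \<bar>interp \<gamma> x s - w s\<bar>"
    have \<eta>: "\<eta> > 0" using x[OF s(1)] by (simp add: \<eta>_def)
    obtain N where "T / \<gamma> < real N" using reals_Archimedean2 by blast
    then have N: "T < \<gamma> * real N" using \<gamma> by (simp add: field_simps)
    let ?O = "\<Inter>k\<in>{..N}. (\<lambda>y. y k) -` ball (x k) \<eta>"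
    have "open ?O"
      by (intro open_INT finite_atMost ballI open_vimage open_ball continuous_on_product_coordinates)
    moreover have "x \<in> ?O" using \<eta> by simp
    moreover have "?O \<subseteq> interp \<gamma> -` U"
    proof
      fix y assume y: "y \<in> ?O"
      have "\<bar>interp \<gamma> y t - w t\<bar> < e" if t: "t \<in> {0..T}" for t
      proof -
        obtain k where k: "\<gamma> * real k \<le> t" "t \<le> \<gamma> * (real k + 1)" using ex_segment[OF \<gamma>, of t] t by (metis atLeastAtMost_iff)
        obtain \<theta> where \<theta>: "0 \<le> \<theta>" "\<theta> \<le> 1" "\<And>x. interp \<gamma> x t = (1 - \<theta>) * x k + \<theta> * x (Suc k)"
          using interp_convex[OF \<gamma> k] by blast
        have "\<gamma> * real k < \<gamma> * real N" using k t N by auto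
        then have "k < N" using \<gamma> by simp
        then have yk: "\<bar>y k - x k\<bar> < \<eta>" "\<bar>y (Suc k) - x (Suc k)\<bar> < \<eta>"
          using y by (auto simp: dist_real_def abs_minus_commute)
        have "interp \<gamma> y t - interp \<gamma> x t = (1 - \<theta>) * (y k - x k) + \<theta> * (y (Suc k) - x (Suc k))"
          unfolding \<theta>(3) by (simp add: algebra_simps)
        also have "\<bar>\<dots>\<bar> < \<eta>"
        proof -
          have "(1 - \<theta>) *\<^sub>R (y k - x k) + \<theta> *\<^sub>R (y (Suc k) - x (Suc k)) \<in> ball 0 \<eta>"
            using yk \<theta> by (intro convexD[OF convex_ball]) (auto simp: dist_real_def)
          then show ?thesis by (simp add: dist_real_def)
        qed
        finally have "\<bar>interp \<gamma> y t - interp \<gamma> x t\<bar> < \<eta>" .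
        then show ?thesis using s(2) t unfolding \<eta>_def by fastforce
      qed
      then show "y \<in> interp \<gamma> -` U" using interp_Wpaths[OF \<gamma>] by (auto simp: U path_ball_def)
    qed
    ultimately show "\<exists>S. open S \<and> x \<in> S \<and> S \<subseteq> interp \<gamma> -` U" by blast
  qed
  then show "openin euclidean (interp \<gamma> -` U \<inter> topspace euclidean)" by simp
qed

text \<open>Borel measurability of the random path comes from continuity of
  \<open>interp \<gamma>\<close>, which treats arbitrary open sets at once, uncountable unions of
  balls included.\<close>

lemma measurable_interp:
  assumes \<gamma>: "\<gamma> > 0" and X: "\<And>k. X k \<in> borel_measurable M"
  shows "(\<lambda>\<omega>. interp \<gamma> (\<lambda>k. X k \<omega>)) \<in> measurable M Wborel"
proof -
  have 1: "(\<lambda>\<omega> k. X k \<omega>) \<in> measurable M borel"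
    by (rule measurable_coordinatewise_then_product) (rule X)
  have 2: "interp \<gamma> \<in> measurable borel Wborel"
    unfolding Wborel_def
  proof (rule measurable_measure_of)
    show "{U. openin Wtop U} \<subseteq> Pow (topspace Wtop)" using openin_subset by blast
    show "interp \<gamma> \<in> space borel \<rightarrow> topspace Wtop" using interp_Wpaths[OF \<gamma>] by auto
    fix U assume "U \<in> {U. openin Wtop U}"
    then have "openin euclidean {x \<in> topspace euclidean. interp \<gamma> x \<in> U}"
      using continuous_interp[OF \<gamma>] unfolding continuous_map_def by blast
    then show "interp \<gamma> -` U \<inter> space borel \<in> sets borel" by (simp add: vimage_def)
  qed
  show ?thesis using measurable_compose[OF 1 2] .
qed

lemma interp_near:
  assumes \<gamma>: "\<gamma> > 0" and t: "\<gamma> * real k \<le> t" "t \<le> \<gamma> * (real k + 1)"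
  shows "\<bar>interp \<gamma> x t - x k\<bar> \<le> \<bar>x (Suc k) - x k\<bar>" "\<bar>interp \<gamma> x t - x (Suc k)\<bar> \<le> \<bar>x (Suc k) - x k\<bar>"
proof -
  obtain \<theta> where \<theta>: "0 \<le> \<theta>" "\<theta> \<le> 1" "\<And>x. interp \<gamma> x t = (1 - \<theta>) * x k + \<theta> * x (Suc k)"
    using interp_convex[OF assms] by blast
  have 1: "interp \<gamma> x t - x k = \<theta> * (x (Suc k) - x k)" 
    and 2: "interp \<gamma> x t - x (Suc k) = (1 - \<theta>) * (x k - x (Suc k))"
    unfolding \<theta>(3) by (simp_all add: algebra_simps)
  show "\<bar>interp \<gamma> x t - x k\<bar> \<le> \<bar>x (Suc k) - x k\<bar>"
    unfolding 1 abs_mult using \<theta> by (intro mult_left_le_one_le) auto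
  show "\<bar>interp \<gamma> x t - x (Suc k)\<bar> \<le> \<bar>x (Suc k) - x k\<bar>"
    unfolding 2 abs_mult abs_minus_commute[of "x k"] using \<theta> by (intro mult_left_le_one_le) auto
qed

section \<open>Path integrals as Riemann sums over the grid\<close>

lemma segment_integral:
  fixes \<psi> :: "real \<Rightarrow> real"
  assumes \<psi>: "\<Lambda>-lipschitz_on UNIV \<psi>" and \<gamma>: "\<gamma> > 0" and t: "\<gamma> * real k \<le> t" "t \<le> \<gamma> * (real k + 1)"
  shows "\<bar>integral {\<gamma> * real k..t} (\<lambda>u. \<psi> (interp \<gamma> x u)) - (t - \<gamma> * real k) * \<psi> (x k)\<bar>
    \<le> (t - \<gamma> * real k) * (\<Lambda> * \<bar>x (Suc k) - x k\<bar>)"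
proof -
  have c: "continuous_on {\<gamma> * real k..t} (\<lambda>u. \<psi> (interp \<gamma> x u))"
    using \<gamma> by (intro lipschitz_imp_continuous_comp[OF \<psi>] Wpaths_continuous interp_Wpaths) auto
  have "integral {\<gamma> * real k..t} (\<lambda>u. \<psi> (interp \<gamma> x u)) - (t - \<gamma> * real k) * \<psi> (x k) =
    integral {\<gamma> * real k..t} (\<lambda>u. \<psi> (interp \<gamma> x u) - \<psi> (x k))"
    using t c by (subst Henstock_Kurzweil_Integration.integral_diff) (auto intro!: integrable_continuous_interval)
  also have "norm \<dots> \<le> (\<Lambda> * \<bar>x (Suc k) - x k\<bar>) * (t - \<gamma> * real k)"
  proof (rule integral_bound[OF t(1)])
    show "continuous_on {\<gamma> * real k..t} (\<lambda>u. \<psi> (interp \<gamma> x u) - \<psi> (x k))"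
      using c by (intro continuous_intros)
    fix u assume u: "u \<in> {\<gamma> * real k..t}"
    have "norm (\<psi> (interp \<gamma> x u) - \<psi> (x k)) \<le> \<Lambda> * \<bar>interp \<gamma> x u - x k\<bar>"
      using lipschitz_onD[OF \<psi>, of "interp \<gamma> x u" "x k"] by (simp add: dist_real_def)
    also have "\<dots> \<le> \<Lambda> * \<bar>x (Suc k) - x k\<bar>"
      using interp_near(1)[OF \<gamma>, of k u x] u t lipschitz_on_nonneg[OF \<psi>] by (intro mult_left_mono) auto
    finally show "norm (\<psi> (interp \<gamma> x u) - \<psi> (x k)) \<le> \<Lambda> * \<bar>x (Suc k) - x k\<bar>" .
  qed
  finally show ?thesis by (simp add: mult.commute)
qed

lemma grid_integral:
  fixes \<psi> :: "real \<Rightarrow> real"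
  assumes \<psi>: "\<Lambda>-lipschitz_on UNIV \<psi>" and \<gamma>: "\<gamma> > 0"
  shows "\<bar>integral {0..\<gamma> * real k} (\<lambda>u. \<psi> (interp \<gamma> x u)) - \<gamma> * (\<Sum>j<k. \<psi> (x j))\<bar>
    \<le> \<gamma> * \<Lambda> * (\<Sum>j<k. \<bar>x (Suc j) - x j\<bar>)"
proof (induction k)
  case (Suc k)
  let ?f = "\<lambda>u. \<psi> (interp \<gamma> x u)"
  have 0: "0 \<le> \<gamma> * real k" "\<gamma> * real k \<le> \<gamma> * real (Suc k)" using \<gamma> by auto
  have "?f integrable_on {0..\<gamma> * real (Suc k)}"
    using \<gamma> by (intro integrable_continuous_interval lipschitz_imp_continuous_comp[OF \<psi>] Wpaths_continuous interp_Wpaths) auto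
  then have "integral {0..\<gamma> * real (Suc k)} ?f = integral {0..\<gamma> * real k} ?f + integral {\<gamma> * real k..\<gamma> * real (Suc k)} ?f"
    using Henstock_Kurzweil_Integration.integral_combine[OF 0] by metis
  moreover have "\<bar>integral {\<gamma> * real k..\<gamma> * real (Suc k)} ?f - \<gamma> * \<psi> (x k)\<bar> \<le> \<gamma> * (\<Lambda> * \<bar>x (Suc k) - x k\<bar>)"
    using segment_integral[OF \<psi> \<gamma>, of k "\<gamma> * real (Suc k)" x] \<gamma> by (simp add: algebra_simps)
  ultimately show ?case using Suc.IH by (simp add: algebra_simps)
qed simp

text \<open>The grid estimate is used up to the last grid point before \<open>t\<close>, and the
  segment in progress is filled up to full length, which costs the term with
  \<open>\<psi> (x (K - 1))\<close>. For \<open>t = 0\<close> one has \<open>K = 0\<close>, and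
  truncated subtraction makes \<open>K - 1 = 0\<close> as well.\<close>

lemma riemann_sum:
  fixes \<psi> :: "real \<Rightarrow> real"
  assumes \<psi>: "\<Lambda>-lipschitz_on UNIV \<psi>" and \<gamma>: "\<gamma> > 0" and t: "t \<ge> 0"
  defines "K \<equiv> nat \<lceil>t / \<gamma>\<rceil>"
  shows "\<bar>(LINT u:{0..t}|lborel. \<psi> (interp \<gamma> x u)) - \<gamma> * (\<Sum>j<K. \<psi> (x j))\<bar>
    \<le> \<gamma> * \<Lambda> * (\<Sum>j<K. \<bar>x (Suc j) - x j\<bar>) + \<gamma> * \<bar>\<psi> (x (K - 1))\<bar>"
    and "\<bar>interp \<gamma> x t - x K\<bar> \<le> \<bar>x (Suc (K - 1)) - x (K - 1)\<bar>"
proof -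
  let ?f = "\<lambda>u. \<psi> (interp \<gamma> x u)"
  have c: "continuous_on {0..t} ?f"
    using \<gamma> by (intro lipschitz_imp_continuous_comp[OF \<psi>] Wpaths_continuous interp_Wpaths) auto
  have "\<bar>integral {0..t} ?f - \<gamma> * (\<Sum>j<K. \<psi> (x j))\<bar>
    \<le> \<gamma> * \<Lambda> * (\<Sum>j<K. \<bar>x (Suc j) - x j\<bar>) + \<gamma> * \<bar>\<psi> (x (K - 1))\<bar>
    \<and> \<bar>interp \<gamma> x t - x K\<bar> \<le> \<bar>x (Suc (K - 1)) - x (K - 1)\<bar>"
  proof (cases "t = 0")
    case True
    then have "K = 0" by (simp add: K_def)
    then show ?thesis using True \<gamma> by (simp add: interp_def)
  next
    case False
    then have pos: "t / \<gamma> > 0" using t \<gamma> by simp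
    then have "0 < \<lceil>t / \<gamma>\<rceil>" by simp
    then obtain k where k: "K = Suc k" and Kc: "real K = of_int \<lceil>t / \<gamma>\<rceil>"
      unfolding K_def using not0_implies_Suc[of "nat \<lceil>t / \<gamma>\<rceil>"] by auto
    have "t / \<gamma> \<le> real K" "real K < t / \<gamma> + 1" unfolding Kc by linarith+
    then have s: "\<gamma> * real k \<le> t" "t \<le> \<gamma> * (real k + 1)"
      using \<gamma> by (auto simp: k field_simps)
    have 0: "0 \<le> \<gamma> * real k" using \<gamma> by simp
    have comb: "integral {0..t} ?f = integral {0..\<gamma> * real k} ?f + integral {\<gamma> * real k..t} ?f"
      using Henstock_Kurzweil_Integration.integral_combine[OF 0 s(1) integrable_continuous_interval[OF c]] by simp
    note seg = segment_integral[OF \<psi> \<gamma> s, of x] and grid = grid_integral[OF \<psi> \<gamma>, of k x]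
    have l1: "(t - \<gamma> * real k) * (\<Lambda> * \<bar>x (Suc k) - x k\<bar>) \<le> \<gamma> * (\<Lambda> * \<bar>x (Suc k) - x k\<bar>)"
      using s lipschitz_on_nonneg[OF \<psi>] by (intro mult_right_mono) (auto simp: algebra_simps)
    have "\<bar>(t - \<gamma> * real k) * \<psi> (x k) - \<gamma> * \<psi> (x k)\<bar> = \<bar>t - \<gamma> * real k - \<gamma>\<bar> * \<bar>\<psi> (x k)\<bar>"
      unfolding left_diff_distrib[symmetric] by (rule abs_mult)
    also have "\<dots> \<le> \<gamma> * \<bar>\<psi> (x k)\<bar>" using s by (intro mult_right_mono) (auto simp: algebra_simps)
    finally have l2: "\<bar>(t - \<gamma> * real k) * \<psi> (x k) - \<gamma> * \<psi> (x k)\<bar> \<le> \<gamma> * \<bar>\<psi> (x k)\<bar>" .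
    have e1: "\<gamma> * (\<Sum>j<K. \<psi> (x j)) = \<gamma> * (\<Sum>j<k. \<psi> (x j)) + \<gamma> * \<psi> (x k)"
      and e2: "\<gamma> * \<Lambda> * (\<Sum>j<K. \<bar>x (Suc j) - x j\<bar>) = \<gamma> * \<Lambda> * (\<Sum>j<k. \<bar>x (Suc j) - x j\<bar>) + \<gamma> * (\<Lambda> * \<bar>x (Suc k) - x k\<bar>)"
      by (simp_all add: k algebra_simps)
    have "\<bar>integral {0..t} ?f - \<gamma> * (\<Sum>j<K. \<psi> (x j))\<bar>
      \<le> \<gamma> * \<Lambda> * (\<Sum>j<K. \<bar>x (Suc j) - x j\<bar>) + \<gamma> * \<bar>\<psi> (x k)\<bar>"
      unfolding comb e1 e2 using seg grid l1 l2 by linarith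
    moreover have "\<bar>interp \<gamma> x t - x (Suc k)\<bar> \<le> \<bar>x (Suc k) - x k\<bar>" using interp_near(2)[OF \<gamma> s] .
    ultimately show ?thesis by (simp add: k)
  qed
  then show "\<bar>(LINT u:{0..t}|lborel. \<psi> (interp \<gamma> x u)) - \<gamma> * (\<Sum>j<K. \<psi> (x j))\<bar>
    \<le> \<gamma> * \<Lambda> * (\<Sum>j<K. \<bar>x (Suc j) - x j\<bar>) + \<gamma> * \<bar>\<psi> (x (K - 1))\<bar>"
    "\<bar>interp \<gamma> x t - x K\<bar> \<le> \<bar>x (Suc (K - 1)) - x (K - 1)\<bar>"
    using LINT_eq_integral[OF c] by auto
qed

text \<open>Up to time \<open>s\<close> no index beyond
  \<open>nat \<lceil>s / \<gamma>\<rceil>\<close> is used. Freezing the sequence there is how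
  functionals of the path up to \<open>s\<close> are seen to depend on the discrete past
  (\<open>past_test_Fil\<close>).\<close>

lemma interp_stopped:
  assumes \<gamma>: "\<gamma> > 0" and t: "t \<ge> 0" "t \<le> s"
  shows "interp \<gamma> (\<lambda>k. x (min k (nat \<lceil>s / \<gamma>\<rceil>))) t = interp \<gamma> x t"
proof -
  have "t / \<gamma> \<le> s / \<gamma>" using t \<gamma> by (simp add: divide_right_mono)
  then have 1: "nat \<lceil>t / \<gamma>\<rceil> \<le> nat \<lceil>s / \<gamma>\<rceil>" by (intro nat_mono ceiling_mono)
  have "nat \<lfloor>t / \<gamma>\<rfloor> \<le> nat \<lceil>t / \<gamma>\<rceil>" by (intro nat_mono floor_le_ceiling)
  then have 2: "nat \<lfloor>t / \<gamma>\<rfloor> \<le> nat \<lceil>s / \<gamma>\<rceil>" using 1 by (rule order_trans)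
  show ?thesis using t(1) unfolding interp_def min_absorb1[OF 1] min_absorb1[OF 2] by simp
qed

lemma interp_nonneg: "interp \<gamma> x t \<ge> 0" if \<gamma>: "\<gamma> > 0" and x: "\<And>k. x k \<ge> 0"
proof (cases "t < 0")
  case False
  then obtain k where k: "\<gamma> * real k \<le> t" "t \<le> \<gamma> * (real k + 1)" using ex_segment[OF \<gamma>, of t] by (metis not_less)
  obtain \<theta> where "0 \<le> \<theta>" "\<theta> \<le> 1" "\<And>x. interp \<gamma> x t = (1 - \<theta>) * x k + \<theta> * x (Suc k)"
    using interp_convex[OF \<gamma> k] by blast
  then show ?thesis using x by simp
qed (simp add: interp_def)

section \<open>The canonical filtration and adaptedness of path integrals\<close>

lemma Wfilt_subset_Wborel: "Wfilt t \<subseteq> sets Wborel"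
proof -
  have "{w \<in> Wpaths. w s \<in> A} \<in> sets Wborel" if "0 \<le> s" "A \<in> sets borel" for s A
    using measurable_sets[OF continuous_map_measurable_Wborel[OF continuous_map_eval[OF that(1)]] that(2)]
    by (simp add: vimage_def Int_def conj_commute)
  then have "{{w \<in> Wpaths. w s \<in> A} | s A. 0 \<le> s \<and> s \<le> t \<and> A \<in> sets borel} \<subseteq> sets Wborel"
    by auto
  then show ?thesis
    unfolding Wfilt_def space_Wborel[symmetric] by (rule sets.sigma_sets_subset)
qed

lemma sets_Wfilt: "sets (sigma Wpaths (Wfilt t)) = Wfilt t"
proof -
  have "Wfilt t \<subseteq> Pow Wpaths" using Wfilt_subset_Wborel sets.sets_into_space[of _ Wborel] by auto
  then have "sets (sigma Wpaths (Wfilt t)) = sigma_sets Wpaths (Wfilt t)" by (rule sets_measure_of)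
  also have "\<dots> = Wfilt t"
    unfolding Wfilt_def by (rule sigma_sets_sigma_sets_eq) auto
  finally show ?thesis .
qed

lemma space_Wfilt: "space (sigma Wpaths (Wfilt t)) = Wpaths"
  by (simp add: space_measure_of_conv)

lemma eval_Wfilt: "0 \<le> s \<Longrightarrow> s \<le> t \<Longrightarrow> (\<lambda>w. w s) \<in> borel_measurable (sigma Wpaths (Wfilt t))"
proof (rule measurableI)
  fix A :: "real set" assume A: "0 \<le> s" "s \<le> t" "A \<in> sets borel"
  have "{w \<in> Wpaths. w s \<in> A} \<in> Wfilt t"
    unfolding Wfilt_def by (rule sigma_sets.Basic) (use A in auto)
  then show "(\<lambda>w. w s) -` A \<inter> space (sigma Wpaths (Wfilt t)) \<in> sets (sigma Wpaths (Wfilt t))"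
    unfolding sets_Wfilt space_Wfilt by (simp add: vimage_def Int_def conj_commute)
qed auto

text \<open>For a Borel function \<open>h\<close> the functional need not be continuous. Adaptedness
  rests on joint measurability of the evaluation in path and time over \<open>[0, t]\<close>,
  obtained as a limit of evaluations at grid times.\<close>

lemma path_integral_Wfilt:
  fixes h :: "real \<Rightarrow> real"
  assumes [measurable]: "h \<in> borel_measurable borel" and t: "0 \<le> t"
  shows "(\<lambda>w. LINT u:{0..t}|lborel. h (w u)) \<in> borel_measurable (sigma Wpaths (Wfilt t))"
proof -
  let ?F = "sigma Wpaths (Wfilt t)"
  \<comment> \<open>Time is rounded down to a grid of mesh \<open>1 / Suc n\<close> and clamped to
    \<open>[0, t]\<close>: it takes countably many values, all visible to
    \<open>Wfilt t\<close>.\<close>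
  define p where "p n u = max 0 (min t (of_int \<lfloor>real (Suc n) * u\<rfloor> / real (Suc n)))" for n :: nat and u
  have clip: "max 0 (min t u) \<in> {0..t}" for u using t by auto
  have pm: "(\<lambda>x. (fst x) (p n (snd x))) \<in> borel_measurable (?F \<Otimes>\<^sub>M lborel)" for n
    unfolding p_def
  proof (rule measurable_compose_countable[where g = "\<lambda>x. \<lfloor>real (Suc n) * snd x\<rfloor>"
        and f = "\<lambda>i x. (fst x) (max 0 (min t (of_int i / real (Suc n))))"])
    show "(\<lambda>x. (fst x) (max 0 (min t (of_int i / real (Suc n))))) \<in> borel_measurable (?F \<Otimes>\<^sub>M lborel)" for i :: int
      by (rule measurable_compose[OF measurable_fst eval_Wfilt]) (use clip in auto)
  qed measurable
  have lim: "(\<lambda>n. w (p n u)) \<longlonglongrightarrow> w (max 0 (min t u))" if w: "w \<in> Wpaths" for w u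
  proof -
    have "(\<lambda>n. of_int \<lfloor>real (Suc n) * u\<rfloor> / real (Suc n)) \<longlonglongrightarrow> u"
    proof (rule real_tendsto_sandwich[where f = "\<lambda>n. u - 1 / real (Suc n)" and h = "\<lambda>n. u"])
      have "u - 1 / real (Suc n) \<le> of_int \<lfloor>real (Suc n) * u\<rfloor> / real (Suc n)"
        "of_int \<lfloor>real (Suc n) * u\<rfloor> / real (Suc n) \<le> u" for n
      proof -
        have "real (Suc n) * u - 1 \<le> of_int \<lfloor>real (Suc n) * u\<rfloor>" "of_int \<lfloor>real (Suc n) * u\<rfloor> \<le> real (Suc n) * u" 
          by linarith+
        then have "(real (Suc n) * u - 1) / real (Suc n) \<le> of_int \<lfloor>real (Suc n) * u\<rfloor> / real (Suc n)"
          "of_int \<lfloor>real (Suc n) * u\<rfloor> / real (Suc n) \<le> (real (Suc n) * u) / real (Suc n)"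
          by (intro divide_right_mono; simp)+
        then show "u - 1 / real (Suc n) \<le> of_int \<lfloor>real (Suc n) * u\<rfloor> / real (Suc n)"
        "of_int \<lfloor>real (Suc n) * u\<rfloor> / real (Suc n) \<le> u" by (simp_all add: diff_divide_distrib)
      qed
      then show "\<forall>\<^sub>F n in sequentially. u - 1 / real (Suc n) \<le> of_int \<lfloor>real (Suc n) * u\<rfloor> / real (Suc n)"
        "\<forall>\<^sub>F n in sequentially. of_int \<lfloor>real (Suc n) * u\<rfloor> / real (Suc n) \<le> u" by auto
      have "(\<lambda>n. u - 1 / real (Suc n)) \<longlonglongrightarrow> u - 0"
        by (intro tendsto_intros LIMSEQ_Suc[OF lim_1_over_n])
      then show "(\<lambda>n. u - 1 / real (Suc n)) \<longlonglongrightarrow> u" by simp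
    qed simp
    then have "(\<lambda>n. p n u) \<longlonglongrightarrow> max 0 (min t u)"
      unfolding p_def by (intro tendsto_intros)
    moreover have "continuous_on {0..} w" using w by (simp add: Wpaths_def)
    ultimately show ?thesis
      by (intro continuous_on_tendsto_compose[of "{0..}" w]) (auto simp: p_def)
  qed
  have [measurable]: "(\<lambda>x. (fst x) (max 0 (min t (snd x)))) \<in> borel_measurable (?F \<Otimes>\<^sub>M lborel)"
    by (rule borel_measurable_LIMSEQ_real[OF _ pm]) (auto simp: space_pair_measure space_Wfilt intro!: lim)
  have "(\<lambda>w. \<integral>u. indicator {0..t} u * h (w (max 0 (min t u))) \<partial>lborel) \<in> borel_measurable ?F"
    by (rule lborel.borel_measurable_lebesgue_integral) (simp add: split_beta', measurable)
  also have "(\<lambda>w. \<integral>u. indicator {0..t} u * h (w (max 0 (min t u))) \<partial>lborel) = (\<lambda>w. LINT u:{0..t}|lborel. h (w u))"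
    unfolding set_lebesgue_integral_def
    by (intro ext Bochner_Integration.integral_cong) (auto simp: indicator_def)
  finally show ?thesis .
qed

section \<open>Interpolated paths\<close>

text \<open>For \<open>\<delta> > 0\<close> it is zero up to \<open>\<delta> / 2\<close> and one
  from \<delta> on. The first property confines it to positions where \<open>step_var_ge\<close> is
  effective; the second confines its deviation from the indicator of \<open>{0<..}\<close> to the
  zone that \<open>occupation\<close> controls.\<close>

definition ramp :: "real \<Rightarrow> real \<Rightarrow> real" where
  "ramp \<delta> x = max 0 (min 1 (2 * x / \<delta> - 1))"

lemma ramp_bounds: "0 \<le> ramp \<delta> x" "ramp \<delta> x \<le> 1"
  by (auto simp: ramp_def)

lemma ramp_lipschitz: "(2 / \<delta>)-lipschitz_on UNIV (ramp \<delta>)" if "\<delta> > 0"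
proof (rule lipschitz_onI)
  fix x y
  have "\<bar>ramp \<delta> x - ramp \<delta> y\<bar> \<le> \<bar>(2 * x / \<delta> - 1) - (2 * y / \<delta> - 1)\<bar>"
    by (auto simp: ramp_def max_def min_def abs_if)
  also have "(2 * x / \<delta> - 1) - (2 * y / \<delta> - 1) = 2 / \<delta> * (x - y)"
    by (simp add: diff_divide_distrib right_diff_distrib)
  also have "\<bar>\<dots>\<bar> = 2 / \<delta> * \<bar>x - y\<bar>" unfolding abs_mult using that by simp
  finally show "dist (ramp \<delta> x) (ramp \<delta> y) \<le> 2 / \<delta> * dist x y" by (simp add: dist_real_def)
qed (use that in simp)

lemma ramp_measurable[measurable]: "ramp \<delta> \<in> borel_measurable borel"
  unfolding ramp_def by measurable

lemma lipschitz_extend: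
  fixes \<kappa> :: "real \<Rightarrow> real"
  assumes "L-lipschitz_on {0..} \<kappa>"
  shows "L-lipschitz_on UNIV (\<lambda>x. \<kappa> (max 0 x))"
proof (rule lipschitz_onI)
  fix x y :: real
  have "dist (\<kappa> (max 0 x)) (\<kappa> (max 0 y)) \<le> L * dist (max 0 x) (max 0 y)"
    using lipschitz_onD[OF assms, of "max 0 x" "max 0 y"] by simp
  also have "\<dots> \<le> L * dist x y"
    using lipschitz_on_nonneg[OF assms] by (intro mult_left_mono) (auto simp: dist_real_def)
  finally show "dist (\<kappa> (max 0 x)) (\<kappa> (max 0 y)) \<le> L * dist x y" .
qed (rule lipschitz_on_nonneg[OF assms])

text \<open>Since \<^term>\<open>\<kappa>\<close> is only regular on \<^term>\<open>{0..}\<close>, the continuous functional to which weak convergence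
  applies is \<^term>\<open>Mproc\<close> with \<^term>\<open>\<kappa>\<close> extended by a constant to the left.\<close>

definition Mcont :: "real \<Rightarrow> (real \<Rightarrow> real) \<Rightarrow> real \<Rightarrow> (real \<Rightarrow> real) \<Rightarrow> real" where
  "Mcont c \<kappa> t w = w t - w 0 - (c * t + (LINT u:{0..t}|lborel. \<kappa> (max 0 (w u))))"

lemma continuous_map_Mcont:
  assumes "L-lipschitz_on {0..} \<kappa>" "t \<ge> 0"
  shows "continuous_map Wtop euclideanreal (Mcont c \<kappa> t)"
  unfolding Mcont_def
  by (intro continuous_map_diff continuous_map_add continuous_map_eval
      continuous_map_path_integral[OF lipschitz_extend[OF assms(1)]] assms) auto

section \<open>Elementary inequalities for powers\<close>

lemma sum_power4:
  fixes a :: "'i \<Rightarrow> real"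
  shows "(\<Sum>i\<in>I. a i)^4 \<le> real (card I)^3 * (\<Sum>i\<in>I. a i^4)"
proof -
  have "((\<Sum>i\<in>I. a i)\<^sup>2)\<^sup>2 \<le> ((\<Sum>i\<in>I. (a i)\<^sup>2) * real (card I))\<^sup>2"
    using sum_squared_le_sum_of_squares[of a I] by (intro power_mono) (auto simp: mult.commute)
  also have "\<dots> = (\<Sum>i\<in>I. (a i)\<^sup>2)\<^sup>2 * (real (card I))\<^sup>2" by (simp add: power_mult_distrib)
  also have "\<dots> \<le> ((\<Sum>i\<in>I. ((a i)\<^sup>2)\<^sup>2) * real (card I)) * (real (card I))\<^sup>2"
    using sum_squared_le_sum_of_squares[of "\<lambda>i. (a i)\<^sup>2" I] by (intro mult_right_mono) (auto simp: mult.commute)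
  finally show ?thesis by (simp add: power4_eq_xxxx power3_eq_cube power2_eq_square algebra_simps)
qed

lemma add_power4: "(x + y)^4 \<le> 8 * x^4 + 8 * (y::real)^4"
proof -
  have "8 * x^4 + 8 * y^4 - (x + y)^4 = (x - y)\<^sup>2 * (7 * x\<^sup>2 + 10 * x * y + 7 * y\<^sup>2)"
    by (simp add: power2_eq_square power4_eq_xxxx algebra_simps)
  moreover have "7 * x\<^sup>2 + 10 * x * y + 7 * y\<^sup>2 = 5 * (x + y)\<^sup>2 + 2 * x\<^sup>2 + 2 * y\<^sup>2"
    by (simp add: power2_eq_square algebra_simps)
  ultimately have "8 * x^4 + 8 * y^4 - (x + y)^4 \<ge> 0" by simp
  then show ?thesis by simp
qed

lemma add3_sq: "(x + y + z)\<^sup>2 \<le> 3 * (x\<^sup>2 + y\<^sup>2 + (z::real)\<^sup>2)"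
proof -
  have "3 * (x\<^sup>2 + y\<^sup>2 + z\<^sup>2) - (x + y + z)\<^sup>2 = (x - y)\<^sup>2 + (y - z)\<^sup>2 + (x - z)\<^sup>2"
    by (simp add: power2_eq_square algebra_simps)
  then show ?thesis by (smt (verit) zero_le_power2)
qed

text \<open>With \<open>q = sqrt \<gamma>\<close> it turns a second moment of order \<gamma> into a
  first absolute moment of order \<open>sqrt \<gamma>\<close>.\<close>

lemma abs_le_sq_div: "\<bar>x\<bar> \<le> x\<^sup>2 / q + q" if "q > 0" for x q :: real
proof (cases "\<bar>x\<bar> \<le> q")
  case False
  then have "q * \<bar>x\<bar> \<le> \<bar>x\<bar> * \<bar>x\<bar>" by (intro mult_right_mono) auto
  then have "\<bar>x\<bar> \<le> x\<^sup>2 / q" using that by (simp add: field_simps power2_eq_square)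
  then show ?thesis using that by simp
qed (use that in \<open>simp add: add_increasing\<close>)

section \<open>From the path functional to the discrete martingale\<close>

context sticky_chain
begin

definition path :: "'a \<Rightarrow> real \<Rightarrow> real" where
  "path \<omega> = interp \<gamma> (\<lambda>k. X k \<omega>)"

definition steps :: "real \<Rightarrow> nat" where
  "steps t = nat \<lceil>t / \<gamma>\<rceil>"

lemma steps_bounds:
  assumes "t \<ge> 0"
  shows "\<gamma> * steps t \<le> t + \<gamma>" "t \<le> \<gamma> * steps t" "\<gamma> * steps t \<le> t + 1"
    "\<gamma> * (steps t - 1) \<le> t" "\<gamma> * real (steps t - 1) \<le> t + 1" "\<gamma> * real (Suc (steps t - 1)) \<le> t + 1"
proof -
  have "t / \<gamma> \<ge> 0" using assms gamma_pos by simp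
  then have "0 \<le> \<lceil>t / \<gamma>\<rceil>" by linarith
  then have *: "real (steps t) = of_int \<lceil>t / \<gamma>\<rceil>" by (simp add: steps_def)
  have "real (steps t) \<le> t / \<gamma> + 1" "t / \<gamma> \<le> real (steps t)" unfolding * by linarith+
  then show 1: "\<gamma> * steps t \<le> t + \<gamma>" "t \<le> \<gamma> * steps t" using gamma_pos by (auto simp: field_simps)
  show 2: "\<gamma> * steps t \<le> t + 1" using 1 gamma_le_1 by linarith
  show 3: "\<gamma> * (steps t - 1) \<le> t"
    using 1 assms gamma_pos by (cases "steps t") (auto simp: algebra_simps)
  then show "\<gamma> * real (steps t - 1) \<le> t + 1" by simp
  show "\<gamma> * real (Suc (steps t - 1)) \<le> t + 1"
    using 3 gamma_le_1 by (simp add: algebra_simps)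
qed

lemma steps_mono: "s \<le> t \<Longrightarrow> steps s \<le> steps t"
  using gamma_pos unfolding steps_def by (intro nat_mono ceiling_mono divide_right_mono) auto

lemma path_measurable: "path \<in> measurable P Wborel"
  unfolding path_def[abs_def] using gamma_pos X_measurable by (rule measurable_interp)

lemma path_functional_measurable:
  "continuous_map Wtop euclideanreal F \<Longrightarrow> (\<lambda>\<omega>. F (path \<omega>)) \<in> borel_measurable P"
  using measurable_compose[OF path_measurable continuous_map_measurable_Wborel] .

lemma Mcont_measurable[measurable]: "t \<ge> 0 \<Longrightarrow> (\<lambda>\<omega>. Mcont c \<kappa> t (path \<omega>)) \<in> borel_measurable P"
  using continuous_map_Mcont[OF lipschitz] by (rule path_functional_measurable)

definition Cdel :: "real \<Rightarrow> real" where
  "Cdel T = 8 * \<sigma>\<^sup>2 + 2 * (L + c)\<^sup>2 * mom T"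

lemma Cdel_nonneg: "Cdel T \<ge> 0"
  using mom_nonneg[of T] by (simp add: Cdel_def)

text \<open>The factor 3 is that of \<open>add3_sq\<close>. The summands belong to the three errors
  of \<open>Mcont_path_near\<close>: the step in progress at time \<open>t\<close>, the Riemann sum,
  and the drift over the missing part of that step.\<close>

definition Capp :: "real \<Rightarrow> real" where
  "Capp t = 3 * (Cdel (t + 1) + L\<^sup>2 * (t + 1)\<^sup>2 * Cdel (t + 1) + (L + c)\<^sup>2 * mom (t + 1))"

lemma Capp_nonneg: "Capp t \<ge> 0"
  using mom_nonneg[of "t + 1"] Cdel_nonneg[of "t + 1"] by (simp add: Capp_def)

lemma Mcont_path_near:
  assumes t: "t \<ge> 0" and X: "\<And>k. X k \<omega> \<ge> 0"
  defines "K \<equiv> steps t"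
  shows "\<bar>Mcont c \<kappa> t (path \<omega>) - Mart K \<omega>\<bar> \<le> \<bar>X (Suc (K - 1)) \<omega> - X (K - 1) \<omega>\<bar>
     + L * \<gamma> * (\<Sum>j<K. \<bar>X (Suc j) \<omega> - X j \<omega>\<bar>) + \<gamma> * (L + c) * (1 + X (K - 1) \<omega>)"
proof -
  note R = riemann_sum[OF lipschitz_extend[OF lipschitz] gamma_pos t, of "\<lambda>k. X k \<omega>",
      folded path_def steps_def K_def, unfolded max_absorb2[OF X]]
  have p0: "path \<omega> 0 = X 0 \<omega>" by (simp add: path_def interp_def)
  have "\<bar>c * (\<gamma> * K - t)\<bar> \<le> c * \<gamma>"
    using steps_bounds(1,2)[OF t] c_nonneg by (auto simp: K_def abs_mult intro!: mult_left_mono)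
  moreover have "\<gamma> * \<bar>\<kappa> (X (K - 1) \<omega>)\<bar> \<le> \<gamma> * (L * X (K - 1) \<omega>)"
    using kappa_bound[OF X] gamma_pos by (intro mult_left_mono) auto
  moreover have "\<gamma> * (L * X (K - 1) \<omega>) + c * \<gamma> \<le> \<gamma> * (L + c) * (1 + X (K - 1) \<omega>)"
    using gamma_pos L_nonneg c_nonneg X[of "K - 1"] by (simp add: algebra_simps)
  moreover have "Mcont c \<kappa> t (path \<omega>) - Mart K \<omega> = (path \<omega> t - X K \<omega>) + c * (\<gamma> * K - t)
     - ((LINT u:{0..t}|lborel. \<kappa> (max 0 (path \<omega> u))) - \<gamma> * (\<Sum>j<K. \<kappa> (X j \<omega>)))"
    by (simp add: Mcont_def Mart_def p0 sum.distrib sum_distrib_left algebra_simps)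
  moreover have "\<bar>u\<bar> \<le> a \<Longrightarrow> \<bar>v\<bar> \<le> q \<Longrightarrow> \<bar>w\<bar> \<le> b + p \<Longrightarrow> p \<le> l \<Longrightarrow> l + q \<le> e \<Longrightarrow> \<bar>u + v - w\<bar> \<le> a + b + e"
    for u v w a b p q l e :: real by linarith
  ultimately show ?thesis using R by (simp only: mult.commute[of L \<gamma>])
qed

lemma step_sq_moment':
  assumes "\<gamma> * k \<le> T"
  shows "(\<integral>\<omega>. (X (Suc k) \<omega> - X k \<omega>)\<^sup>2 \<partial>P) \<le> Cdel T * \<gamma>"
  using step_sq_moment(2)[OF assms] by (simp add: Cdel_def)

lemma steps_lt: "t \<ge> 0 \<Longrightarrow> j < steps t \<Longrightarrow> \<gamma> * real j \<le> t + 1"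
  using steps_bounds(3)[of t] gamma_pos by (smt (verit) mult_less_cancel_left_pos of_nat_less_iff)

text \<open>By Cauchy-Schwarz the squared Riemann error is at most
  \<open>L\<^sup>2 * \<gamma>\<^sup>2 * K\<close> times a sum of \<open>K\<close> squared steps,
  each of mean order \<gamma>, for \<open>K = steps t\<close>. As
  \<open>\<gamma> * K \<le> t + 1\<close>, the total stays of order \<gamma>.\<close>

lemma Mcont_approx:
  assumes t: "t \<ge> 0"
  shows "integrable P (\<lambda>\<omega>. (Mcont c \<kappa> t (path \<omega>) - Mart (steps t) \<omega>)\<^sup>2)"
    and "(\<integral>\<omega>. (Mcont c \<kappa> t (path \<omega>) - Mart (steps t) \<omega>)\<^sup>2 \<partial>P) \<le> Capp t * \<gamma>"
proof -
  let ?K = "steps t"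
  let ?d = "\<lambda>j \<omega>. X (Suc j) \<omega> - X j \<omega>"
  let ?U = "\<lambda>\<omega>. 3 * ((?d (?K - 1) \<omega>)\<^sup>2 + L\<^sup>2 * \<gamma>\<^sup>2 * (real ?K * (\<Sum>j<?K. (?d j \<omega>)\<^sup>2))
     + \<gamma>\<^sup>2 * (L + c)\<^sup>2 * (1 + X (?K - 1) \<omega>)\<^sup>2)"
  have iU: "integrable P ?U"
    by (intro integrable_mult_right Bochner_Integration.integrable_add Bochner_Integration.integrable_sum
        integrable_1X2 step_sq_moment(1)[OF order.refl])
  have le: "AE \<omega> in P. (Mcont c \<kappa> t (path \<omega>) - Mart ?K \<omega>)\<^sup>2 \<le> ?U \<omega>"
    using AE_X_all_nonneg
  proof eventually_elim
    case (elim \<omega>)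
    have "\<bar>Mcont c \<kappa> t (path \<omega>) - Mart ?K \<omega>\<bar> \<le> \<bar>?d (?K - 1) \<omega>\<bar> + L * \<gamma> * (\<Sum>j<?K. \<bar>?d j \<omega>\<bar>)
        + \<gamma> * (L + c) * (1 + X (?K - 1) \<omega>)" (is "_ \<le> ?r")
      using Mcont_path_near[OF t] elim by blast
    then have "(Mcont c \<kappa> t (path \<omega>) - Mart ?K \<omega>)\<^sup>2 \<le> ?r\<^sup>2"
      by (intro power2_le_iff_abs_le[THEN iffD2]) (auto intro: order_trans[OF abs_ge_zero])
    also have "\<dots> \<le> 3 * (\<bar>?d (?K - 1) \<omega>\<bar>\<^sup>2 + (L * \<gamma> * (\<Sum>j<?K. \<bar>?d j \<omega>\<bar>))\<^sup>2
        + (\<gamma> * (L + c) * (1 + X (?K - 1) \<omega>))\<^sup>2)"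
      by (rule add3_sq)
    also have "\<dots> \<le> ?U \<omega>"
    proof -
      have "(\<Sum>j<?K. \<bar>?d j \<omega>\<bar>)\<^sup>2 \<le> real ?K * (\<Sum>j<?K. (?d j \<omega>)\<^sup>2)"
        using sum_squared_le_sum_of_squares[of "\<lambda>j. \<bar>?d j \<omega>\<bar>" "{..<?K}"] by (simp add: mult.commute)
      then have "L\<^sup>2 * \<gamma>\<^sup>2 * (\<Sum>j<?K. \<bar>?d j \<omega>\<bar>)\<^sup>2 \<le> L\<^sup>2 * \<gamma>\<^sup>2 * (real ?K * (\<Sum>j<?K. (?d j \<omega>)\<^sup>2))"
        by (intro mult_left_mono) auto
      then show ?thesis by (simp add: power_mult_distrib)
    qed
    finally show ?case .
  qed
  show i: "integrable P (\<lambda>\<omega>. (Mcont c \<kappa> t (path \<omega>) - Mart ?K \<omega>)\<^sup>2)"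
    using t le by (intro Bochner_Integration.integrable_bound[OF iU]) (auto elim!: eventually_mono)
  have "(\<integral>\<omega>. (Mcont c \<kappa> t (path \<omega>) - Mart ?K \<omega>)\<^sup>2 \<partial>P) \<le> (\<integral>\<omega>. ?U \<omega> \<partial>P)"
    by (rule integral_mono_AE[OF i iU le])
  also have "\<dots> = 3 * ((\<integral>\<omega>. (?d (?K - 1) \<omega>)\<^sup>2 \<partial>P) + L\<^sup>2 * \<gamma>\<^sup>2 * (real ?K * (\<Sum>j<?K. \<integral>\<omega>. (?d j \<omega>)\<^sup>2 \<partial>P))
     + \<gamma>\<^sup>2 * (L + c)\<^sup>2 * (\<integral>\<omega>. (1 + X (?K - 1) \<omega>)\<^sup>2 \<partial>P))"
    using integrable_1X2 step_sq_moment(1)[OF order.refl]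
    by (simp add: Bochner_Integration.integrable_sum Bochner_Integration.integral_sum)
  also have "\<dots> \<le> 3 * (Cdel (t + 1) * \<gamma> + L\<^sup>2 * \<gamma>\<^sup>2 * (real ?K * (\<Sum>j<?K. Cdel (t + 1) * \<gamma>))
     + \<gamma>\<^sup>2 * (L + c)\<^sup>2 * mom (t + 1))"
    using t by (intro mult_left_mono add_mono sum_mono step_sq_moment' X_moment_2 steps_bounds steps_lt) auto
  also have "\<dots> = 3 * (Cdel (t + 1) * \<gamma> + L\<^sup>2 * (\<gamma> * ?K)\<^sup>2 * (Cdel (t + 1) * \<gamma>)
     + \<gamma> * ((L + c)\<^sup>2 * mom (t + 1) * \<gamma>))"
    by (simp add: power2_eq_square algebra_simps)
  also have "\<dots> \<le> 3 * (Cdel (t + 1) * \<gamma> + L\<^sup>2 * (t + 1)\<^sup>2 * (Cdel (t + 1) * \<gamma>)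
     + 1 * ((L + c)\<^sup>2 * mom (t + 1) * \<gamma>))"
    using steps_bounds(3)[OF t] gamma_pos gamma_le_1 Cdel_nonneg[of "t+1"] mom_nonneg[of "t+1"]
    by (intro mult_left_mono add_mono mult_right_mono power_mono) auto
  also have "\<dots> = Capp t * \<gamma>" by (simp add: Capp_def algebra_simps)
  finally show "(\<integral>\<omega>. (Mcont c \<kappa> t (path \<omega>) - Mart ?K \<omega>)\<^sup>2 \<partial>P) \<le> Capp t * \<gamma>" .
qed

lemma L1_of_L2:
  fixes f :: "'a \<Rightarrow> real"
  assumes [measurable]: "f \<in> borel_measurable P" and i: "integrable P (\<lambda>\<omega>. (f \<omega>)\<^sup>2)"
    and C: "(\<integral>\<omega>. (f \<omega>)\<^sup>2 \<partial>P) \<le> C * \<gamma>"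
  shows "integrable P f" "(\<integral>\<omega>. \<bar>f \<omega>\<bar> \<partial>P) \<le> (C + 1) * sqrt \<gamma>"
proof -
  show f: "integrable P f" using integrable_mult_sq[of f "\<lambda>_. 1"] i by simp
  have "(\<integral>\<omega>. \<bar>f \<omega>\<bar> \<partial>P) \<le> (\<integral>\<omega>. (f \<omega>)\<^sup>2 / sqrt \<gamma> + sqrt \<gamma> \<partial>P)"
    using f i gamma_pos by (intro integral_mono) (auto intro!: abs_le_sq_div)
  also have "\<dots> = (\<integral>\<omega>. (f \<omega>)\<^sup>2 \<partial>P) / sqrt \<gamma> + sqrt \<gamma>"
    using i by (simp add: prob_space)
  also have "\<dots> \<le> (C * \<gamma>) / sqrt \<gamma> + sqrt \<gamma>"
    using C gamma_pos by (intro add_mono divide_right_mono) auto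
  also have "\<dots> = (C + 1) * sqrt \<gamma>"
    using gamma_pos by (simp add: field_simps)
  finally show "(\<integral>\<omega>. \<bar>f \<omega>\<bar> \<partial>P) \<le> (C + 1) * sqrt \<gamma>" .
qed

lemma Mcont_sq_integrable:
  assumes t: "t \<ge> 0"
  shows "integrable P (\<lambda>\<omega>. (Mcont c \<kappa> t (path \<omega>))\<^sup>2)" "integrable P (\<lambda>\<omega>. Mcont c \<kappa> t (path \<omega>))"
    and "(\<integral>\<omega>. (Mcont c \<kappa> t (path \<omega>))\<^sup>2 \<partial>P) \<le> 2 * Capp t + 8 * \<sigma>\<^sup>2 * (t + 1)"
proof -
  note [measurable] = Mcont_measurable[OF t]
  let ?R = "\<lambda>\<omega>. Mcont c \<kappa> t (path \<omega>) - Mart (steps t) \<omega>"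
  note R = Mcont_approx[OF t]
  have le: "(Mcont c \<kappa> t (path \<omega>))\<^sup>2 \<le> 2 * (?R \<omega>)\<^sup>2 + 2 * (Mart (steps t) \<omega>)\<^sup>2" for \<omega>
    using zero_le_power2[of "?R \<omega> - Mart (steps t) \<omega>"] by (simp add: power2_eq_square algebra_simps)
  have iU: "integrable P (\<lambda>\<omega>. 2 * (?R \<omega>)\<^sup>2 + 2 * (Mart (steps t) \<omega>)\<^sup>2)"
    using R(1) Mart_sq[of "steps t"] by simp
  show i: "integrable P (\<lambda>\<omega>. (Mcont c \<kappa> t (path \<omega>))\<^sup>2)"
    by (rule Bochner_Integration.integrable_bound[OF iU]) (use le in auto)
  show "integrable P (\<lambda>\<omega>. Mcont c \<kappa> t (path \<omega>))"
    using integrable_mult_sq[of "\<lambda>\<omega>. Mcont c \<kappa> t (path \<omega>)" "\<lambda>_. 1"] i by simp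
  have "(\<integral>\<omega>. (Mcont c \<kappa> t (path \<omega>))\<^sup>2 \<partial>P) \<le> 2 * (\<integral>\<omega>. (?R \<omega>)\<^sup>2 \<partial>P) + 2 * (\<integral>\<omega>. (Mart (steps t) \<omega>)\<^sup>2 \<partial>P)"
    using integral_mono[OF i iU le] R(1) Mart_sq[of "steps t"] by simp
  also have "\<dots> \<le> 2 * (Capp t * \<gamma>) + 2 * (4 * r\<^sup>2 * steps t)"
    using R(2) Mart_sq[of "steps t"] by (intro add_mono mult_left_mono) auto
  also have "\<dots> \<le> 2 * (Capp t * 1) + 8 * (\<sigma>\<^sup>2 * (t + 1))"
  proof (intro add_mono mult_left_mono)
    have "\<sigma>\<^sup>2 * (\<gamma> * steps t) \<le> \<sigma>\<^sup>2 * (t + 1)" using steps_bounds(3)[OF t] by (intro mult_left_mono) auto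
    then show "2 * (4 * r\<^sup>2 * steps t) \<le> 8 * (\<sigma>\<^sup>2 * (t + 1))" by (simp add: r_sq)
  qed (use gamma_le_1 Capp_nonneg in auto)
  finally show "(\<integral>\<omega>. (Mcont c \<kappa> t (path \<omega>))\<^sup>2 \<partial>P) \<le> 2 * Capp t + 8 * \<sigma>\<^sup>2 * (t + 1)" by simp
qed

text \<open>\<open>4096 = 8^4\<close> stems from four uses of \<open>add_power4\<close> on five
  summands; 3 counts the summands with coefficient one, \<open>81 = 3^4\<close>, and
  \<open>t + 2\<close> bounds \<open>\<gamma> * Suc (steps t)\<close>.\<close>

definition C4 :: "real \<Rightarrow> real" where
  "C4 t = 4096 * mom (t + 1) * (3 + (1 + (L + c))^4 + 81 * (L + c)^4 * (t + 2)^4)"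

text \<open>A crude bound by positions at grid times. The weighted sum enters once through the
  compensator in \<open>Mart\<close> and twice through the Riemann error, where a step is bounded by
  \<open>z (Suc j) + z j\<close>.\<close>

lemma Mcont_path_bound:
  assumes t: "t \<ge> 0" and X: "\<And>k. X k \<omega> \<ge> 0"
  defines "K \<equiv> steps t" and "z \<equiv> \<lambda>k. 1 + X k \<omega>"
  shows "\<bar>Mcont c \<kappa> t (path \<omega>)\<bar> \<le>
     z K + (z 0 + (z (Suc (K - 1)) + ((1 + (L + c)) * z (K - 1) + 3 * (L + c) * (\<gamma> * (\<Sum>j\<le>K. z j)))))"
proof -
  have z: "z k \<ge> 0" "X k \<omega> \<le> z k" "X k \<omega> \<ge> 0" for k using X by (auto simp: z_def)
  define S where "S = \<gamma> * (\<Sum>j\<le>K. z j)"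
  define B where "B = L + c"
  have B: "B \<ge> 0" "L \<le> B" using L_nonneg c_nonneg by (auto simp: B_def)
  have S1: "\<gamma> * (\<Sum>j<K. z j) \<le> S" unfolding S_def using gamma_pos z by (intro mult_left_mono sum_mono2) auto
  have S2: "\<gamma> * (\<Sum>j<K. z (Suc j)) \<le> S"
  proof -
    have "(\<Sum>j\<le>K. z j) = z 0 + (\<Sum>j<K. z (Suc j))" by (rule sum.atMost_shift)
    then show ?thesis unfolding S_def using gamma_pos z by (intro mult_left_mono) auto
  qed
  have S0: "S \<ge> 0" unfolding S_def using gamma_pos z by (intro mult_nonneg_nonneg sum_nonneg) auto
  have "\<bar>\<Sum>j<K. \<gamma> * (c + \<kappa> (X j \<omega>))\<bar> \<le> (\<Sum>j<K. \<gamma> * (B * z j))"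
  proof (intro order_trans[OF sum_abs] sum_mono)
    fix j
    have "\<bar>c + \<kappa> (X j \<omega>)\<bar> \<le> c + L * X j \<omega>" using kappa_bound[OF X, of j] c_nonneg by linarith
    also have "\<dots> \<le> B * z j" using c_nonneg L_nonneg X[of j] by (simp add: B_def z_def algebra_simps)
    finally show "\<bar>\<gamma> * (c + \<kappa> (X j \<omega>))\<bar> \<le> \<gamma> * (B * z j)" using gamma_pos by (simp add: abs_mult)
  qed
  also have "\<dots> = B * (\<gamma> * (\<Sum>j<K. z j))" by (simp add: sum_distrib_left algebra_simps)
  also have "\<dots> \<le> B * S" using S1 B by (intro mult_left_mono) auto
  finally have m1: "\<bar>Mart K \<omega>\<bar> \<le> z K + z 0 - 1 + B * S"
    using X[of 0] X[of K] by (simp add: Mart_def z_def)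
  have "L * \<gamma> * (\<Sum>j<K. \<bar>X (Suc j) \<omega> - X j \<omega>\<bar>) \<le> L * \<gamma> * (\<Sum>j<K. z (Suc j) + z j)"
    using gamma_pos L_nonneg X by (intro mult_left_mono sum_mono) (auto simp: z_def abs_le_iff add_increasing add_increasing2)
  also have "\<dots> = L * (\<gamma> * (\<Sum>j<K. z (Suc j)) + \<gamma> * (\<Sum>j<K. z j))" by (simp add: sum.distrib algebra_simps)
  also have "\<dots> \<le> B * (S + S)" using S1 S2 B L_nonneg S0 gamma_pos z
    by (intro mult_mono add_mono) (auto intro!: add_nonneg_nonneg mult_nonneg_nonneg sum_nonneg)
  finally have m2: "L * \<gamma> * (\<Sum>j<K. \<bar>X (Suc j) \<omega> - X j \<omega>\<bar>) \<le> 2 * (B * S)" by simp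
  have "\<gamma> * (B * z (K - 1)) \<le> 1 * (B * z (K - 1))"
    using gamma_le_1 B z by (intro mult_right_mono mult_nonneg_nonneg) auto
  then have m3: "\<gamma> * B * z (K - 1) \<le> B * z (K - 1)" by simp
  have m4: "\<bar>X (Suc (K - 1)) \<omega> - X (K - 1) \<omega>\<bar> \<le> z (Suc (K - 1)) + z (K - 1)"
    using X[of "Suc (K - 1)"] X[of "K - 1"] by (simp add: z_def)
  have "\<bar>Mcont c \<kappa> t (path \<omega>)\<bar> \<le> z K + z 0 + B * S + (z (Suc (K - 1)) + z (K - 1)) + 2 * (B * S) + B * z (K - 1)"
    using Mcont_path_near[OF t X, folded K_def B_def] m1 m2 m3 m4 unfolding z_def by linarith
  also have "\<dots> = z K + (z 0 + (z (Suc (K - 1)) + ((1 + B) * z (K - 1) + 3 * B * S)))"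
    by (simp add: algebra_simps)
  finally show ?thesis by (simp add: B_def S_def)
qed

text \<open>This gives the squared functional a uniform second moment. After
  \<open>sum_power4\<close> the factor \<open>\<gamma>^4 * real (Suc K)^3\<close> and the
  \<open>Suc K\<close> summands, \<open>K = steps t\<close>, combine to
  \<open>(\<gamma> * real (Suc K))^4\<close>, which is bounded uniformly in the step size.\<close>

lemma Mcont_power4:
  assumes t: "t \<ge> 0"
  shows "integrable P (\<lambda>\<omega>. (Mcont c \<kappa> t (path \<omega>))^4)"
    and "(\<integral>\<omega>. (Mcont c \<kappa> t (path \<omega>))^4 \<partial>P) \<le> C4 t"
proof -
  note [measurable] = Mcont_measurable[OF t]
  let ?K = "steps t" and ?z = "\<lambda>k \<omega>. 1 + X k \<omega>" and ?B = "L + c"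
  let ?c = "(3 * ?B)^4 * \<gamma>^4 * real (Suc ?K)^3"
  let ?U = "\<lambda>\<omega>. 4096 * ((?z ?K \<omega>)^4 + ((?z 0 \<omega>)^4 + ((?z (Suc (?K - 1)) \<omega>)^4 + ((1 + ?B)^4 * (?z (?K - 1) \<omega>)^4
    + ?c * (\<Sum>j\<le>?K. (?z j \<omega>)^4)))))"
  have iU: "integrable P ?U"
    by (intro integrable_mult_right Bochner_Integration.integrable_add Bochner_Integration.integrable_sum
        integrable_X4)
  have le: "AE \<omega> in P. (Mcont c \<kappa> t (path \<omega>))^4 \<le> ?U \<omega>"
    using AE_X_all_nonneg
  proof eventually_elim
    case (elim \<omega>)
    let ?S = "\<gamma> * (\<Sum>j\<le>?K. ?z j \<omega>)"
    have "\<bar>Mcont c \<kappa> t (path \<omega>)\<bar>^4 \<le>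
       (?z ?K \<omega> + (?z 0 \<omega> + (?z (Suc (?K - 1)) \<omega> + ((1 + ?B) * ?z (?K - 1) \<omega> + 3 * ?B * ?S))))^4"
      using Mcont_path_bound[OF t] elim by (intro power_mono) auto
    also have "\<dots> \<le> 4096 * ((?z ?K \<omega>)^4 + ((?z 0 \<omega>)^4 + ((?z (Suc (?K - 1)) \<omega>)^4 
       + (((1 + ?B) * ?z (?K - 1) \<omega>)^4 + (3 * ?B * ?S)^4))))"
    proof -
      have "(p + (q + (u + (v + w))))^4 \<le> 4096 * (p^4 + (q^4 + (u^4 + (v^4 + w^4))))" for p q u v w :: real
      proof -
        have "0 \<le> p^4" "0 \<le> q^4" "0 \<le> u^4" "0 \<le> v^4" "0 \<le> w^4" by simp_all
        then show ?thesis
          using add_power4[of p "q + (u + (v + w))"] add_power4[of q "u + (v + w)"]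
            add_power4[of u "v + w"] add_power4[of v w] unfolding distrib_left by linarith
      qed
      then show ?thesis .
    qed
    also have "\<dots> \<le> ?U \<omega>"
    proof -
      have "(3 * ?B * ?S)^4 = (3 * ?B)^4 * \<gamma>^4 * (\<Sum>j\<le>?K. ?z j \<omega>)^4" by (simp only: power_mult_distrib mult.assoc)
      also have "\<dots> \<le> (3 * ?B)^4 * \<gamma>^4 * (real (Suc ?K)^3 * (\<Sum>j\<le>?K. (?z j \<omega>)^4))"
        using sum_power4[of "\<lambda>j. ?z j \<omega>" "{..?K}"] by (intro mult_left_mono) auto
      finally have "(3 * ?B * ?S)^4 \<le> ?c * (\<Sum>j\<le>?K. (?z j \<omega>)^4)" by (simp only: mult.assoc)
      moreover have "((1 + ?B) * ?z (?K - 1) \<omega>)^4 = (1 + ?B)^4 * (?z (?K - 1) \<omega>)^4" by (rule power_mult_distrib)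
      ultimately show ?thesis by (intro mult_left_mono add_mono order.refl) auto
    qed
    finally show ?case by simp
  qed
  show i: "integrable P (\<lambda>\<omega>. (Mcont c \<kappa> t (path \<omega>))^4)"
    using le by (intro Bochner_Integration.integrable_bound[OF iU]) (auto elim!: eventually_mono)
  have "(\<integral>\<omega>. (Mcont c \<kappa> t (path \<omega>))^4 \<partial>P) \<le> (\<integral>\<omega>. ?U \<omega> \<partial>P)"
    by (rule integral_mono_AE[OF i iU le])
  also have "\<dots> = 4096 * ((\<integral>\<omega>. (?z ?K \<omega>)^4 \<partial>P) + ((\<integral>\<omega>. (?z 0 \<omega>)^4 \<partial>P) + ((\<integral>\<omega>. (?z (Suc (?K - 1)) \<omega>)^4 \<partial>P)
    + ((1 + ?B)^4 * (\<integral>\<omega>. (?z (?K - 1) \<omega>)^4 \<partial>P) + ?c * (\<Sum>j\<le>?K. (\<integral>\<omega>. (?z j \<omega>)^4 \<partial>P))))))"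
    using integrable_X4 by (simp add: Bochner_Integration.integral_sum Bochner_Integration.integrable_sum)
  also have "\<dots> \<le> 4096 * (mom (t + 1) + (mom (t + 1) + (mom (t + 1) + ((1 + ?B)^4 * mom (t + 1)
     + ?c * (\<Sum>j\<le>?K. mom (t + 1))))))"
  proof (intro mult_left_mono add_mono sum_mono X_moment steps_bounds t)
    fix j assume "j \<in> {..?K}"
    then have "\<gamma> * j \<le> \<gamma> * ?K" using gamma_pos by (intro mult_left_mono) auto
    then show "\<gamma> * real j \<le> t + 1" using steps_bounds(3)[OF t] by linarith
  qed (use t gamma_pos in auto)
  also have "?c * (\<Sum>j\<le>?K. mom (t + 1)) = (3 * ?B)^4 * (\<gamma> * real (Suc ?K))^4 * mom (t + 1)"
    by (simp add: power_mult_distrib power4_eq_xxxx power3_eq_cube)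
  also have "\<dots> \<le> (3 * ?B)^4 * (t + 2)^4 * mom (t + 1)"
    using steps_bounds(3)[OF t] gamma_le_1 gamma_pos mom_nonneg
    by (intro mult_right_mono mult_left_mono power_mono) (auto simp: algebra_simps)
  finally show "(\<integral>\<omega>. (Mcont c \<kappa> t (path \<omega>))^4 \<partial>P) \<le> C4 t"
    unfolding C4_def power_mult_distrib[of 3 "L + c"] by (simp add: algebra_simps)
qed

end

text \<open>Expansion around \<open>y\<close>, with Young's inequality of weight \<open>q\<close>
  for the mixed term. For \<open>q = sqrt \<gamma>\<close>, a difference of mean square order
  \<gamma> and a bounded second moment of \<open>y\<close>, every term has mean of order at most
  \<open>sqrt \<gamma>\<close>.\<close>

lemma abs_diff_sq_le: "\<bar>x\<^sup>2 - y\<^sup>2\<bar> \<le> (x - y)\<^sup>2 + (x - y)\<^sup>2 / q + q * y\<^sup>2" if "q > 0" for x y q :: real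
proof -
  have "0 \<le> (\<bar>x - y\<bar> - q * \<bar>y\<bar>)\<^sup>2" by simp
  then have "2 * \<bar>x - y\<bar> * \<bar>y\<bar> * q \<le> (x - y)\<^sup>2 + q\<^sup>2 * y\<^sup>2"
    by (simp add: power2_diff power_mult_distrib algebra_simps)
  then have "2 * \<bar>x - y\<bar> * \<bar>y\<bar> \<le> (x - y)\<^sup>2 / q + q * y\<^sup>2"
    using that by (simp add: field_simps power2_eq_square)
  moreover have "\<bar>x\<^sup>2 - y\<^sup>2\<bar> \<le> (x - y)\<^sup>2 + 2 * \<bar>x - y\<bar> * \<bar>y\<bar>"
  proof -
    have "x\<^sup>2 - y\<^sup>2 = (x - y)\<^sup>2 + 2 * ((x - y) * y)" by (simp add: power2_eq_square algebra_simps)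
    then have "\<bar>x\<^sup>2 - y\<^sup>2\<bar> \<le> \<bar>(x - y)\<^sup>2\<bar> + \<bar>2 * ((x - y) * y)\<bar>" by (simp only: abs_triangle_ineq)
    then show ?thesis by (simp add: abs_mult)
  qed
  ultimately show ?thesis by linarith
qed

section \<open>From summed conditional variances to the ramp time of the path\<close>

context sticky_chain
begin

text \<open>Above \<delta> the ramp is 1 and the variance is nearly \<open>4 * r\<^sup>2\<close>;
  below \<open>\<delta> / 2\<close> the ramp vanishes and the error is \<open>V k \<omega>\<close>
  itself; in between each one-sided estimate covers one sign. \<open>384 = 96 * 4\<close> is the
  constant of \<open>step_var_ge\<close> at distance \<open>\<delta> / 2\<close>.\<close>

lemma ramp_V:
  assumes \<delta>: "\<delta> > 0" and X: "X k \<omega> \<ge> 0"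
  shows "\<bar>V k \<omega> - 4 * r\<^sup>2 * ramp \<delta> (drift k \<omega>)\<bar> \<le> indicator {..\<delta>} (drift k \<omega>) * V k \<omega> + 384 * r^4 / \<delta>\<^sup>2"
proof -
  let ?a = "drift k \<omega>"
  have low: "4 * r\<^sup>2 - 384 * r^4 / \<delta>\<^sup>2 \<le> V k \<omega>" if "\<delta> / 2 \<le> ?a"
  proof -
    have a: "?a > 0" using that \<delta> by linarith
    have "(\<delta> / 2)\<^sup>2 \<le> ?a\<^sup>2" using that \<delta> by (intro power_mono) auto
    then have "96 * r^4 / ?a\<^sup>2 \<le> 96 * r^4 / (\<delta> / 2)\<^sup>2"
      using \<delta> a by (intro divide_left_mono) auto
    also have "\<dots> = 384 * r^4 / \<delta>\<^sup>2" using \<delta> by (simp add: power_divide)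
    finally have 1: "96 * r^4 / ?a\<^sup>2 \<le> 384 * r^4 / \<delta>\<^sup>2" .
    have "r\<^sup>2 * (4 - 96 / (?a / r)\<^sup>2) \<le> V k \<omega>"
      unfolding V_def using step_var_ge[of "?a / r"] a r_pos by (intro mult_left_mono) auto
    moreover have "r\<^sup>2 * (4 - 96 / (?a / r)\<^sup>2) = 4 * r\<^sup>2 - 96 * r^4 / ?a\<^sup>2"
      using r_pos a by (simp add: power_divide right_diff_distrib power2_eq_square power4_eq_xxxx)
    ultimately show ?thesis using 1 by linarith
  qed
  have pos: "0 \<le> 384 * r^4 / \<delta>\<^sup>2" by simp
  have V: "0 \<le> V k \<omega>" "V k \<omega> \<le> 4 * r\<^sup>2" using V_bounds X by auto
  have rp: "0 \<le> 4 * r\<^sup>2 * ramp \<delta> ?a" "4 * r\<^sup>2 * ramp \<delta> ?a \<le> 4 * r\<^sup>2"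
    using ramp_bounds[of \<delta> ?a] by (auto intro!: mult_left_le)
  consider "?a > \<delta>" | "\<delta> / 2 \<le> ?a" "?a \<le> \<delta>" | "?a < \<delta> / 2" by linarith
  then show ?thesis
  proof cases
    case 1
    then have "ramp \<delta> ?a = 1" using \<delta> by (simp add: ramp_def field_simps)
    then show ?thesis using low V 1 \<delta> by simp
  next
    case 2
    then show ?thesis using low V rp pos by simp
  next
    case 3
    then have "ramp \<delta> ?a = 0" using \<delta> by (simp add: ramp_def field_simps)
    then show ?thesis using V 3 \<delta> pos by simp
  qed
qed

lemma ramp_drift:
  assumes \<delta>: "\<delta> > 0" and X: "X k \<omega> \<ge> 0"
  shows "\<bar>ramp \<delta> (drift k \<omega>) - ramp \<delta> (X k \<omega>)\<bar> \<le> 2 / \<delta> * (\<gamma> * (L + c) * (1 + X k \<omega>))"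
proof -
  have "\<bar>ramp \<delta> (drift k \<omega>) - ramp \<delta> (X k \<omega>)\<bar> \<le> 2 / \<delta> * \<bar>drift k \<omega> - X k \<omega>\<bar>"
    using lipschitz_onD[OF ramp_lipschitz[OF \<delta>], of "drift k \<omega>" "X k \<omega>"] by (simp add: dist_real_def)
  also have "\<dots> \<le> 2 / \<delta> * (\<gamma> * (L + c) * (1 + X k \<omega>))"
    using drift_diff[OF X] \<delta> by (intro mult_left_mono) auto
  finally show ?thesis .
qed

lemma gamma_le_sqrt: "\<gamma> \<le> sqrt \<gamma>"
proof -
  have "sqrt \<gamma> * sqrt \<gamma> \<le> sqrt \<gamma> * 1" using gamma_le_1 gamma_pos by (intro mult_left_mono) auto
  then show ?thesis using gamma_pos by simp
qed

definition occ :: "real \<Rightarrow> real \<Rightarrow> 'a \<Rightarrow> real" where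
  "occ \<delta> t \<omega> = (LINT u:{0..t}|lborel. ramp \<delta> (path \<omega> u))"

lemma occ_measurable[measurable]: "\<delta> > 0 \<Longrightarrow> t \<ge> 0 \<Longrightarrow> occ \<delta> t \<in> borel_measurable P"
  unfolding occ_def[abs_def]
  by (rule path_functional_measurable[OF continuous_map_path_integral[OF ramp_lipschitz]])

text \<open>\<open>2 / \<delta>\<close> is the Lipschitz constant of the ramp,
  \<open>Cdel (t + 1) + 1\<close> bounds the mean absolute step relative to
  \<open>sqrt \<gamma>\<close>, and the last 1 pays for the segment in progress.\<close>

definition Cocc :: "real \<Rightarrow> real \<Rightarrow> real" where
  "Cocc \<delta> t = 2 / \<delta> * (t + 1) * (Cdel (t + 1) + 1) + 1"

lemma occ_approx:
  assumes \<delta>: "\<delta> > 0" and t: "t \<ge> 0"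
  shows "integrable P (\<lambda>\<omega>. occ \<delta> t \<omega> - \<gamma> * (\<Sum>j<steps t. ramp \<delta> (X j \<omega>)))"
    and "(\<integral>\<omega>. \<bar>occ \<delta> t \<omega> - \<gamma> * (\<Sum>j<steps t. ramp \<delta> (X j \<omega>))\<bar> \<partial>P) \<le> Cocc \<delta> t * sqrt \<gamma>"
proof -
  let ?K = "steps t"
  let ?U = "\<lambda>\<omega>. \<gamma> * (2 / \<delta>) * (\<Sum>j<?K. \<bar>X (Suc j) \<omega> - X j \<omega>\<bar>) + \<gamma> * 1"
  note [measurable] = occ_measurable[OF \<delta> t]
  have d: "integrable P (\<lambda>\<omega>. X (Suc j) \<omega> - X j \<omega>)" for j using integrable_X by simp
  have iU: "integrable P ?U"
    using d by (intro Bochner_Integration.integrable_add integrable_mult_right Bochner_Integration.integrable_sum integrable_abs) auto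
  have le: "\<bar>occ \<delta> t \<omega> - \<gamma> * (\<Sum>j<?K. ramp \<delta> (X j \<omega>))\<bar> \<le> ?U \<omega>" for \<omega>
  proof -
    have "\<gamma> * \<bar>ramp \<delta> (X (?K - 1) \<omega>)\<bar> \<le> \<gamma> * 1"
      using ramp_bounds[of \<delta> "X (?K - 1) \<omega>"] gamma_pos by (intro mult_left_mono) auto
    then show ?thesis
      using riemann_sum(1)[OF ramp_lipschitz[OF \<delta>] gamma_pos t, of "\<lambda>k. X k \<omega>", folded path_def steps_def]
      unfolding occ_def by linarith
  qed
  show i: "integrable P (\<lambda>\<omega>. occ \<delta> t \<omega> - \<gamma> * (\<Sum>j<steps t. ramp \<delta> (X j \<omega>)))"
  proof (rule Bochner_Integration.integrable_bound[OF iU])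
    show "AE \<omega> in P. norm (occ \<delta> t \<omega> - \<gamma> * (\<Sum>j<steps t. ramp \<delta> (X j \<omega>))) \<le> norm (?U \<omega>)"
      using order_trans[OF le abs_ge_self] by (intro AE_I2) (simp only: real_norm_def)
  qed measurable
  have "(\<integral>\<omega>. \<bar>occ \<delta> t \<omega> - \<gamma> * (\<Sum>j<?K. ramp \<delta> (X j \<omega>))\<bar> \<partial>P) \<le> (\<integral>\<omega>. ?U \<omega> \<partial>P)"
    by (intro integral_mono integrable_abs i iU le)
  also have "\<dots> = \<gamma> * (2 / \<delta>) * (\<Sum>j<?K. \<integral>\<omega>. \<bar>X (Suc j) \<omega> - X j \<omega>\<bar> \<partial>P) + \<gamma>"
    using d by (simp add: Bochner_Integration.integral_sum Bochner_Integration.integrable_sum prob_space)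
  also have "\<dots> \<le> \<gamma> * (2 / \<delta>) * (\<Sum>j<?K. (Cdel (t + 1) + 1) * sqrt \<gamma>) + sqrt \<gamma>"
  proof (intro add_mono mult_left_mono sum_mono gamma_le_sqrt)
    fix j assume "j \<in> {..<?K}"
    then have j: "\<gamma> * real j \<le> t + 1" using steps_lt[OF t] by simp
    show "(\<integral>\<omega>. \<bar>X (Suc j) \<omega> - X j \<omega>\<bar> \<partial>P) \<le> (Cdel (t + 1) + 1) * sqrt \<gamma>"
      by (rule L1_of_L2(2)[OF _ step_sq_moment(1)[OF order.refl] step_sq_moment'[OF j]]) measurable
  qed (use gamma_pos \<delta> in auto)
  also have "\<dots> = 2 / \<delta> * (\<gamma> * ?K) * (Cdel (t + 1) + 1) * sqrt \<gamma> + sqrt \<gamma>"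
    by (simp add: algebra_simps add_divide_distrib)
  also have "\<dots> \<le> 2 / \<delta> * (t + 1) * (Cdel (t + 1) + 1) * sqrt \<gamma> + sqrt \<gamma>"
    using steps_bounds(3)[OF t] Cdel_nonneg[of "t + 1"] \<delta> gamma_pos
    by (intro add_mono mult_right_mono mult_left_mono) auto
  finally show "(\<integral>\<omega>. \<bar>occ \<delta> t \<omega> - \<gamma> * (\<Sum>j<steps t. ramp \<delta> (X j \<omega>))\<bar> \<partial>P) \<le> Cocc \<delta> t * sqrt \<gamma>"
    by (simp add: Cocc_def algebra_simps)
qed

definition Csq :: "real \<Rightarrow> real" where
  "Csq t = 2 * Capp t + 4 * \<sigma>\<^sup>2 * (t + 1)"

lemma Mcont_sq_approx:
  assumes t: "t \<ge> 0"
  shows "(\<integral>\<omega>. \<bar>(Mcont c \<kappa> t (path \<omega>))\<^sup>2 - (Mart (steps t) \<omega>)\<^sup>2\<bar> \<partial>P) \<le> Csq t * sqrt \<gamma>"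
proof -
  let ?R = "\<lambda>\<omega>. Mcont c \<kappa> t (path \<omega>) - Mart (steps t) \<omega>"
  note R = Mcont_approx[OF t] and M = Mart_sq[of "steps t"]
  have q: "sqrt \<gamma> > 0" using gamma_pos by simp
  have "(\<integral>\<omega>. \<bar>(Mcont c \<kappa> t (path \<omega>))\<^sup>2 - (Mart (steps t) \<omega>)\<^sup>2\<bar> \<partial>P)
     \<le> (\<integral>\<omega>. (?R \<omega>)\<^sup>2 + (?R \<omega>)\<^sup>2 / sqrt \<gamma> + sqrt \<gamma> * (Mart (steps t) \<omega>)\<^sup>2 \<partial>P)"
    using R(1) M Mcont_sq_integrable(1)[OF t] abs_diff_sq_le[OF q] by (intro integral_mono) auto
  also have "\<dots> = (\<integral>\<omega>. (?R \<omega>)\<^sup>2 \<partial>P) + (\<integral>\<omega>. (?R \<omega>)\<^sup>2 \<partial>P) / sqrt \<gamma> + sqrt \<gamma> * (\<integral>\<omega>. (Mart (steps t) \<omega>)\<^sup>2 \<partial>P)"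
    using R(1) M by simp
  also have "\<dots> \<le> Capp t * \<gamma> + Capp t * \<gamma> / sqrt \<gamma> + sqrt \<gamma> * (4 * (\<sigma>\<^sup>2 * (t + 1)))"
  proof (intro add_mono divide_right_mono mult_left_mono R(2))
    have "\<sigma>\<^sup>2 * (\<gamma> * steps t) \<le> \<sigma>\<^sup>2 * (t + 1)" using steps_bounds(3)[OF t] by (intro mult_left_mono) auto
    then show "(\<integral>\<omega>. (Mart (steps t) \<omega>)\<^sup>2 \<partial>P) \<le> 4 * (\<sigma>\<^sup>2 * (t + 1))" using M by (simp add: r_sq)
  qed (use q in auto)
  also have "\<dots> = Capp t * \<gamma> + Capp t * sqrt \<gamma> + sqrt \<gamma> * (4 * (\<sigma>\<^sup>2 * (t + 1)))"
    using gamma_pos by (simp add: real_div_sqrt flip: times_divide_eq_right)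
  also have "\<dots> \<le> Capp t * sqrt \<gamma> + Capp t * sqrt \<gamma> + sqrt \<gamma> * (4 * (\<sigma>\<^sup>2 * (t + 1)))"
    using gamma_le_sqrt Capp_nonneg gamma_pos by (intro add_mono mult_left_mono) auto
  finally show ?thesis by (simp add: Csq_def algebra_simps)
qed

definition Cvar1 :: "real \<Rightarrow> real" where
  "Cvar1 t = 4 * (1 + (t + 1) * (L + c)) * mom (t + 1)"

text \<open>It collects the errors that vanish with the step size at fixed \<delta>, whereas
  \<open>Cvar1\<close> belongs to the one that only a small \<delta> removes.
  \<open>528 = 144 + 384\<close> adds the fourth-moment term of \<open>occupation\<close> to the one
  of \<open>ramp_V\<close>.\<close>

definition Cvar2 :: "real \<Rightarrow> real \<Rightarrow> real \<Rightarrow> real" where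
  "Cvar2 s t \<delta> = Csq t + Csq s + 528 * (t + 1) * \<sigma>^4 / \<delta>\<^sup>2
     + 4 * \<sigma>\<^sup>2 * (2 / \<delta> * (t + 1) * (L + c) * mom (t + 1)) + 4 * \<sigma>\<^sup>2 * (Cocc \<delta> t + Cocc \<delta> s)"

context
  fixes G :: "'a \<Rightarrow> real" and s t :: real
  assumes G: "G \<in> borel_measurable (Fil (steps s))" and G_bounds: "\<And>\<omega>. 0 \<le> G \<omega>" "\<And>\<omega>. G \<omega> \<le> 1"
    and st: "0 \<le> s" "s \<le> t"
begin

lemma t_nonneg: "0 \<le> t" using st by simp

lemma G_P_measurable[measurable]: "G \<in> borel_measurable P" using G by (rule Fil_measurable)

lemma G_integrable: "integrable P f \<Longrightarrow> integrable P (\<lambda>\<omega>. G \<omega> * f \<omega>)" for f :: "'a \<Rightarrow> real"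
  by (rule integrable_bounded_mult) (use G_bounds in auto)

lemma G_abs: "integrable P f \<Longrightarrow> \<bar>\<integral>\<omega>. G \<omega> * f \<omega> \<partial>P\<bar> \<le> (\<integral>\<omega>. \<bar>f \<omega>\<bar> \<partial>P)" for f :: "'a \<Rightarrow> real"
proof -
  assume f: "integrable P f"
  have "\<bar>\<integral>\<omega>. G \<omega> * f \<omega> \<partial>P\<bar> \<le> (\<integral>\<omega>. \<bar>G \<omega> * f \<omega>\<bar> \<partial>P)" by (rule integral_abs_bound)
  also have "\<dots> \<le> (\<integral>\<omega>. \<bar>f \<omega>\<bar> \<partial>P)"
    using G_bounds
    by (intro integral_mono integrable_abs f G_integrable[OF f]) (simp add: abs_mult mult_left_le_one_le)
  finally show ?thesis .
qed

text \<open>\<open>G\<close> belongs to the past at index \<open>steps s\<close>, so the weighted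
  increment of \<open>Mart\<close> is exactly zero and only the two replacement errors
  remain.\<close>

lemma Mcont_increment:
  "\<bar>\<integral>\<omega>. G \<omega> * (Mcont c \<kappa> t (path \<omega>) - Mcont c \<kappa> s (path \<omega>)) \<partial>P\<bar> \<le> (Capp t + Capp s + 2) * sqrt \<gamma>"
proof -
  let ?R = "\<lambda>t \<omega>. Mcont c \<kappa> t (path \<omega>) - Mart (steps t) \<omega>"
  have R: "integrable P (?R u)" "(\<integral>\<omega>. \<bar>?R u \<omega>\<bar> \<partial>P) \<le> (Capp u + 1) * sqrt \<gamma>" if "u \<ge> 0" for u
    using L1_of_L2[OF _ Mcont_approx[OF that]] that by auto
  note Rt = R[OF t_nonneg] and Rs = R[OF st(1)]
  have i: "integrable P (\<lambda>\<omega>. Mart (steps t) \<omega> - Mart (steps s) \<omega>)" using integrable_Mart by simp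
  have "(\<integral>\<omega>. G \<omega> * (Mcont c \<kappa> t (path \<omega>) - Mcont c \<kappa> s (path \<omega>)) \<partial>P) =
     (\<integral>\<omega>. G \<omega> * (Mart (steps t) \<omega> - Mart (steps s) \<omega>) + (G \<omega> * ?R t \<omega> - G \<omega> * ?R s \<omega>) \<partial>P)"
    by (intro Bochner_Integration.integral_cong) (auto simp: algebra_simps)
  also have "\<dots> = 0 + ((\<integral>\<omega>. G \<omega> * ?R t \<omega> \<partial>P) - (\<integral>\<omega>. G \<omega> * ?R s \<omega> \<partial>P))"
    using G_integrable[OF i] G_integrable[OF Rt(1)] G_integrable[OF Rs(1)]
      Mart_increment[OF G G_bounds steps_mono[OF st(2)]]
    by (subst Bochner_Integration.integral_add Bochner_Integration.integral_diff; simp)+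
  also have "\<bar>\<dots>\<bar> \<le> (Capp t + 1) * sqrt \<gamma> + (Capp s + 1) * sqrt \<gamma>"
    using G_abs[OF Rt(1)] G_abs[OF Rs(1)] Rt(2) Rs(2) by linarith
  finally show ?thesis by (simp add: algebra_simps)
qed

lemma Mcont_sq_increment:
  "\<bar>(\<integral>\<omega>. G \<omega> * ((Mcont c \<kappa> t (path \<omega>))\<^sup>2 - (Mcont c \<kappa> s (path \<omega>))\<^sup>2) \<partial>P)
     - (\<Sum>j\<in>{steps s..<steps t}. \<integral>\<omega>. G \<omega> * V j \<omega> \<partial>P)\<bar> \<le> (Csq t + Csq s) * sqrt \<gamma>"
proof -
  let ?R = "\<lambda>t \<omega>. (Mcont c \<kappa> t (path \<omega>))\<^sup>2 - (Mart (steps t) \<omega>)\<^sup>2"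
  have R: "integrable P (?R u)" if "u \<ge> 0" for u
    using Mcont_sq_integrable(1)[OF that] Mart_sq by auto
  note Rt = R[OF t_nonneg] and Rs = R[OF st(1)]
  have i: "integrable P (\<lambda>\<omega>. (Mart (steps t) \<omega>)\<^sup>2 - (Mart (steps s) \<omega>)\<^sup>2)" using Mart_sq by auto
  have "(\<integral>\<omega>. G \<omega> * ((Mcont c \<kappa> t (path \<omega>))\<^sup>2 - (Mcont c \<kappa> s (path \<omega>))\<^sup>2) \<partial>P) =
     (\<integral>\<omega>. G \<omega> * ((Mart (steps t) \<omega>)\<^sup>2 - (Mart (steps s) \<omega>)\<^sup>2) + (G \<omega> * ?R t \<omega> - G \<omega> * ?R s \<omega>) \<partial>P)"
    by (intro Bochner_Integration.integral_cong) (auto simp: algebra_simps)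
  also have "\<dots> = (\<Sum>j\<in>{steps s..<steps t}. \<integral>\<omega>. G \<omega> * V j \<omega> \<partial>P)
      + ((\<integral>\<omega>. G \<omega> * ?R t \<omega> \<partial>P) - (\<integral>\<omega>. G \<omega> * ?R s \<omega> \<partial>P))"
    using G_integrable[OF i] G_integrable[OF Rt(1)] G_integrable[OF Rs(1)]
    unfolding Mart_sq_increment[OF G G_bounds steps_mono[OF st(2)], symmetric]
    by (subst Bochner_Integration.integral_add Bochner_Integration.integral_diff; simp)+
  finally show ?thesis
    using G_abs[OF Rt(1)] G_abs[OF Rs(1)] Mcont_sq_approx[OF t_nonneg] Mcont_sq_approx[OF st(1)]
    unfolding distrib_right by linarith
qed

text \<open>\<open>ramp_V\<close> is summed. Its first error has nonnegative mean, so the sum may be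
  extended to all steps before \<open>steps t\<close>, where \<open>occupation\<close> applies; the
  horizon is \<open>t + 1\<close> because \<open>steps t\<close> rounds up.\<close>

lemma V_sum_ramp:
  assumes \<delta>: "\<delta> > 0"
  shows "\<bar>(\<Sum>j\<in>{steps s..<steps t}. \<integral>\<omega>. G \<omega> * V j \<omega> \<partial>P)
     - 4 * r\<^sup>2 * (\<Sum>j\<in>{steps s..<steps t}. \<integral>\<omega>. G \<omega> * ramp \<delta> (drift j \<omega>) \<partial>P)\<bar>
   \<le> Cvar1 t * \<delta> + 528 * (t + 1) * \<sigma>^4 / \<delta>\<^sup>2 * sqrt \<gamma>"
proof -
  let ?K = "steps t" and ?S = "{steps s..<steps t}"
  let ?H = "\<lambda>j \<omega>. indicator {..\<delta>} (drift j \<omega>) :: real"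
  have iV: "integrable P (V j)" for j using D2(2)[of "\<lambda>_. 1" j] by simp
  have ir: "integrable P (\<lambda>\<omega>. ramp \<delta> (drift j \<omega>))" for j
    using ramp_bounds by (intro integrable_const_bound[of _ 1]) auto
  have iH: "integrable P (\<lambda>\<omega>. ?H j \<omega> * V j \<omega>)" for j
    using iV by (rule integrable_bounded_mult) auto
  have step: "\<bar>(\<integral>\<omega>. G \<omega> * V j \<omega> \<partial>P) - 4 * r\<^sup>2 * (\<integral>\<omega>. G \<omega> * ramp \<delta> (drift j \<omega>) \<partial>P)\<bar>
     \<le> (\<integral>\<omega>. ?H j \<omega> * V j \<omega> \<partial>P) + 384 * r^4 / \<delta>\<^sup>2" for j
  proof -
    have i: "integrable P (\<lambda>\<omega>. V j \<omega> - 4 * r\<^sup>2 * ramp \<delta> (drift j \<omega>))" using iV ir by simp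
    have "(\<integral>\<omega>. G \<omega> * V j \<omega> \<partial>P) - 4 * r\<^sup>2 * (\<integral>\<omega>. G \<omega> * ramp \<delta> (drift j \<omega>) \<partial>P) =
      (\<integral>\<omega>. G \<omega> * V j \<omega> - 4 * r\<^sup>2 * (G \<omega> * ramp \<delta> (drift j \<omega>)) \<partial>P)"
      using G_integrable[OF iV] G_integrable[OF ir] by simp
    also have "\<dots> = (\<integral>\<omega>. G \<omega> * (V j \<omega> - 4 * r\<^sup>2 * ramp \<delta> (drift j \<omega>)) \<partial>P)"
      by (intro Bochner_Integration.integral_cong refl) (simp only: right_diff_distrib mult_ac)
    finally have eq: "(\<integral>\<omega>. G \<omega> * V j \<omega> \<partial>P) - 4 * r\<^sup>2 * (\<integral>\<omega>. G \<omega> * ramp \<delta> (drift j \<omega>) \<partial>P) =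
       (\<integral>\<omega>. G \<omega> * (V j \<omega> - 4 * r\<^sup>2 * ramp \<delta> (drift j \<omega>)) \<partial>P)" .
    have "\<bar>(\<integral>\<omega>. G \<omega> * V j \<omega> \<partial>P) - 4 * r\<^sup>2 * (\<integral>\<omega>. G \<omega> * ramp \<delta> (drift j \<omega>) \<partial>P)\<bar>
      \<le> (\<integral>\<omega>. \<bar>V j \<omega> - 4 * r\<^sup>2 * ramp \<delta> (drift j \<omega>)\<bar> \<partial>P)" unfolding eq by (rule G_abs[OF i])
    also have "\<dots> \<le> (\<integral>\<omega>. ?H j \<omega> * V j \<omega> + 384 * r^4 / \<delta>\<^sup>2 \<partial>P)"
    proof (rule integral_mono_AE)
      show "integrable P (\<lambda>\<omega>. \<bar>V j \<omega> - 4 * r\<^sup>2 * ramp \<delta> (drift j \<omega>)\<bar>)" using i by (rule integrable_abs)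
      show "integrable P (\<lambda>\<omega>. ?H j \<omega> * V j \<omega> + 384 * r^4 / \<delta>\<^sup>2)"
        by (intro Bochner_Integration.integrable_add iH) simp
      show "AE \<omega> in P. \<bar>V j \<omega> - 4 * r\<^sup>2 * ramp \<delta> (drift j \<omega>)\<bar> \<le> ?H j \<omega> * V j \<omega> + 384 * r^4 / \<delta>\<^sup>2"
        using AE_X_nonneg[of j] by eventually_elim (rule ramp_V[OF \<delta>])
    qed
    also have "\<dots> = (\<integral>\<omega>. ?H j \<omega> * V j \<omega> \<partial>P) + 384 * r^4 / \<delta>\<^sup>2" using iH by (simp add: prob_space)
    finally show ?thesis .
  qed
  have Hpos: "0 \<le> (\<integral>\<omega>. ?H j \<omega> * V j \<omega> \<partial>P)" for j
    using AE_X_nonneg[of j] by (intro integral_nonneg_AE) (auto elim!: eventually_mono simp: V_bounds)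
  have "\<bar>(\<Sum>j\<in>?S. \<integral>\<omega>. G \<omega> * V j \<omega> \<partial>P) - 4 * r\<^sup>2 * (\<Sum>j\<in>?S. \<integral>\<omega>. G \<omega> * ramp \<delta> (drift j \<omega>) \<partial>P)\<bar> =
    \<bar>\<Sum>j\<in>?S. (\<integral>\<omega>. G \<omega> * V j \<omega> \<partial>P) - 4 * r\<^sup>2 * (\<integral>\<omega>. G \<omega> * ramp \<delta> (drift j \<omega>) \<partial>P)\<bar>"
    by (simp add: sum_subtractf sum_distrib_left)
  also have "\<dots> \<le> (\<Sum>j\<in>?S. (\<integral>\<omega>. ?H j \<omega> * V j \<omega> \<partial>P) + 384 * r^4 / \<delta>\<^sup>2)"
    by (intro order_trans[OF sum_abs] sum_mono step)
  also have "\<dots> \<le> (\<Sum>j<?K. (\<integral>\<omega>. ?H j \<omega> * V j \<omega> \<partial>P) + 384 * r^4 / \<delta>\<^sup>2)"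
    using Hpos by (intro sum_mono2) auto
  also have "\<dots> = (\<Sum>j<?K. \<integral>\<omega>. ?H j \<omega> * V j \<omega> \<partial>P) + (\<gamma> * ?K) * (384 * \<sigma>^4 / \<delta>\<^sup>2 * \<gamma>)"
    by (simp add: sum.distrib r_4 power2_eq_square)
  also have "\<dots> \<le> (4 * (1 + (t + 1) * (L + c)) * mom (t + 1) * \<delta> + 144 * (t + 1) * \<sigma>^4 / \<delta>\<^sup>2 * \<gamma>)
     + (t + 1) * (384 * \<sigma>^4 / \<delta>\<^sup>2 * \<gamma>)"
    using occupation[OF \<delta> steps_bounds(3)[OF t_nonneg]] steps_bounds(3)[OF t_nonneg] gamma_pos
    by (intro add_mono mult_right_mono) auto
  also have "\<dots> = Cvar1 t * \<delta> + 528 * (t + 1) * \<sigma>^4 / \<delta>\<^sup>2 * \<gamma>"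
    by (simp add: Cvar1_def algebra_simps add_divide_distrib)
  also have "\<dots> \<le> Cvar1 t * \<delta> + 528 * (t + 1) * \<sigma>^4 / \<delta>\<^sup>2 * sqrt \<gamma>"
    using gamma_le_sqrt t_nonneg by (intro add_left_mono mult_left_mono) auto
  finally show ?thesis .
qed

lemma ramp_sum_drift:
  assumes \<delta>: "\<delta> > 0"
  shows "\<bar>\<gamma> * (\<Sum>j\<in>{steps s..<steps t}. \<integral>\<omega>. G \<omega> * ramp \<delta> (drift j \<omega>) \<partial>P)
     - \<gamma> * (\<Sum>j\<in>{steps s..<steps t}. \<integral>\<omega>. G \<omega> * ramp \<delta> (X j \<omega>) \<partial>P)\<bar>
   \<le> 2 / \<delta> * (t + 1) * (L + c) * mom (t + 1) * sqrt \<gamma>"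
proof -
  let ?S = "{steps s..<steps t}"
  let ?q = "2 / \<delta> * (\<gamma> * (L + c))"
  have q: "?q \<ge> 0" using \<delta> gamma_pos L_nonneg c_nonneg by simp
  have ir: "integrable P (\<lambda>\<omega>. ramp \<delta> (drift j \<omega>))" "integrable P (\<lambda>\<omega>. ramp \<delta> (X j \<omega>))" for j
    using ramp_bounds by (auto intro!: integrable_const_bound[of _ 1])
  have step: "\<bar>(\<integral>\<omega>. G \<omega> * ramp \<delta> (drift j \<omega>) \<partial>P) - (\<integral>\<omega>. G \<omega> * ramp \<delta> (X j \<omega>) \<partial>P)\<bar> \<le> ?q * mom (t + 1)"
    if j: "j \<in> ?S" for j
  proof -
    have i: "integrable P (\<lambda>\<omega>. ramp \<delta> (drift j \<omega>) - ramp \<delta> (X j \<omega>))" using ir by simp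
    have "\<bar>(\<integral>\<omega>. G \<omega> * ramp \<delta> (drift j \<omega>) \<partial>P) - (\<integral>\<omega>. G \<omega> * ramp \<delta> (X j \<omega>) \<partial>P)\<bar> =
      \<bar>\<integral>\<omega>. G \<omega> * (ramp \<delta> (drift j \<omega>) - ramp \<delta> (X j \<omega>)) \<partial>P\<bar>"
      using G_integrable[OF ir(1)] G_integrable[OF ir(2)] by (simp add: right_diff_distrib)
    also have "\<dots> \<le> (\<integral>\<omega>. \<bar>ramp \<delta> (drift j \<omega>) - ramp \<delta> (X j \<omega>)\<bar> \<partial>P)" by (rule G_abs[OF i])
    also have "\<dots> \<le> (\<integral>\<omega>. ?q * (1 + X j \<omega>) \<partial>P)"
      using AE_X_nonneg[of j] i integrable_X ramp_drift[OF \<delta>, of j]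
      by (intro integral_mono_AE) (auto elim!: eventually_mono simp: mult.assoc)
    also have "\<dots> = ?q * (\<integral>\<omega>. (1 + X j \<omega>) \<partial>P)" by (rule integral_mult_right_zero)
    also have "\<dots> \<le> ?q * mom (t + 1)"
      using j by (intro mult_left_mono X_moment_1 steps_lt t_nonneg q) auto
    finally show ?thesis .
  qed
  have "\<bar>\<gamma> * (\<Sum>j\<in>?S. \<integral>\<omega>. G \<omega> * ramp \<delta> (drift j \<omega>) \<partial>P) - \<gamma> * (\<Sum>j\<in>?S. \<integral>\<omega>. G \<omega> * ramp \<delta> (X j \<omega>) \<partial>P)\<bar>
    = \<bar>\<gamma> * (\<Sum>j\<in>?S. (\<integral>\<omega>. G \<omega> * ramp \<delta> (drift j \<omega>) \<partial>P) - (\<integral>\<omega>. G \<omega> * ramp \<delta> (X j \<omega>) \<partial>P))\<bar>"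
    by (simp add: sum_subtractf right_diff_distrib)
  also have "\<dots> \<le> \<gamma> * (\<Sum>j\<in>?S. ?q * mom (t + 1))"
    unfolding abs_mult using gamma_pos
    by (intro mult_mono order_trans[OF sum_abs] sum_mono step) auto
  also have "\<dots> \<le> \<gamma> * (\<Sum>j<steps t. ?q * mom (t + 1))"
    using gamma_pos by (intro mult_left_mono sum_mono2 mult_nonneg_nonneg[OF q mom_nonneg]) auto
  also have "\<dots> = (\<gamma> * steps t) * (2 / \<delta> * (L + c) * mom (t + 1)) * \<gamma>" by simp
  also have "\<dots> \<le> (t + 1) * (2 / \<delta> * (L + c) * mom (t + 1)) * sqrt \<gamma>"
    using steps_bounds(3)[OF t_nonneg] gamma_le_sqrt t_nonneg \<delta> L_nonneg c_nonneg mom_nonneg[of "t + 1"] gamma_pos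
    by (intro mult_mono) auto
  finally show ?thesis by (simp add: algebra_simps)
qed

text \<open>The sum over the steps between the two times is a difference of two Riemann sums started
  at 0, and \<open>occ_approx\<close> handles each of them.\<close>

lemma ramp_sum_occ:
  assumes \<delta>: "\<delta> > 0"
  shows "\<bar>\<gamma> * (\<Sum>j\<in>{steps s..<steps t}. \<integral>\<omega>. G \<omega> * ramp \<delta> (X j \<omega>) \<partial>P)
     - (\<integral>\<omega>. G \<omega> * (occ \<delta> t \<omega> - occ \<delta> s \<omega>) \<partial>P)\<bar> \<le> (Cocc \<delta> t + Cocc \<delta> s) * sqrt \<gamma>"
proof -
  let ?s = "\<lambda>t \<omega>. \<gamma> * (\<Sum>j<steps t. ramp \<delta> (X j \<omega>))"
  let ?R = "\<lambda>t \<omega>. occ \<delta> t \<omega> - ?s t \<omega>"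
  note Rt = occ_approx[OF \<delta> t_nonneg] and Rs = occ_approx[OF \<delta> st(1)]
  have ir: "integrable P (\<lambda>\<omega>. ramp \<delta> (X j \<omega>))" for j
    using ramp_bounds by (auto intro!: integrable_const_bound[of _ 1])
  have ist: "integrable P (?s u)" for u
    using ir by (intro integrable_mult_right Bochner_Integration.integrable_sum) auto
  have "{..<steps t} = {..<steps s} \<union> {steps s..<steps t}" using steps_mono[OF st(2)] by auto
  then have split: "?s t \<omega> - ?s s \<omega> = \<gamma> * (\<Sum>j\<in>{steps s..<steps t}. ramp \<delta> (X j \<omega>))" for \<omega>
    by (simp add: sum.union_disjoint ivl_disj_int algebra_simps)
  have "\<gamma> * (\<Sum>j\<in>{steps s..<steps t}. \<integral>\<omega>. G \<omega> * ramp \<delta> (X j \<omega>) \<partial>P) = 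
     (\<integral>\<omega>. \<gamma> * (\<Sum>j\<in>{steps s..<steps t}. G \<omega> * ramp \<delta> (X j \<omega>)) \<partial>P)"
    using G_integrable[OF ir] by (simp add: Bochner_Integration.integral_sum)
  also have "\<dots> = (\<integral>\<omega>. G \<omega> * (?s t \<omega> - ?s s \<omega>) \<partial>P)"
    unfolding split by (simp add: sum_distrib_left algebra_simps)
  also have "\<dots> = (\<integral>\<omega>. G \<omega> * (occ \<delta> t \<omega> - occ \<delta> s \<omega>) - (G \<omega> * ?R t \<omega> - G \<omega> * ?R s \<omega>) \<partial>P)"
    by (intro Bochner_Integration.integral_cong) (auto simp: algebra_simps)
  also have "\<dots> = (\<integral>\<omega>. G \<omega> * (occ \<delta> t \<omega> - occ \<delta> s \<omega>) \<partial>P) - ((\<integral>\<omega>. G \<omega> * ?R t \<omega> \<partial>P) - (\<integral>\<omega>. G \<omega> * ?R s \<omega> \<partial>P))"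
  proof -
    have "integrable P (occ \<delta> t)" "integrable P (occ \<delta> s)"
      using Bochner_Integration.integrable_add[OF Rt(1) ist[of t]] Bochner_Integration.integrable_add[OF Rs(1) ist[of s]] by auto
    then have "integrable P (\<lambda>\<omega>. G \<omega> * (occ \<delta> t \<omega> - occ \<delta> s \<omega>))" by (intro G_integrable) auto
    then show ?thesis
      using G_integrable[OF Rt(1)] G_integrable[OF Rs(1)]
      by (subst Bochner_Integration.integral_diff; simp)+
  qed
  finally show ?thesis
    using G_abs[OF Rt(1)] G_abs[OF Rs(1)] Rt(2) Rs(2) unfolding distrib_right by linarith
qed

text \<open>Four replacements in a row: the squared path functional becomes a sum of conditional
  variances, then of ramps at drifted positions, then of ramps at actual positions, and finally the
  ramp time of the path.\<close>

lemma variance_increment: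
  assumes \<delta>: "\<delta> > 0"
  shows "\<bar>(\<integral>\<omega>. G \<omega> * ((Mcont c \<kappa> t (path \<omega>))\<^sup>2 - (Mcont c \<kappa> s (path \<omega>))\<^sup>2) \<partial>P)
     - 4 * \<sigma>\<^sup>2 * (\<integral>\<omega>. G \<omega> * (occ \<delta> t \<omega> - occ \<delta> s \<omega>) \<partial>P)\<bar> \<le> Cvar1 t * \<delta> + Cvar2 s t \<delta> * sqrt \<gamma>"
proof -
  let ?A = "\<Sum>j\<in>{steps s..<steps t}. \<integral>\<omega>. G \<omega> * ramp \<delta> (drift j \<omega>) \<partial>P"
  let ?X = "\<Sum>j\<in>{steps s..<steps t}. \<integral>\<omega>. G \<omega> * ramp \<delta> (X j \<omega>) \<partial>P"
  let ?O = "\<integral>\<omega>. G \<omega> * (occ \<delta> t \<omega> - occ \<delta> s \<omega>) \<partial>P"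
  have 1: "\<bar>4 * r\<^sup>2 * ?A - 4 * \<sigma>\<^sup>2 * (\<gamma> * ?X)\<bar> \<le> 4 * \<sigma>\<^sup>2 * (2 / \<delta> * (t + 1) * (L + c) * mom (t + 1) * sqrt \<gamma>)"
  proof -
    have "\<bar>4 * r\<^sup>2 * ?A - 4 * \<sigma>\<^sup>2 * (\<gamma> * ?X)\<bar> = \<bar>4 * \<sigma>\<^sup>2 * (\<gamma> * ?A - \<gamma> * ?X)\<bar>"
      unfolding r_sq right_diff_distrib by (simp only: mult.assoc)
    also have "\<dots> = 4 * \<sigma>\<^sup>2 * \<bar>\<gamma> * ?A - \<gamma> * ?X\<bar>" by (simp add: abs_mult)
    also have "\<dots> \<le> 4 * \<sigma>\<^sup>2 * (2 / \<delta> * (t + 1) * (L + c) * mom (t + 1) * sqrt \<gamma>)"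
      by (intro mult_left_mono ramp_sum_drift \<delta>) auto
    finally show ?thesis .
  qed
  have 2: "\<bar>4 * \<sigma>\<^sup>2 * (\<gamma> * ?X) - 4 * \<sigma>\<^sup>2 * ?O\<bar> \<le> 4 * \<sigma>\<^sup>2 * ((Cocc \<delta> t + Cocc \<delta> s) * sqrt \<gamma>)"
  proof -
    have "\<bar>4 * \<sigma>\<^sup>2 * (\<gamma> * ?X) - 4 * \<sigma>\<^sup>2 * ?O\<bar> = 4 * \<sigma>\<^sup>2 * \<bar>\<gamma> * ?X - ?O\<bar>"
      unfolding right_diff_distrib[symmetric] abs_mult by simp
    also have "\<dots> \<le> 4 * \<sigma>\<^sup>2 * ((Cocc \<delta> t + Cocc \<delta> s) * sqrt \<gamma>)"
      by (intro mult_left_mono ramp_sum_occ \<delta>) auto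
    finally show ?thesis .
  qed
  have e: "Cvar1 t * \<delta> + Cvar2 s t \<delta> * sqrt \<gamma> = (Csq t + Csq s) * sqrt \<gamma>
     + (Cvar1 t * \<delta> + 528 * (t + 1) * \<sigma>^4 / \<delta>\<^sup>2 * sqrt \<gamma>)
     + 4 * \<sigma>\<^sup>2 * (2 / \<delta> * (t + 1) * (L + c) * mom (t + 1) * sqrt \<gamma>)
     + 4 * \<sigma>\<^sup>2 * ((Cocc \<delta> t + Cocc \<delta> s) * sqrt \<gamma>)"
    unfolding Cvar2_def by (simp add: algebra_simps)
  have tri: "\<bar>x - y\<bar> \<le> a \<Longrightarrow> \<bar>y - z\<bar> \<le> b \<Longrightarrow> \<bar>z - u\<bar> \<le> d \<Longrightarrow> \<bar>u - v\<bar> \<le> f \<Longrightarrow> \<bar>x - v\<bar> \<le> a + b + d + f"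
    for x y z u v a b d f :: real by linarith
  show ?thesis
    unfolding e by (rule tri[OF Mcont_sq_increment V_sum_ramp[OF \<delta>] 1 2])
qed

end

end

section \<open>Passing to the limit\<close>

lemma abs_truncation_le: "\<bar>x - max (- R) (min R x)\<bar> \<le> x\<^sup>2 / R" if "R > 0" for x R :: real
proof (cases "\<bar>x\<bar> \<le> R")
  case True
  then have "min R x = x" "max (- R) x = x" by auto
  then show ?thesis using that by simp
next
  case False
  have "\<bar>x - max (- R) (min R x)\<bar> \<le> \<bar>x\<bar>" using that by (auto simp: max_def min_def abs_if)
  also have "\<dots> \<le> x\<^sup>2 / R"
  proof -
    have "R * \<bar>x\<bar> \<le> \<bar>x\<bar> * \<bar>x\<bar>" using False by (intro mult_right_mono) auto
    then show ?thesis using that by (simp add: field_simps power2_eq_square)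
  qed
  finally show ?thesis .
qed

lemma (in prob_space) truncation_error:
  fixes f :: "'a \<Rightarrow> real"
  assumes [measurable]: "f \<in> borel_measurable M" and i: "integrable M (\<lambda>x. (f x)\<^sup>2)" and C: "(\<integral>x. (f x)\<^sup>2 \<partial>M) \<le> C"
    and R: "R > 0"
  shows "integrable M f" "\<bar>(\<integral>x. f x \<partial>M) - (\<integral>x. max (- R) (min R (f x)) \<partial>M)\<bar> \<le> C / R"
proof -
  have y: "\<bar>y\<bar> \<le> \<bar>y\<^sup>2 + 1\<bar>" for y :: real using abs_le_sq_div[of 1 y] by simp
  show f: "integrable M f"
  proof (rule Bochner_Integration.integrable_bound)
    show "integrable M (\<lambda>x. (f x)\<^sup>2 + 1)" using i by simp
    show "AE x in M. norm (f x) \<le> norm ((f x)\<^sup>2 + 1)" unfolding real_norm_def by (intro AE_I2 y)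
  qed measurable
  have t: "integrable M (\<lambda>x. max (- R) (min R (f x)))"
    using R by (intro integrable_const_bound[of _ R]) (auto simp: max_def min_def abs_le_iff)
  have "\<bar>(\<integral>x. f x \<partial>M) - (\<integral>x. max (- R) (min R (f x)) \<partial>M)\<bar> = \<bar>\<integral>x. f x - max (- R) (min R (f x)) \<partial>M\<bar>"
    using f t by simp
  also have "\<dots> \<le> (\<integral>x. \<bar>f x - max (- R) (min R (f x))\<bar> \<partial>M)" by (rule integral_abs_bound)
  also have "\<dots> \<le> (\<integral>x. (f x)\<^sup>2 / R \<partial>M)"
    using i f t R by (intro integral_mono abs_truncation_le) auto
  also have "\<dots> \<le> C / R" using C R by (simp add: divide_right_mono)
  finally show "\<bar>(\<integral>x. f x \<partial>M) - (\<integral>x. max (- R) (min R (f x)) \<partial>M)\<bar> \<le> C / R" .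
qed

text \<open>Each approximating element \<open>Z j\<close> lives on its own probability space, and
  convergence is assumed for bounded continuous functionals only; the results extend it to
  functionals with a uniform second moment.\<close>

locale weak_limit = prob_space \<mu> for \<mu> :: "'b measure" +
  fixes T :: "'b topology" and P :: "nat \<Rightarrow> 'a measure" and Z :: "nat \<Rightarrow> 'a \<Rightarrow> 'b"
  assumes prob_P: "\<And>j. prob_space (P j)"
    and space_\<mu>: "space \<mu> = topspace T"
    and cont_meas: "\<And>f. continuous_map T euclideanreal f \<Longrightarrow> f \<in> borel_measurable \<mu>"
    and cont_meas_Z: "\<And>f j. continuous_map T euclideanreal f \<Longrightarrow> (\<lambda>\<omega>. f (Z j \<omega>)) \<in> borel_measurable (P j)"
    and conv: "\<And>f. continuous_map T euclideanreal f \<Longrightarrow> bounded (f ` topspace T) \<Longrightarrow>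
       (\<lambda>j. \<integral>\<omega>. f (Z j \<omega>) \<partial>P j) \<longlonglongrightarrow> (\<integral>x. f x \<partial>\<mu>)"
begin

context
  fixes F :: "'b \<Rightarrow> real" and C :: real
  assumes F: "continuous_map T euclideanreal F"
    and FZ: "\<And>j. integrable (P j) (\<lambda>\<omega>. (F (Z j \<omega>))\<^sup>2)" "\<And>j. (\<integral>\<omega>. (F (Z j \<omega>))\<^sup>2 \<partial>P j) \<le> C"
begin

text \<open>The truncations \<open>min n ((F x)\<^sup>2)\<close> are bounded and continuous, so they
  inherit the bound \<open>C\<close> in the limit; Fatou's lemma then removes the
  truncation.\<close>

lemma limit_sq: "integrable \<mu> (\<lambda>x. (F x)\<^sup>2)" "(\<integral>x. (F x)\<^sup>2 \<partial>\<mu>) \<le> C"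
proof -
  have [measurable]: "F \<in> borel_measurable \<mu>" using F by (rule cont_meas)
  have le: "(\<integral>x. min (real n) ((F x)\<^sup>2) \<partial>\<mu>) \<le> C" for n
  proof (rule tendsto_upperbound)
    have "continuous_map T euclideanreal (\<lambda>x. min (real n) ((F x)\<^sup>2))"
      using F by (intro continuous_map_real_min continuous_map_real_pow) auto
    moreover have "bounded ((\<lambda>x. min (real n) ((F x)\<^sup>2)) ` topspace T)"
      by (rule boundedI[of _ "real n"]) auto
    ultimately show "(\<lambda>j. \<integral>\<omega>. min (real n) ((F (Z j \<omega>))\<^sup>2) \<partial>P j) \<longlonglongrightarrow> (\<integral>x. min (real n) ((F x)\<^sup>2) \<partial>\<mu>)"
      by (rule conv)
    show "\<forall>\<^sub>F j in sequentially. (\<integral>\<omega>. min (real n) ((F (Z j \<omega>))\<^sup>2) \<partial>P j) \<le> C"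
    proof (intro always_eventually allI)
      fix j
      interpret Pj: prob_space "P j" by (rule prob_P)
      have [measurable]: "(\<lambda>\<omega>. F (Z j \<omega>)) \<in> borel_measurable (P j)" using F by (rule cont_meas_Z)
      have "integrable (P j) (\<lambda>\<omega>. min (real n) ((F (Z j \<omega>))\<^sup>2))"
        by (rule Pj.integrable_const_bound[of _ "real n"]) auto
      then have "(\<integral>\<omega>. min (real n) ((F (Z j \<omega>))\<^sup>2) \<partial>P j) \<le> (\<integral>\<omega>. (F (Z j \<omega>))\<^sup>2 \<partial>P j)"
        using FZ by (intro integral_mono) auto
      then show "(\<integral>\<omega>. min (real n) ((F (Z j \<omega>))\<^sup>2) \<partial>P j) \<le> C" using FZ(2) by (rule order_trans)
    qed
  qed simp
  have "(\<integral>\<^sup>+x. ennreal ((F x)\<^sup>2) \<partial>\<mu>) = (\<integral>\<^sup>+x. liminf (\<lambda>n. ennreal (min (real n) ((F x)\<^sup>2))) \<partial>\<mu>)"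
  proof (rule nn_integral_cong)
    fix x
    obtain N where N: "(F x)\<^sup>2 \<le> real N" using real_arch_simple by blast
    have "\<forall>\<^sub>F n in sequentially. min (real n) ((F x)\<^sup>2) = (F x)\<^sup>2"
      using eventually_ge_at_top[of N] by eventually_elim (use N in linarith)
    then have "(\<lambda>n. ennreal (min (real n) ((F x)\<^sup>2))) \<longlonglongrightarrow> ennreal ((F x)\<^sup>2)"
      by (intro tendsto_eventually) (auto elim!: eventually_mono)
    then show "ennreal ((F x)\<^sup>2) = liminf (\<lambda>n. ennreal (min (real n) ((F x)\<^sup>2)))"
      by (intro lim_imp_Liminf[symmetric]) auto
  qed
  also have "\<dots> \<le> liminf (\<lambda>n. \<integral>\<^sup>+x. ennreal (min (real n) ((F x)\<^sup>2)) \<partial>\<mu>)"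
    by (rule nn_integral_liminf) measurable
  also have "\<dots> \<le> liminf (\<lambda>n::nat. ennreal C)"
  proof (intro Liminf_mono always_eventually allI)
    fix n
    have "integrable \<mu> (\<lambda>x. min (real n) ((F x)\<^sup>2))"
      by (rule integrable_const_bound[of _ "real n"]) auto
    then have "(\<integral>\<^sup>+x. ennreal (min (real n) ((F x)\<^sup>2)) \<partial>\<mu>) = ennreal (\<integral>x. min (real n) ((F x)\<^sup>2) \<partial>\<mu>)"
      by (intro nn_integral_eq_integral) auto
    then show "(\<integral>\<^sup>+x. ennreal (min (real n) ((F x)\<^sup>2)) \<partial>\<mu>) \<le> ennreal C"
      using le[of n] by (simp add: ennreal_leI)
  qed
  finally have *: "(\<integral>\<^sup>+x. ennreal ((F x)\<^sup>2) \<partial>\<mu>) \<le> ennreal C" by (simp add: Liminf_const)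
  show "integrable \<mu> (\<lambda>x. (F x)\<^sup>2)"
    using * by (intro integrableI_bounded) (auto simp: le_less_trans)
  have "0 \<le> C" using le[of 0] by simp
  then show "(\<integral>x. (F x)\<^sup>2 \<partial>\<mu>) \<le> C"
    using * by (subst integral_eq_nn_integral) (auto simp: enn2real_leI)
qed

lemma limit_integrable: "integrable \<mu> F"
  using truncation_error(1)[OF cont_meas[OF F] limit_sq, of 1] by simp

text \<open>Clamping \<open>F\<close> to \<open>[-R, R]\<close> costs at most \<open>C / R\<close>,
  uniformly in \<open>j\<close> and also under the limit, while weak convergence covers the clamped
  functional.\<close>

lemma limit_integral: "(\<lambda>j. \<integral>\<omega>. F (Z j \<omega>) \<partial>P j) \<longlonglongrightarrow> (\<integral>x. F x \<partial>\<mu>)"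
proof (rule LIMSEQ_I)
  fix \<epsilon> :: real assume \<epsilon>: "\<epsilon> > 0"
  interpret P0: prob_space "P 0" by (rule prob_P)
  have "0 \<le> (\<integral>\<omega>. (F (Z 0 \<omega>))\<^sup>2 \<partial>P 0)" by simp
  then have C: "C \<ge> 0" using FZ(2)[of 0] by linarith
  \<comment> \<open>The added 1 makes \<open>R\<close> positive even for \<open>C = 0\<close> and
    gives \<open>C / R < \<epsilon> / 3\<close>.\<close>
  define R where "R = 3 * (C + 1) / \<epsilon>"
  have R: "R > 0" using C \<epsilon> by (simp add: R_def)
  have CR: "C / R < \<epsilon> / 3" using C \<epsilon> by (simp add: R_def field_simps)
  let ?c = "\<lambda>x. max (- R) (min R (F x))"
  have "continuous_map T euclideanreal ?c"
    using F by (intro continuous_map_real_min continuous_map_real_max) auto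
  moreover have "bounded (?c ` topspace T)"
    by (rule boundedI[of _ R]) (use R in \<open>auto simp: max_def min_def abs_le_iff\<close>)
  ultimately have "(\<lambda>j. \<integral>\<omega>. ?c (Z j \<omega>) \<partial>P j) \<longlonglongrightarrow> (\<integral>x. ?c x \<partial>\<mu>)" by (rule conv)
  from LIMSEQ_D[OF this, of "\<epsilon> / 3"] \<epsilon> obtain N where
    N: "\<And>j. j \<ge> N \<Longrightarrow> \<bar>(\<integral>\<omega>. ?c (Z j \<omega>) \<partial>P j) - (\<integral>x. ?c x \<partial>\<mu>)\<bar> < \<epsilon> / 3" by auto
  have 1: "\<bar>(\<integral>\<omega>. F (Z j \<omega>) \<partial>P j) - (\<integral>\<omega>. ?c (Z j \<omega>) \<partial>P j)\<bar> \<le> C / R" for j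
    using prob_space.truncation_error(2)[OF prob_P cont_meas_Z[OF F] FZ R] .
  have 2: "\<bar>(\<integral>x. F x \<partial>\<mu>) - (\<integral>x. ?c x \<partial>\<mu>)\<bar> \<le> C / R"
    using truncation_error(2)[OF cont_meas[OF F] limit_sq R] .
  show "\<exists>N. \<forall>j\<ge>N. norm ((\<integral>\<omega>. F (Z j \<omega>) \<partial>P j) - (\<integral>x. F x \<partial>\<mu>)) < \<epsilon>"
  proof (intro exI[of _ N] allI impI)
    fix j assume "j \<ge> N"
    then show "norm ((\<integral>\<omega>. F (Z j \<omega>) \<partial>P j) - (\<integral>x. F x \<partial>\<mu>)) < \<epsilon>"
      using N[of j] 1[of j] 2 CR unfolding real_norm_def by linarith
  qed
qed

lemma limit_bound:
  assumes "\<And>j. \<bar>\<integral>\<omega>. F (Z j \<omega>) \<partial>P j\<bar> \<le> a + b * e j" and "e \<longlonglongrightarrow> 0"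
  shows "\<bar>\<integral>x. F x \<partial>\<mu>\<bar> \<le> a"
proof (rule tendsto_le[OF sequentially_bot])
  show "(\<lambda>j. \<bar>\<integral>\<omega>. F (Z j \<omega>) \<partial>P j\<bar>) \<longlonglongrightarrow> \<bar>\<integral>x. F x \<partial>\<mu>\<bar>"
    using limit_integral by (rule tendsto_rabs)
  have "(\<lambda>j. a + b * e j) \<longlonglongrightarrow> a + b * 0" by (intro tendsto_intros assms(2))
  then show "(\<lambda>j. a + b * e j) \<longlonglongrightarrow> a" by simp
qed (use assms(1) in auto)

end

end

text \<open>Bounded continuous functionals of the path up to time \<^term>\<open>s\<close>. They are used as test functions because
  every set in a generator of \<^term>\<open>Wfilt s\<close> has an indicator that is a pointwise limit of them.\<close>

definition past_tests :: "real \<Rightarrow> ((real \<Rightarrow> real) \<Rightarrow> real) set" where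
  "past_tests s = {G. continuous_map Wtop euclideanreal G \<and> (\<forall>w\<in>Wpaths. 0 \<le> G w \<and> G w \<le> 1)
     \<and> (\<forall>v\<in>Wpaths. \<forall>w\<in>Wpaths. (\<forall>u\<in>{0..s}. v u = w u) \<longrightarrow> G v = G w)}"

definition test_limits :: "real \<Rightarrow> (real \<Rightarrow> real) set set" where
  "test_limits s = {B. B \<subseteq> Wpaths \<and>
     (\<exists>G. (\<forall>j::nat. G j \<in> past_tests s) \<and> (\<forall>w\<in>Wpaths. (\<lambda>j. G j w) \<longlonglongrightarrow> indicator B w))}"

lemma past_testsD:
  assumes "G \<in> past_tests s"
  shows "continuous_map Wtop euclideanreal G"
    and "w \<in> Wpaths \<Longrightarrow> 0 \<le> G w" and "w \<in> Wpaths \<Longrightarrow> G w \<le> 1"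
    and "v \<in> Wpaths \<Longrightarrow> w \<in> Wpaths \<Longrightarrow> (\<And>u. 0 \<le> u \<Longrightarrow> u \<le> s \<Longrightarrow> v u = w u) \<Longrightarrow> G v = G w"
  using assms unfolding past_tests_def mem_Collect_eq by (blast, blast, blast, meson atLeastAtMost_iff)

lemma past_tests_one: "(\<lambda>_. 1) \<in> past_tests s"
  by (simp add: past_tests_def)

lemma past_tests_mult: "G \<in> past_tests s \<Longrightarrow> H \<in> past_tests s \<Longrightarrow> (\<lambda>w. G w * H w) \<in> past_tests s"
  unfolding past_tests_def mem_Collect_eq
  by (intro conjI ballI impI continuous_map_real_mult mult_nonneg_nonneg mult_le_one arg_cong2[where f = "(*)"]) 
     blast+

text \<open>Products of tests are tests, and indicators of intersections are products. This supplies
  the generator for the Dynkin argument in \<open>integral_Wfilt_eq_0\<close>.\<close>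

lemma Int_stable_test_limits: "Int_stable (test_limits s)"
proof (rule Int_stableI)
  fix A B assume AB: "A \<in> test_limits s" "B \<in> test_limits s"
  then have sub: "A \<subseteq> Wpaths" "B \<subseteq> Wpaths" by (auto simp: test_limits_def)
  obtain G where G: "\<And>j. G j \<in> past_tests s" "\<And>w. w \<in> Wpaths \<Longrightarrow> (\<lambda>j. G j w) \<longlonglongrightarrow> indicator A w"
    using AB(1) unfolding test_limits_def by blast
  obtain H where H: "\<And>j. H j \<in> past_tests s" "\<And>w. w \<in> Wpaths \<Longrightarrow> (\<lambda>j. H j w) \<longlonglongrightarrow> indicator B w"
    using AB(2) unfolding test_limits_def by blast
  have "(\<lambda>j. G j w * H j w) \<longlonglongrightarrow> indicator (A \<inter> B) w" if "w \<in> Wpaths" for w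
    using tendsto_mult[OF G(2)[OF that] H(2)[OF that]] by (simp add: indicator_inter_arith)
  then show "A \<inter> B \<in> test_limits s"
    unfolding test_limits_def using sub G(1) H(1)
    by (auto intro!: exI[of _ "\<lambda>j w. G j w * H j w"] past_tests_mult)
qed

text \<open>The tests are functions of \<open>w u\<close> that equal 1 up to \<open>a\<close> and
  then fall to 0 with slope \<open>j\<close>.\<close>

lemma halfline_test_limits: "{w \<in> Wpaths. w u \<le> a} \<in> test_limits s" if u: "0 \<le> u" "u \<le> s"
proof -
  define G where "G = (\<lambda>(j::nat) (w :: real \<Rightarrow> real). max 0 (min 1 (1 - real j * (w u - a))))"
  have "G j \<in> past_tests s" for j
    unfolding past_tests_def G_def using u
    by (auto intro!: continuous_map_real_max continuous_map_real_min continuous_map_diff continuous_map_real_mult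
        continuous_map_eval)
  moreover have "(\<lambda>j. G j w) \<longlonglongrightarrow> indicator {w \<in> Wpaths. w u \<le> a} w" if w: "w \<in> Wpaths" for w
  proof (cases "w u \<le> a")
    case True
    then have "real j * (w u - a) \<le> 0" for j by (simp add: mult_nonneg_nonpos)
    then have "G j w = 1" for j unfolding G_def by (smt (verit))
    then show ?thesis using True w by simp
  next
    case False
    obtain N :: nat where N: "1 / (w u - a) \<le> real N" using real_arch_simple by blast
    have "\<forall>\<^sub>F j in sequentially. G j w = 0"
      using eventually_ge_at_top[of N]
    proof eventually_elim
      case (elim j)
      then have "1 / (w u - a) \<le> real j" using N by linarith
      then have "1 \<le> real j * (w u - a)" using False by (simp add: field_simps)
      then show ?case by (simp add: G_def)
    qed
    then show ?thesis using False by (simp add: tendsto_eventually)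
  qed
  ultimately show ?thesis unfolding test_limits_def by auto
qed

lemma test_limits_Pow: "test_limits s \<subseteq> Pow Wpaths"
  by (auto simp: test_limits_def)

lemma Wfilt_test_limits: "Wfilt s \<subseteq> sigma_sets Wpaths (test_limits s)"
  unfolding Wfilt_def
proof (rule sigma_sets_mono, rule subsetI)
  fix E assume "E \<in> {{w \<in> Wpaths. w u \<in> A} |u A. 0 \<le> u \<and> u \<le> s \<and> A \<in> sets borel}"
  then obtain u A where E: "E = {w \<in> Wpaths. w u \<in> A}" and u: "0 \<le> u" "u \<le> s" and A: "A \<in> sets borel"
    by auto
  let ?M = "sigma Wpaths (test_limits s)"
  have sp: "space ?M = Wpaths" and se: "sets ?M = sigma_sets Wpaths (test_limits s)"
    using test_limits_Pow by (auto simp: space_measure_of_conv sets_measure_of)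
  have "(\<lambda>w. w u) \<in> borel_measurable ?M"
    unfolding borel_measurable_iff_le sp se using halfline_test_limits[OF u] by auto
  from measurable_sets[OF this A] show "E \<in> sigma_sets Wpaths (test_limits s)"
    unfolding E sp se by (simp add: vimage_def Int_def conj_commute)
qed

text \<open>Dominated convergence carries the identity from tests to \<open>test_limits s\<close>.
  The sets for which it holds are closed under countable disjoint unions, and under complements
  because the constant test 1 makes the total integral vanish.\<close>

lemma integral_Wfilt_eq_0:
  assumes sets: "sets \<mu> = sets Wborel" and Y: "integrable \<mu> Y"
    and test: "\<And>G. G \<in> past_tests s \<Longrightarrow> (\<integral>w. G w * Y w \<partial>\<mu>) = (0::real)"
    and B: "B \<in> Wfilt s"
  shows "(\<integral>w\<in>B. Y w \<partial>\<mu>) = 0"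
proof -
  have sp: "space \<mu> = Wpaths" using sets_eq_imp_space_eq[OF sets] by simp
  have Gm: "G \<in> borel_measurable \<mu>" if "G \<in> past_tests s" for G
    using continuous_map_measurable_Wborel[OF past_testsD(1)[OF that]]
    unfolding measurable_cong_sets[OF sets refl] .
  have tm: "A \<in> sets \<mu>" if "A \<in> test_limits s" for A
  proof -
    obtain G where A: "A \<subseteq> Wpaths" and G: "\<And>j. G j \<in> past_tests s"
      "\<And>w. w \<in> Wpaths \<Longrightarrow> (\<lambda>j. G j w) \<longlonglongrightarrow> indicator A w"
      using \<open>A \<in> test_limits s\<close> unfolding test_limits_def by blast
    have "(indicator A :: _ \<Rightarrow> real) \<in> borel_measurable \<mu>"
      by (rule borel_measurable_LIMSEQ_real[of _ G]) (use G Gm sp in auto)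
    then show ?thesis using A sp by (simp add: borel_measurable_indicator_iff Int_absorb2)
  qed
  have sm: "A \<in> sets \<mu>" if "A \<in> sigma_sets Wpaths (test_limits s)" for A
    using sets.sigma_sets_subset[of "test_limits s" \<mu>] tm that unfolding sp by auto
  have YA: "set_integrable \<mu> A Y" if "A \<in> sets \<mu>" for A
    unfolding set_integrable_def using that Y by (rule integrable_mult_indicator)
  have tot: "(\<integral>w\<in>Wpaths. Y w \<partial>\<mu>) = 0"
    using test[OF past_tests_one] set_integral_space[OF Y] by (simp add: sp)
  have "B \<in> sigma_sets Wpaths (test_limits s)" using B Wfilt_test_limits by blast
  from Int_stable_test_limits test_limits_Pow this show ?thesis
  proof (induction rule: sigma_sets_induct_disjoint)
    case (basic A)
    obtain G where A: "A \<subseteq> Wpaths" and G: "\<And>j. G j \<in> past_tests s"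
      "\<And>w. w \<in> Wpaths \<Longrightarrow> (\<lambda>j. G j w) \<longlonglongrightarrow> indicator A w"
      using \<open>A \<in> test_limits s\<close> unfolding test_limits_def by blast
    have "(\<lambda>j. \<integral>w. G j w * Y w \<partial>\<mu>) \<longlonglongrightarrow> (\<integral>w. indicator A w * Y w \<partial>\<mu>)"
    proof (rule integral_dominated_convergence[where w = "\<lambda>w. \<bar>Y w\<bar>"])
      show "(\<lambda>w. indicator A w * Y w) \<in> borel_measurable \<mu>"
        using tm[OF basic] Y by measurable
      show "(\<lambda>w. G j w * Y w) \<in> borel_measurable \<mu>" for j
        using Gm[OF G(1)[of j]] Y by measurable
      show "integrable \<mu> (\<lambda>w. \<bar>Y w\<bar>)" using Y by simp
      show "AE w in \<mu>. (\<lambda>j. G j w * Y w) \<longlonglongrightarrow> indicator A w * Y w"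
        using G(2) by (intro AE_I2 tendsto_mult tendsto_const) (simp add: sp)
      show "AE w in \<mu>. norm (G j w * Y w) \<le> \<bar>Y w\<bar>" for j
      proof (rule AE_I2)
        fix w assume "w \<in> space \<mu>"
        then have "0 \<le> G j w" "G j w \<le> 1" using past_testsD(2,3)[OF G(1)] by (simp_all add: sp)
        then show "norm (G j w * Y w) \<le> \<bar>Y w\<bar>" by (simp add: abs_mult mult_left_le_one_le)
      qed
    qed
    then have "(\<lambda>j::nat. 0) \<longlonglongrightarrow> (\<integral>w. indicator A w * Y w \<partial>\<mu>)"
      using test[OF G(1)] by simp
    then have "(\<integral>w. indicator A w * Y w \<partial>\<mu>) = 0" using LIMSEQ_unique tendsto_const by blast
    then show ?case by (simp add: set_lebesgue_integral_def)
  next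
    case empty
    then show ?case by (simp add: set_lebesgue_integral_def)
  next
    case (compl A)
    have "(\<integral>w\<in>Wpaths - A. Y w \<partial>\<mu>) = (\<integral>w\<in>Wpaths. Y w \<partial>\<mu>) - (\<integral>w\<in>A. Y w \<partial>\<mu>)"
    proof -
      have AW: "A \<subseteq> Wpaths" using sets.sets_into_space[OF sm[OF compl(1)]] by (simp add: sp)
      then have "Wpaths = A \<union> (Wpaths - A)" by auto
      then have "(\<integral>w\<in>Wpaths. Y w \<partial>\<mu>) = (\<integral>w\<in>A \<union> (Wpaths - A). Y w \<partial>\<mu>)" by simp
      also have "\<dots> = (\<integral>w\<in>A. Y w \<partial>\<mu>) + (\<integral>w\<in>Wpaths - A. Y w \<partial>\<mu>)"
        using sm[OF compl(1)] sets.top[of \<mu>] by (intro set_integral_Un YA) (auto simp: sp)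
      finally show ?thesis by simp
    qed
    then show ?case using tot compl by simp
  next
    case (union A)
    have Am: "A i \<in> sets \<mu>" for i using union(2) sm by blast
    then have "(\<Union>i. A i) \<in> sets \<mu>" by (intro sets.countable_UN) auto
    then have "(\<integral>w\<in>(\<Union>i. A i). Y w \<partial>\<mu>) = (\<Sum>i. \<integral>w\<in>A i. Y w \<partial>\<mu>)"
      using union(1) by (intro lebesgue_integral_countable_add YA Am) (auto simp: disjoint_family_on_def)
    then show ?case using union by simp
  qed
qed

text \<open>\<open>G\<close> sees the path up to \<open>s\<close> only, so it takes the same value
  on the interpolation of the chain stopped at \<open>steps s\<close>, which is built from
  coordinates in \<open>Fil (steps s)\<close>.\<close>

lemma (in sticky_chain) past_test_Fil:
  assumes G: "G \<in> past_tests s" and s: "s \<ge> 0"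
  shows "(\<lambda>\<omega>. G (path \<omega>)) \<in> borel_measurable (Fil (steps s))"
proof -
  have "(\<lambda>\<omega>. interp \<gamma> (\<lambda>k. X (min k (steps s)) \<omega>)) \<in> measurable (Fil (steps s)) Wborel"
    by (rule measurable_interp[OF gamma_pos]) (rule X_Fil, simp)
  note m = measurable_compose[OF this continuous_map_measurable_Wborel[OF past_testsD(1)[OF G]]]
  have "G (interp \<gamma> (\<lambda>k. X (min k (steps s)) \<omega>)) = G (path \<omega>)" for \<omega>
    unfolding path_def steps_def
    by (rule past_testsD(4)[OF G]; (rule interp_Wpaths interp_stopped, rule gamma_pos; assumption)?)
  then have "(\<lambda>\<omega>. G (interp \<gamma> (\<lambda>k. X (min k (steps s)) \<omega>))) = (\<lambda>\<omega>. G (path \<omega>))"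
    by (rule ext)
  with m show ?thesis by (rule subst[rotated])
qed

section \<open>Time spent away from the origin and its continuous approximations\<close>

definition pos_time :: "real \<Rightarrow> (real \<Rightarrow> real) \<Rightarrow> real" where
  "pos_time t w = (LINT u:{0..t}|lborel. indicator {0<..} (w u))"

definition ramp_time :: "real \<Rightarrow> real \<Rightarrow> (real \<Rightarrow> real) \<Rightarrow> real" where
  "ramp_time \<delta> t w = (LINT u:{0..t}|lborel. ramp \<delta> (w u))"

lemma continuous_map_ramp_time: "\<delta> > 0 \<Longrightarrow> t \<ge> 0 \<Longrightarrow> continuous_map Wtop euclideanreal (ramp_time \<delta> t)"
  unfolding ramp_time_def by (rule continuous_map_path_integral[OF ramp_lipschitz])

lemma set_integral_bounds_01:
  fixes f :: "real \<Rightarrow> real"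
  assumes t: "t \<ge> 0" and f: "\<And>u. 0 \<le> f u" "\<And>u. f u \<le> 1"
  shows "0 \<le> (LINT u:{0..t}|lborel. f u)" "(LINT u:{0..t}|lborel. f u) \<le> t"
proof -
  show "0 \<le> (LINT u:{0..t}|lborel. f u)"
    unfolding set_lebesgue_integral_def using f by (intro integral_nonneg_AE) auto
  have "(LINT u:{0..t}|lborel. f u) \<le> (LINT u|lborel. indicator {0..t} u)"
    unfolding set_lebesgue_integral_def
  \<comment> \<open>Integrability is asked of the larger function only, so the bound also covers
    functions whose integral takes its default value 0.\<close>
  proof (rule integral_mono')
    show "integrable lborel (indicator {0..t} :: real \<Rightarrow> real)" by (simp add: emeasure_lborel_Icc t)
  qed (use f in \<open>auto split: split_indicator\<close>)
  also have "\<dots> = t" using t by simp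
  finally show "(LINT u:{0..t}|lborel. f u) \<le> t" .
qed

text \<open>Every ramp vanishes at 0, so the limit is the indicator of the open half-line and not of
  the closed one.\<close>

lemma ramp_tendsto: "(\<lambda>n. ramp (1 / real (Suc n)) x) \<longlonglongrightarrow> indicator {0<..} x"
proof (cases "x > 0")
  case True
  obtain N :: nat where N: "1 / x \<le> real N" using real_arch_simple by blast
  have "\<forall>\<^sub>F n in sequentially. ramp (1 / real (Suc n)) x = 1"
    using eventually_ge_at_top[of N]
  proof eventually_elim
    case (elim n)
    then have "1 / x \<le> real (Suc n)" using N by simp
    then have "1 \<le> x * real (Suc n)" using True by (simp add: field_simps)
    then have "1 \<le> 2 * x / (1 / real (Suc n)) - 1" by simp
    then show ?case unfolding ramp_def by linarith
  qed
  then show ?thesis using True by (simp add: tendsto_eventually)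
next
  case False
  then have "2 * x \<le> 0" by simp
  then have "2 * x * real (Suc n) \<le> 0" for n by (rule mult_nonpos_nonneg) simp
  then have "2 * x / (1 / real (Suc n)) - 1 \<le> 0" for n by (smt (verit) divide_divide_eq_right div_by_1)
  then have "ramp (1 / real (Suc n)) x = 0" for n unfolding ramp_def by (smt (verit))
  then show ?thesis using False by simp
qed

lemma ramp_time_tendsto:
  assumes w: "w \<in> Wpaths"
  shows "(\<lambda>n. ramp_time (1 / real (Suc n)) t w) \<longlonglongrightarrow> pos_time t w"
  unfolding ramp_time_def pos_time_def set_lebesgue_integral_def
proof (rule integral_dominated_convergence[where w = "indicator {0..t}"])
  have "continuous_on {0..t} w" using Wpaths_continuous[OF order.refl w] .
  then have w0[measurable]: "(\<lambda>u. indicator {0..t} u * w u) \<in> borel_measurable borel"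
    using borel_measurable_continuous_on_indicator[of "{0..t}" w] by simp
  \<comment> \<open>The integrand is expressed through the path cut off outside
    \<open>[0, t]\<close>, which is a Borel function on the whole line.\<close>
  have eq: "indicator {0..t} u *\<^sub>R f (w u) = indicator {0..t} u * f (indicator {0..t} u * w u)" 
    for f :: "real \<Rightarrow> real" and u by (simp split: split_indicator)
  show "(\<lambda>u. indicator {0..t} u *\<^sub>R ramp (1 / real (Suc n)) (w u)) \<in> borel_measurable lborel" for n
    unfolding eq by measurable
  have "(\<lambda>u. indicator {0..t} u * (indicator {0<..} (indicator {0..t} u * w u) :: real)) \<in> borel_measurable lborel"
    by measurable
  then show "(\<lambda>u. indicator {0..t} u *\<^sub>R indicator {0<..} (w u) :: real) \<in> borel_measurable lborel"
    by (subst eq)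
  show "integrable lborel (indicator {0..t} :: real \<Rightarrow> real)" by (cases "0 \<le> t") simp_all
  show "AE u in lborel. (\<lambda>n. indicator {0..t} u *\<^sub>R ramp (1 / real (Suc n)) (w u))
      \<longlonglongrightarrow> indicator {0..t} u *\<^sub>R indicator {0<..} (w u)"
    by (intro AE_I2 tendsto_scaleR tendsto_const ramp_tendsto)
  show "AE u in lborel. norm (indicator {0..t} u *\<^sub>R ramp (1 / real (Suc n)) (w u)) \<le> indicator {0..t} u" for n
    using ramp_bounds by (intro AE_I2) (auto split: split_indicator)
qed

lemma Mproc_eq_Mcont:
  assumes \<kappa>: "L-lipschitz_on {0..} \<kappa>" and w: "w \<in> Wpaths" "\<And>t. t \<ge> 0 \<Longrightarrow> w t \<ge> 0" and t: "t \<ge> 0"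
  shows "Mproc c \<kappa> t w = Mcont c \<kappa> t w"
proof -
  have c: "continuous_on {0..t} (\<lambda>u. \<kappa> (max 0 (w u)))"
    by (intro lipschitz_imp_continuous_comp[OF lipschitz_extend[OF \<kappa>]] Wpaths_continuous w) simp
  have "(LINT u:{0..t}|lborel. c + \<kappa> (w u)) = (LINT u:{0..t}|lborel. c + \<kappa> (max 0 (w u)))"
    unfolding set_lebesgue_integral_def using w(2)
    by (intro Bochner_Integration.integral_cong) (auto split: split_indicator)
  also have "\<dots> = integral {0..t} (\<lambda>u. c + \<kappa> (max 0 (w u)))"
    using c by (intro LINT_eq_integral continuous_intros)
  also have "\<dots> = c * t + integral {0..t} (\<lambda>u. \<kappa> (max 0 (w u)))"
    using c t by (subst Henstock_Kurzweil_Integration.integral_add) (auto intro!: integrable_continuous_interval)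
  also have "integral {0..t} (\<lambda>u. \<kappa> (max 0 (w u))) = (LINT u:{0..t}|lborel. \<kappa> (max 0 (w u)))"
    using LINT_eq_integral[OF c] by simp
  finally show ?thesis by (simp add: Mproc_def Mcont_def)
qed

text \<open>The family stands for a tail of the convergent subsequence, so that all its members are
  instances of \<open>sticky_chain\<close> with the same parameters apart from the step
  size.\<close>

locale sticky_limit =
  fixes \<sigma> c L w0 :: real and \<kappa> :: "real \<Rightarrow> real" and \<gamma> :: "nat \<Rightarrow> real"
    and P :: "nat \<Rightarrow> 'a measure" and X :: "nat \<Rightarrow> nat \<Rightarrow> 'a \<Rightarrow> real" and \<mu> :: "(real \<Rightarrow> real) measure"
  assumes chain: "\<And>j. sticky_chain (P j) \<sigma> c L w0 (\<gamma> j) \<kappa> (X j)"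
    and gamma_0: "\<gamma> \<longlonglongrightarrow> 0"
    and prob_\<mu>: "prob_space \<mu>" and sets_\<mu>: "sets \<mu> = sets Wborel"
    and weak: "\<And>f. continuous_map Wtop euclideanreal f \<Longrightarrow> bounded (f ` topspace Wtop) \<Longrightarrow>
       (\<lambda>j. \<integral>\<omega>. f (sticky_chain.path (\<gamma> j) (X j) \<omega>) \<partial>P j) \<longlonglongrightarrow> (\<integral>w. f w \<partial>\<mu>)"
begin

abbreviation Z :: "nat \<Rightarrow> 'a \<Rightarrow> real \<Rightarrow> real" where
  "Z j \<equiv> sticky_chain.path (\<gamma> j) (X j)"

lemma space_limit: "space \<mu> = Wpaths"
  using sets_eq_imp_space_eq[OF sets_\<mu>] by simp

lemma continuous_functional_measurable: "continuous_map Wtop euclideanreal f \<Longrightarrow> f \<in> borel_measurable \<mu>"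
  using continuous_map_measurable_Wborel[of f] unfolding measurable_cong_sets[OF sets_\<mu> refl] .

sublocale weak_limit \<mu> Wtop P Z
proof (intro weak_limit.intro weak_limit_axioms.intro prob_\<mu> weak)
  show "prob_space (P j)" for j using chain[of j] by (rule sticky_chain.axioms(1))
  show "space \<mu> = topspace Wtop" by (simp add: space_limit)
  show "f \<in> borel_measurable \<mu>" if "continuous_map Wtop euclideanreal f" for f
    using that by (rule continuous_functional_measurable)
  show "(\<lambda>\<omega>. f (Z j \<omega>)) \<in> borel_measurable (P j)" if "continuous_map Wtop euclideanreal f" for f j
    using that by (rule sticky_chain.path_functional_measurable[OF chain])
qed

lemma Z_Wpaths: "Z j \<omega> \<in> Wpaths"
proof -
  interpret C: sticky_chain "P j" \<sigma> c L w0 "\<gamma> j" \<kappa> "X j" by (rule chain)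
  show ?thesis unfolding C.path_def using C.gamma_pos by (rule interp_Wpaths)
qed

lemma lipschitz: "L-lipschitz_on {0..} \<kappa>"
  using chain[of 0] by (rule sticky_chain.lipschitz)

lemma Mcont_cont: "t \<ge> 0 \<Longrightarrow> continuous_map Wtop euclideanreal (Mcont c \<kappa> t)"
  by (rule continuous_map_Mcont[OF lipschitz])

text \<open>At a fixed time a bounded continuous functional detecting negative values has mean zero
  along the chains, hence under \<mu>. Countably many rational times are treated simultaneously, and
  continuity of paths covers the others.\<close>

lemma AE_nonneg: "AE w in \<mu>. \<forall>t\<ge>0. w t \<ge> 0"
proof -
  have one: "AE w in \<mu>. w t \<ge> 0" if t: "t \<ge> 0" for t
  proof -
    let ?f = "\<lambda>w :: real \<Rightarrow> real. max 0 (min 1 (- w t))"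
    have cf: "continuous_map Wtop euclideanreal ?f"
      using t by (intro continuous_map_real_max continuous_map_real_min continuous_map_minus continuous_map_eval) auto
    have "bounded (?f ` topspace Wtop)" by (rule boundedI[of _ 1]) auto
    then have "(\<lambda>j. \<integral>\<omega>. ?f (Z j \<omega>) \<partial>P j) \<longlonglongrightarrow> (\<integral>w. ?f w \<partial>\<mu>)" using cf by (intro weak)
    moreover have "(\<integral>\<omega>. ?f (Z j \<omega>) \<partial>P j) = 0" for j
    proof -
      interpret C: sticky_chain "P j" \<sigma> c L w0 "\<gamma> j" \<kappa> "X j" by (rule chain)
      have "AE \<omega> in P j. ?f (C.path \<omega>) = 0"
        using C.AE_X_all_nonneg
      proof eventually_elim
        case (elim \<omega>)
        then have "C.path \<omega> t \<ge> 0" unfolding C.path_def by (intro interp_nonneg C.gamma_pos) simp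
        then show ?case by simp
      qed
      then show ?thesis by (rule integral_eq_zero_AE)
    qed
    ultimately have "(\<lambda>j::nat. 0) \<longlonglongrightarrow> (\<integral>w. ?f w \<partial>\<mu>)" by (simp only:)
    then have z: "(\<integral>w. ?f w \<partial>\<mu>) = 0" by (rule LIMSEQ_unique) (rule tendsto_const)
    have [measurable]: "?f \<in> borel_measurable \<mu>" using cf by (rule cont_meas)
    have "integrable \<mu> ?f" by (rule integrable_const_bound[of _ 1]) auto
    then have "AE w in \<mu>. ?f w = 0" using z by (subst integral_nonneg_eq_0_iff_AE[symmetric]) auto
    then show ?thesis by eventually_elim (auto simp: max_def min_def split: if_splits)
  qed
  have "AE w in \<mu>. \<forall>q\<in>\<rat> \<inter> {0..}. w q \<ge> 0"
    using one by (subst AE_ball_countable) (auto intro!: countable_subset[OF _ countable_rat])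
  then show ?thesis
  proof (rule AE_mp, intro AE_I2 impI allI)
    fix w t assume w: "w \<in> space \<mu>" and q: "\<forall>q\<in>\<rat> \<inter> {0..}. w q \<ge> 0" and t: "(t::real) \<ge> 0"
    show "w t \<ge> 0"
    proof (rule ccontr)
      assume neg: "\<not> w t \<ge> 0"
      \<comment> \<open>Working to the right of \<open>t\<close> keeps the nearby rational time
        nonnegative, also for \<open>t = 0\<close>.\<close>
      have "continuous_on {t..t + 1} w" using w t by (intro Wpaths_continuous) (auto simp: space_limit)
      then obtain d where d: "d > 0" "\<And>u. u \<in> {t..t + 1} \<Longrightarrow> dist u t < d \<Longrightarrow> dist (w u) (w t) < - w t"
        using neg unfolding continuous_on_iff by (metis atLeastAtMost_iff less_add_one linorder_not_le neg_0_less_iff_less order.refl less_imp_le)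
      have "t < min (t + d) (t + 1)" using d by simp
      from Rats_dense_in_real[OF this] obtain u where u: "u \<in> \<rat>" "t < u" "u < t + d" "u < t + 1" by auto
      then have "dist (w u) (w t) < - w t" by (intro d(2)) (auto simp: dist_real_def)
      then have "w u < 0" by (simp add: dist_real_def)
      then show False using q u t by force
    qed
  qed
qed

lemma test_Z: "G \<in> past_tests s \<Longrightarrow> 0 \<le> G (Z j \<omega>)" "G \<in> past_tests s \<Longrightarrow> G (Z j \<omega>) \<le> 1"
  using past_testsD(2,3)[OF _ Z_Wpaths] by blast+

lemma test_sq_le: "G \<in> past_tests s \<Longrightarrow> (G (Z j \<omega>) * x)\<^sup>2 \<le> x\<^sup>2"
  using test_Z[of G s j \<omega>] by (simp add: power_mult_distrib mult_left_le_one_le abs_square_le_1)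

text \<open>The constants of \<^locale>\<open>sticky_chain\<close> do not depend on the step size.\<close>

lemma Mcont_second_moment:
  assumes t: "t \<ge> 0"
  shows "integrable \<mu> (\<lambda>w. (Mcont c \<kappa> t w)\<^sup>2)" "integrable \<mu> (Mcont c \<kappa> t)"
proof -
  have b: "integrable (P j) (\<lambda>\<omega>. (Mcont c \<kappa> t (Z j \<omega>))\<^sup>2)"
    "(\<integral>\<omega>. (Mcont c \<kappa> t (Z j \<omega>))\<^sup>2 \<partial>P j) \<le> 2 * sticky_chain.Capp \<sigma> c L w0 t + 8 * \<sigma>\<^sup>2 * (t + 1)" for j
    using sticky_chain.Mcont_sq_integrable[OF chain t] by blast+
  show "integrable \<mu> (\<lambda>w. (Mcont c \<kappa> t w)\<^sup>2)" "integrable \<mu> (Mcont c \<kappa> t)"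
    using limit_sq(1)[OF Mcont_cont[OF t] b] limit_integrable[OF Mcont_cont[OF t] b] .
qed

context
  fixes G :: "(real \<Rightarrow> real) \<Rightarrow> real" and s t :: real
  assumes G: "G \<in> past_tests s" and s: "0 \<le> s" and st: "s \<le> t"
begin

text \<open>The discrete error is a multiple of \<open>sqrt \<gamma>\<close> alone, and the uniform
  second moments admit this unbounded functional to the limit.\<close>

lemma test_M: "(\<integral>w. G w * (Mcont c \<kappa> t w - Mcont c \<kappa> s w) \<partial>\<mu>) = 0"
proof -
  have t: "0 \<le> t" using s st by simp
  let ?F = "\<lambda>w. G w * (Mcont c \<kappa> t w - Mcont c \<kappa> s w)"
  let ?B = "\<lambda>u. 2 * sticky_chain.Capp \<sigma> c L w0 u + 8 * \<sigma>\<^sup>2 * (u + 1)"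
  have F: "continuous_map Wtop euclideanreal ?F"
    by (intro continuous_map_real_mult continuous_map_diff Mcont_cont s t past_testsD(1)[OF G])
  have b: "integrable (P j) (\<lambda>\<omega>. (?F (Z j \<omega>))\<^sup>2) \<and> (\<integral>\<omega>. (?F (Z j \<omega>))\<^sup>2 \<partial>P j) \<le> 2 * ?B t + 2 * ?B s" for j
  proof -
    interpret C: sticky_chain "P j" \<sigma> c L w0 "\<gamma> j" \<kappa> "X j" by (rule chain)
    let ?U = "\<lambda>\<omega>. 2 * (Mcont c \<kappa> t (Z j \<omega>))\<^sup>2 + 2 * (Mcont c \<kappa> s (Z j \<omega>))\<^sup>2"
    have iU: "integrable (P j) ?U" using C.Mcont_sq_integrable(1) s t by simp
    have "(x - y)\<^sup>2 \<le> 2 * x\<^sup>2 + 2 * y\<^sup>2" for x y :: real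
      using zero_le_power2[of "x + y"] by (simp add: power2_eq_square algebra_simps)
    from order_trans[OF test_sq_le[OF G] this]
    have le: "(?F (Z j \<omega>))\<^sup>2 \<le> ?U \<omega>" for \<omega> .
    have i: "integrable (P j) (\<lambda>\<omega>. (?F (Z j \<omega>))\<^sup>2)"
    proof (rule Bochner_Integration.integrable_bound[OF iU])
      show "(\<lambda>\<omega>. (?F (Z j \<omega>))\<^sup>2) \<in> borel_measurable (P j)"
        using cont_meas_Z[OF F] by (rule borel_measurable_power)
      show "AE \<omega> in P j. norm ((?F (Z j \<omega>))\<^sup>2) \<le> norm (?U \<omega>)"
      proof (rule AE_I2)
        fix \<omega> show "norm ((?F (Z j \<omega>))\<^sup>2) \<le> norm (?U \<omega>)"
          using le[of \<omega>] unfolding real_norm_def abs_power2 by (rule order_trans[OF _ abs_ge_self])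
      qed
    qed
    have "(\<integral>\<omega>. (?F (Z j \<omega>))\<^sup>2 \<partial>P j) \<le> (\<integral>\<omega>. ?U \<omega> \<partial>P j)" by (rule integral_mono[OF i iU le])
    also have "\<dots> = 2 * (\<integral>\<omega>. (Mcont c \<kappa> t (Z j \<omega>))\<^sup>2 \<partial>P j) + 2 * (\<integral>\<omega>. (Mcont c \<kappa> s (Z j \<omega>))\<^sup>2 \<partial>P j)"
      using C.Mcont_sq_integrable(1) s t by simp
    also have "\<dots> \<le> 2 * ?B t + 2 * ?B s"
      by (intro add_mono mult_left_mono C.Mcont_sq_integrable(3) s t) auto
    finally show ?thesis using i by blast
  qed
  have "\<bar>\<integral>w. ?F w \<partial>\<mu>\<bar> \<le> 0"
  proof (rule limit_bound[OF F])
    fix j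
    show "integrable (P j) (\<lambda>\<omega>. (?F (Z j \<omega>))\<^sup>2)" "(\<integral>\<omega>. (?F (Z j \<omega>))\<^sup>2 \<partial>P j) \<le> 2 * ?B t + 2 * ?B s"
      using b[of j] by blast+
    interpret C: sticky_chain "P j" \<sigma> c L w0 "\<gamma> j" \<kappa> "X j" by (rule chain)
    show "\<bar>\<integral>\<omega>. ?F (Z j \<omega>) \<partial>P j\<bar> \<le> 0 + (sticky_chain.Capp \<sigma> c L w0 t + sticky_chain.Capp \<sigma> c L w0 s + 2) * sqrt (\<gamma> j)"
      using C.Mcont_increment[OF C.past_test_Fil[OF G s] test_Z[OF G] s st] by simp
  next
    show "(\<lambda>j. sqrt (\<gamma> j)) \<longlonglongrightarrow> 0" using tendsto_real_sqrt[OF gamma_0] by simp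
  qed
  then show ?thesis by simp
qed

text \<open>The limit in the step size at fixed \<delta>: the part with \<open>sqrt \<gamma>\<close>
  disappears. The required second moments come from \<open>Mcont_power4\<close> for the squares and
  from the bound \<open>t\<close> for the ramp times.\<close>

lemma test_ramp:
  assumes \<delta>: "\<delta> > 0"
  shows "\<bar>(\<integral>w. G w * ((Mcont c \<kappa> t w)\<^sup>2 - (Mcont c \<kappa> s w)\<^sup>2) \<partial>\<mu>)
     - 4 * \<sigma>\<^sup>2 * (\<integral>w. G w * (ramp_time \<delta> t w - ramp_time \<delta> s w) \<partial>\<mu>)\<bar> \<le> sticky_chain.Cvar1 \<sigma> c L w0 t * \<delta>"
proof -
  have t: "0 \<le> t" using s st by simp
  let ?F1 = "\<lambda>w. G w * ((Mcont c \<kappa> t w)\<^sup>2 - (Mcont c \<kappa> s w)\<^sup>2)"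
  let ?F2 = "\<lambda>w. G w * (ramp_time \<delta> t w - ramp_time \<delta> s w)"
  let ?B1 = "2 * sticky_chain.C4 \<sigma> c L w0 t + 2 * sticky_chain.C4 \<sigma> c L w0 s"
  have F1: "continuous_map Wtop euclideanreal ?F1"
    by (intro continuous_map_real_mult continuous_map_diff continuous_map_real_pow Mcont_cont s t past_testsD(1)[OF G])
  have F2: "continuous_map Wtop euclideanreal ?F2"
    by (intro continuous_map_real_mult continuous_map_diff continuous_map_ramp_time \<delta> s t past_testsD(1)[OF G])
  have b1: "integrable (P j) (\<lambda>\<omega>. (?F1 (Z j \<omega>))\<^sup>2) \<and> (\<integral>\<omega>. (?F1 (Z j \<omega>))\<^sup>2 \<partial>P j) \<le> ?B1" for j
  proof -
    interpret C: sticky_chain "P j" \<sigma> c L w0 "\<gamma> j" \<kappa> "X j" by (rule chain)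
    let ?U = "\<lambda>\<omega>. 2 * (Mcont c \<kappa> t (Z j \<omega>))^4 + 2 * (Mcont c \<kappa> s (Z j \<omega>))^4"
    have iU: "integrable (P j) ?U" using C.Mcont_power4(1) s t by simp
    have "(x\<^sup>2 - y\<^sup>2)\<^sup>2 \<le> 2 * x^4 + 2 * y^4" for x y :: real
      using zero_le_power2[of "x\<^sup>2 + y\<^sup>2"] by (simp add: power2_eq_square power4_eq_xxxx algebra_simps)
    from order_trans[OF test_sq_le[OF G] this]
    have le: "(?F1 (Z j \<omega>))\<^sup>2 \<le> ?U \<omega>" for \<omega> .
    have i: "integrable (P j) (\<lambda>\<omega>. (?F1 (Z j \<omega>))\<^sup>2)"
    proof (rule Bochner_Integration.integrable_bound[OF iU])
      show "(\<lambda>\<omega>. (?F1 (Z j \<omega>))\<^sup>2) \<in> borel_measurable (P j)"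
        using cont_meas_Z[OF F1] by (rule borel_measurable_power)
      show "AE \<omega> in P j. norm ((?F1 (Z j \<omega>))\<^sup>2) \<le> norm (?U \<omega>)"
      proof (rule AE_I2)
        fix \<omega> show "norm ((?F1 (Z j \<omega>))\<^sup>2) \<le> norm (?U \<omega>)"
          using le[of \<omega>] unfolding real_norm_def abs_power2 by (rule order_trans[OF _ abs_ge_self])
      qed
    qed
    have "(\<integral>\<omega>. (?F1 (Z j \<omega>))\<^sup>2 \<partial>P j) \<le> (\<integral>\<omega>. ?U \<omega> \<partial>P j)" by (rule integral_mono[OF i iU le])
    also have "\<dots> = 2 * (\<integral>\<omega>. (Mcont c \<kappa> t (Z j \<omega>))^4 \<partial>P j) + 2 * (\<integral>\<omega>. (Mcont c \<kappa> s (Z j \<omega>))^4 \<partial>P j)"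
      using C.Mcont_power4(1) s t by simp
    also have "\<dots> \<le> ?B1"
      by (intro add_mono mult_left_mono C.Mcont_power4(2) s t) auto
    finally show ?thesis using i by blast
  qed
  have sq2: "(?F2 (Z j \<omega>))\<^sup>2 \<le> t\<^sup>2" for j \<omega>
  proof -
    have "\<bar>ramp_time \<delta> t (Z j \<omega>) - ramp_time \<delta> s (Z j \<omega>)\<bar> \<le> t"
      using set_integral_bounds_01[OF t, of "\<lambda>u. ramp \<delta> (Z j \<omega> u)"] 
        set_integral_bounds_01[OF s, of "\<lambda>u. ramp \<delta> (Z j \<omega> u)"] st ramp_bounds
      unfolding ramp_time_def by fastforce
    then have "(ramp_time \<delta> t (Z j \<omega>) - ramp_time \<delta> s (Z j \<omega>))\<^sup>2 \<le> t\<^sup>2"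
      using t by (intro power2_le_iff_abs_le[THEN iffD2])
    then show ?thesis using test_sq_le[OF G] by (rule order_trans[rotated])
  qed
  have b2: "integrable (P j) (\<lambda>\<omega>. (?F2 (Z j \<omega>))\<^sup>2) \<and> (\<integral>\<omega>. (?F2 (Z j \<omega>))\<^sup>2 \<partial>P j) \<le> t\<^sup>2" for j
  proof -
    interpret Pj: prob_space "P j" by (rule prob_P)
    have i: "integrable (P j) (\<lambda>\<omega>. (?F2 (Z j \<omega>))\<^sup>2)"
    proof (rule Pj.integrable_const_bound[of _ "t\<^sup>2"])
      show "AE \<omega> in P j. norm ((?F2 (Z j \<omega>))\<^sup>2) \<le> t\<^sup>2"
        unfolding real_norm_def abs_power2 by (intro AE_I2 sq2)
      show "(\<lambda>\<omega>. (?F2 (Z j \<omega>))\<^sup>2) \<in> borel_measurable (P j)"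
        using cont_meas_Z[OF F2] by (rule borel_measurable_power)
    qed
    have "(\<integral>\<omega>. (?F2 (Z j \<omega>))\<^sup>2 \<partial>P j) \<le> (\<integral>\<omega>. t\<^sup>2 \<partial>P j)" by (intro integral_mono i sq2) simp
    then show ?thesis using i by (simp add: Pj.prob_space)
  qed
  note l1 = limit_integral[OF F1, of ?B1] and l2 = limit_integral[OF F2, of "t\<^sup>2"]
  have lim: "(\<lambda>j. \<bar>(\<integral>\<omega>. ?F1 (Z j \<omega>) \<partial>P j) - 4 * \<sigma>\<^sup>2 * (\<integral>\<omega>. ?F2 (Z j \<omega>) \<partial>P j)\<bar>)
     \<longlonglongrightarrow> \<bar>(\<integral>w. ?F1 w \<partial>\<mu>) - 4 * \<sigma>\<^sup>2 * (\<integral>w. ?F2 w \<partial>\<mu>)\<bar>"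
    using b1 b2 by (intro tendsto_intros l1 l2) blast+
  have "(\<lambda>j. sqrt (\<gamma> j)) \<longlonglongrightarrow> 0" using tendsto_real_sqrt[OF gamma_0] by simp
  then have "(\<lambda>j. sticky_chain.Cvar1 \<sigma> c L w0 t * \<delta> + sticky_chain.Cvar2 \<sigma> c L w0 s t \<delta> * sqrt (\<gamma> j))
     \<longlonglongrightarrow> sticky_chain.Cvar1 \<sigma> c L w0 t * \<delta> + sticky_chain.Cvar2 \<sigma> c L w0 s t \<delta> * 0"
    by (intro tendsto_intros)
  then have lim2: "(\<lambda>j. sticky_chain.Cvar1 \<sigma> c L w0 t * \<delta> + sticky_chain.Cvar2 \<sigma> c L w0 s t \<delta> * sqrt (\<gamma> j))
     \<longlonglongrightarrow> sticky_chain.Cvar1 \<sigma> c L w0 t * \<delta>" by simp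
  show ?thesis
  proof (rule tendsto_le[OF sequentially_bot lim2 lim], intro always_eventually allI)
    fix j
    interpret C: sticky_chain "P j" \<sigma> c L w0 "\<gamma> j" \<kappa> "X j" by (rule chain)
    show "\<bar>(\<integral>\<omega>. ?F1 (Z j \<omega>) \<partial>P j) - 4 * \<sigma>\<^sup>2 * (\<integral>\<omega>. ?F2 (Z j \<omega>) \<partial>P j)\<bar>
      \<le> sticky_chain.Cvar1 \<sigma> c L w0 t * \<delta> + sticky_chain.Cvar2 \<sigma> c L w0 s t \<delta> * sqrt (\<gamma> j)"
      using C.variance_increment[OF C.past_test_Fil[OF G s] test_Z[OF G] s st \<delta>]
      unfolding C.occ_def ramp_time_def .
  qed
qed

lemma pos_time_measurable: "u \<ge> 0 \<Longrightarrow> pos_time u \<in> borel_measurable \<mu>"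
proof (rule borel_measurable_LIMSEQ_real)
  show "(\<lambda>n. ramp_time (1 / real (Suc n)) u w) \<longlonglongrightarrow> pos_time u w" if "w \<in> space \<mu>" for w
    using that by (intro ramp_time_tendsto) (simp add: space_limit)
  show "u \<ge> 0 \<Longrightarrow> ramp_time (1 / real (Suc n)) u \<in> borel_measurable \<mu>" for n
    by (intro cont_meas continuous_map_ramp_time) auto
qed

text \<open>Now \<delta> runs through \<open>1 / real (Suc n)\<close>: the bound of
  \<open>test_ramp\<close> tends to 0, and dominated convergence under \<mu> turns ramp times into
  \<open>pos_time\<close>. The discontinuous functional thus appears only under the limit
  law.\<close>

lemma test_N: "(\<integral>w. G w * (((Mcont c \<kappa> t w)\<^sup>2 - (Mcont c \<kappa> s w)\<^sup>2) - 4 * \<sigma>\<^sup>2 * (pos_time t w - pos_time s w)) \<partial>\<mu>) = 0"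
proof -
  have t: "0 \<le> t" using s st by simp
  let ?F1 = "\<lambda>w. G w * ((Mcont c \<kappa> t w)\<^sup>2 - (Mcont c \<kappa> s w)\<^sup>2)"
  let ?d = "\<lambda>n. 1 / real (Suc n)"
  have Gm: "G \<in> borel_measurable \<mu>" by (rule cont_meas[OF past_testsD(1)[OF G]])
  have Gb: "\<bar>G w * x\<bar> \<le> \<bar>x\<bar>" if "w \<in> space \<mu>" for w x
    using past_testsD(2,3)[OF G, of w] that by (simp add: abs_mult mult_left_le_one_le space_limit)
  have rt: "0 \<le> ramp_time \<delta> u w \<and> ramp_time \<delta> u w \<le> u" if "u \<ge> 0" for u \<delta> w
    unfolding ramp_time_def by (intro conjI set_integral_bounds_01[OF that] ramp_bounds)
  have pt: "0 \<le> pos_time u w \<and> pos_time u w \<le> u" if "u \<ge> 0" for u w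
    unfolding pos_time_def using set_integral_bounds_01[OF that, of "\<lambda>u. indicator {0<..} (w u)"] by auto
  have i2: "integrable \<mu> (\<lambda>w. G w * (pos_time t w - pos_time s w))"
  proof (rule integrable_const_bound[of _ t])
    show "AE w in \<mu>. norm (G w * (pos_time t w - pos_time s w)) \<le> t"
    proof (rule AE_I2)
      fix w assume w: "w \<in> space \<mu>"
      have "\<bar>pos_time t w - pos_time s w\<bar> \<le> t" using pt[OF s, of w] pt[OF t, of w] st by linarith
      then show "norm (G w * (pos_time t w - pos_time s w)) \<le> t" 
        using Gb[OF w, of "pos_time t w - pos_time s w"] by simp
    qed
    show "(\<lambda>w. G w * (pos_time t w - pos_time s w)) \<in> borel_measurable \<mu>"
      by (intro borel_measurable_times borel_measurable_diff pos_time_measurable Gm s t)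
  qed
  have i1: "integrable \<mu> ?F1"
  proof (rule Bochner_Integration.integrable_bound)
    show i: "integrable \<mu> (\<lambda>w. (Mcont c \<kappa> t w)\<^sup>2 - (Mcont c \<kappa> s w)\<^sup>2)"
      by (intro Bochner_Integration.integrable_diff Mcont_second_moment s t)
    show "?F1 \<in> borel_measurable \<mu>" using Gm borel_measurable_integrable[OF i] by (rule borel_measurable_times)
    show "AE w in \<mu>. norm (?F1 w) \<le> norm ((Mcont c \<kappa> t w)\<^sup>2 - (Mcont c \<kappa> s w)\<^sup>2)"
      unfolding real_norm_def by (intro AE_I2 Gb)
  qed
  have lim: "(\<lambda>n. \<integral>w. G w * (ramp_time (?d n) t w - ramp_time (?d n) s w) \<partial>\<mu>)
      \<longlonglongrightarrow> (\<integral>w. G w * (pos_time t w - pos_time s w) \<partial>\<mu>)"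
  proof (rule integral_dominated_convergence[where w = "\<lambda>_. t"])
    show "(\<lambda>w. G w * (pos_time t w - pos_time s w)) \<in> borel_measurable \<mu>" using i2 by (rule borel_measurable_integrable)
    show "(\<lambda>w. G w * (ramp_time (?d n) t w - ramp_time (?d n) s w)) \<in> borel_measurable \<mu>" for n
      by (intro borel_measurable_times borel_measurable_diff Gm cont_meas continuous_map_ramp_time s t) auto
    show "AE w in \<mu>. (\<lambda>n. G w * (ramp_time (?d n) t w - ramp_time (?d n) s w)) \<longlonglongrightarrow> G w * (pos_time t w - pos_time s w)"
      by (intro AE_I2 tendsto_intros ramp_time_tendsto) (simp_all add: space_limit)
    show "AE w in \<mu>. norm (G w * (ramp_time (?d n) t w - ramp_time (?d n) s w)) \<le> t" for n
    proof (rule AE_I2)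
      fix w assume w: "w \<in> space \<mu>"
      have "\<bar>ramp_time (?d n) t w - ramp_time (?d n) s w\<bar> \<le> t" using rt[OF s, of "?d n" w] rt[OF t, of "?d n" w] st by linarith
      then show "norm (G w * (ramp_time (?d n) t w - ramp_time (?d n) s w)) \<le> t" 
        using Gb[OF w, of "ramp_time (?d n) t w - ramp_time (?d n) s w"] by simp
    qed
  qed simp
  have "\<bar>(\<integral>w. ?F1 w \<partial>\<mu>) - 4 * \<sigma>\<^sup>2 * (\<integral>w. G w * (pos_time t w - pos_time s w) \<partial>\<mu>)\<bar> \<le> 0"
  proof (rule tendsto_le[OF sequentially_bot])
    show "(\<lambda>n. \<bar>(\<integral>w. ?F1 w \<partial>\<mu>) - 4 * \<sigma>\<^sup>2 * (\<integral>w. G w * (ramp_time (?d n) t w - ramp_time (?d n) s w) \<partial>\<mu>)\<bar>)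
       \<longlonglongrightarrow> \<bar>(\<integral>w. ?F1 w \<partial>\<mu>) - 4 * \<sigma>\<^sup>2 * (\<integral>w. G w * (pos_time t w - pos_time s w) \<partial>\<mu>)\<bar>"
      by (intro tendsto_intros lim)
    have "(\<lambda>n. sticky_chain.Cvar1 \<sigma> c L w0 t * ?d n) \<longlonglongrightarrow> sticky_chain.Cvar1 \<sigma> c L w0 t * 0"
      by (intro tendsto_intros LIMSEQ_Suc[OF lim_1_over_n])
    then show "(\<lambda>n. sticky_chain.Cvar1 \<sigma> c L w0 t * ?d n) \<longlonglongrightarrow> 0" by simp
    show "\<forall>\<^sub>F n in sequentially. \<bar>(\<integral>w. ?F1 w \<partial>\<mu>) - 4 * \<sigma>\<^sup>2 * (\<integral>w. G w * (ramp_time (?d n) t w - ramp_time (?d n) s w) \<partial>\<mu>)\<bar>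
       \<le> sticky_chain.Cvar1 \<sigma> c L w0 t * ?d n"
      by (intro always_eventually allI test_ramp) simp
  qed
  then have "(\<integral>w. ?F1 w \<partial>\<mu>) - 4 * \<sigma>\<^sup>2 * (\<integral>w. G w * (pos_time t w - pos_time s w) \<partial>\<mu>) = 0" by simp
  moreover have "(\<integral>w. G w * (((Mcont c \<kappa> t w)\<^sup>2 - (Mcont c \<kappa> s w)\<^sup>2) - 4 * \<sigma>\<^sup>2 * (pos_time t w - pos_time s w)) \<partial>\<mu>)
    = (\<integral>w. ?F1 w - 4 * \<sigma>\<^sup>2 * (G w * (pos_time t w - pos_time s w)) \<partial>\<mu>)"
    by (intro Bochner_Integration.integral_cong refl) (simp only: right_diff_distrib mult_ac)
  ultimately show ?thesis using i1 i2 by simp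
qed

end

lemma AE_Mproc: "AE w in \<mu>. \<forall>t\<ge>0. Mproc c \<kappa> t w = Mcont c \<kappa> t w"
  using AE_nonneg AE_space
  by eventually_elim (auto intro!: Mproc_eq_Mcont[OF lipschitz] simp: space_limit)

text \<open>Two versions of a process share the work: \<open>Y'\<close> is adapted, the test
  identities are known for \<open>Y\<close>, and almost surely both agree at all times.\<close>

lemma is_martingaleI:
  assumes int: "\<And>t. t \<ge> 0 \<Longrightarrow> integrable \<mu> (Y t)"
    and meas: "\<And>t. t \<ge> 0 \<Longrightarrow> Y' t \<in> borel_measurable (sigma Wpaths (Wfilt t))"
    and eq: "AE w in \<mu>. \<forall>t\<ge>0. Y' t w = Y t w"
    and test: "\<And>G s t. G \<in> past_tests s \<Longrightarrow> 0 \<le> s \<Longrightarrow> s \<le> t \<Longrightarrow> (\<integral>w. G w * (Y t w - Y s w) \<partial>\<mu>) = 0"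
  shows "is_martingale \<mu> Wfilt Y'"
proof -
  have sub: "B \<in> sets \<mu>" if "B \<in> Wfilt u" for B u using that Wfilt_subset_Wborel sets_\<mu> by blast
  have Y'm: "Y' u \<in> borel_measurable \<mu>" if "u \<ge> 0" for u
  proof (rule measurable_from_subalg[OF _ meas[OF that]])
    show "subalgebra \<mu> (sigma Wpaths (Wfilt u))"
      unfolding subalgebra_def sets_Wfilt space_Wfilt space_limit using sub by blast
  qed
  show ?thesis
    unfolding is_martingale_def
  proof (intro conjI allI impI)
    fix t :: real assume t: "0 \<le> t"
    have ae: "AE w in \<mu>. Y t w = Y' t w" using eq by eventually_elim (use t in simp)
    show "integrable \<mu> (Y' t)"
      using int[OF t] ae by (rule integrable_cong_AE_imp[OF _ Y'm[OF t]])
    show "Y' t \<in> measurable (sigma (space \<mu>) (Wfilt t)) borel" using meas[OF t] by (simp add: space_limit)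
  next
    fix s t :: real and B assume s: "0 \<le> s" and st: "s \<le> t" and B: "B \<in> Wfilt s"
    have t: "0 \<le> t" using s st by simp
    have Y: "set_integrable \<mu> B (Y u)" if "u \<ge> 0" for u
      unfolding set_integrable_def using sub[OF B] int[OF that] by (rule integrable_mult_indicator)
    have e: "(\<integral>w\<in>B. Y' u w \<partial>\<mu>) = (\<integral>w\<in>B. Y u w \<partial>\<mu>)" if "u \<ge> 0" for u
    proof (rule set_lebesgue_integral_cong_AE)
      show "B \<in> sets \<mu>" by (rule sub[OF B])
      show "Y' u \<in> borel_measurable \<mu>" "Y u \<in> borel_measurable \<mu>"
        using Y'm[OF that] int[OF that] by auto
      show "AE w\<in>B in \<mu>. Y' u w = Y u w" using eq by eventually_elim (use that in simp)
    qed
    have "(\<integral>w\<in>B. Y t w - Y s w \<partial>\<mu>) = 0"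
      by (rule integral_Wfilt_eq_0[OF sets_\<mu> _ _ B]) (auto intro!: int s t test[OF _ s st])
    then have "(\<integral>w\<in>B. Y t w \<partial>\<mu>) = (\<integral>w\<in>B. Y s w \<partial>\<mu>)"
      using set_integral_diff(2)[OF Y[OF t] Y[OF s]] by simp
    then show "(\<integral>w\<in>B. Y' t w \<partial>\<mu>) = (\<integral>w\<in>B. Y' s w \<partial>\<mu>)" by (simp add: e s t)
  qed
qed

lemma martingales: "is_martingale \<mu> Wfilt (Mproc c \<kappa>)" "is_martingale \<mu> Wfilt (Nproc \<sigma> c \<kappa>)"
proof -
  have \<kappa>m: "\<kappa> \<in> borel_measurable borel" using chain[of 0] by (rule sticky_chain.kappa_measurable)
  have Mm: "Mproc c \<kappa> t \<in> borel_measurable (sigma Wpaths (Wfilt t))" if "t \<ge> 0" for t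
    unfolding Mproc_def[abs_def]
    by (intro borel_measurable_diff eval_Wfilt path_integral_Wfilt borel_measurable_add \<kappa>m that) (use that in auto)
  show "is_martingale \<mu> Wfilt (Mproc c \<kappa>)"
    by (rule is_martingaleI[where Y = "Mcont c \<kappa>"])
       (auto intro: Mcont_second_moment Mm AE_Mproc test_M)
  have pti: "integrable \<mu> (pos_time t)" if "t \<ge> 0" for t
  proof (rule integrable_const_bound[of _ t])
    have "0 \<le> pos_time t w \<and> pos_time t w \<le> t" for w
      unfolding pos_time_def using set_integral_bounds_01[OF that, of "\<lambda>u. indicator {0<..} (w u)"] by auto
    then show "AE w in \<mu>. norm (pos_time t w) \<le> t" by auto
    \<comment> \<open>The fact comes from a context with a fixed test functional; the constant test
      1 serves as one.\<close>
    show "pos_time t \<in> borel_measurable \<mu>" using pos_time_measurable[OF past_tests_one] that by blast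
  qed
  show "is_martingale \<mu> Wfilt (Nproc \<sigma> c \<kappa>)"
  proof (rule is_martingaleI[where Y = "\<lambda>t w. (Mcont c \<kappa> t w)\<^sup>2 - 4 * \<sigma>\<^sup>2 * pos_time t w"])
    show "integrable \<mu> (\<lambda>w. (Mcont c \<kappa> t w)\<^sup>2 - 4 * \<sigma>\<^sup>2 * pos_time t w)" if "t \<ge> 0" for t
      using Mcont_second_moment(1)[OF that] pti[OF that] by simp
    show "Nproc \<sigma> c \<kappa> t \<in> borel_measurable (sigma Wpaths (Wfilt t))" if "t \<ge> 0" for t
      unfolding Nproc_def[abs_def]
      by (intro borel_measurable_diff borel_measurable_power Mm borel_measurable_times path_integral_Wfilt
          borel_measurable_const borel_measurable_indicator that) simp
    show "AE w in \<mu>. \<forall>t\<ge>0. Nproc \<sigma> c \<kappa> t w = (Mcont c \<kappa> t w)\<^sup>2 - 4 * \<sigma>\<^sup>2 * pos_time t w"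
      using AE_Mproc by eventually_elim (simp add: Nproc_def pos_time_def)
    fix G s t assume "G \<in> past_tests s" "0 \<le> s" "s \<le> (t::real)"
    then have "(\<integral>w. G w * (((Mcont c \<kappa> t w)\<^sup>2 - (Mcont c \<kappa> s w)\<^sup>2) - 4 * \<sigma>\<^sup>2 * (pos_time t w - pos_time s w)) \<partial>\<mu>) = 0"
      by (rule test_N)
    then show "(\<integral>w. G w * ((Mcont c \<kappa> t w)\<^sup>2 - 4 * \<sigma>\<^sup>2 * pos_time t w
        - ((Mcont c \<kappa> s w)\<^sup>2 - 4 * \<sigma>\<^sup>2 * pos_time s w)) \<partial>\<mu>) = 0"
      by (simp add: algebra_simps)
  qed
qed

end

theorem theorem18:
  fixes \<sigma> \<gamma>bar c L w0 :: real
    and \<kappa> :: "real \<Rightarrow> real"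
    and \<gamma> :: "nat \<Rightarrow> real"
    and Pn :: "nat \<Rightarrow> 'a measure"
    and X :: "nat \<Rightarrow> nat \<Rightarrow> 'a \<Rightarrow> real"
    and \<mu>inf :: "(real \<Rightarrow> real) measure"
  assumes "\<sigma> > 0" and "\<gamma>bar > 0" and "c \<ge> 0"
    and "L-lipschitz_on {0..} \<kappa>" and "\<kappa> 0 = 0"
    and "\<kappa> \<in> borel_measurable borel"
    and "\<And>n. \<gamma> n > 0 \<and> \<gamma> n \<le> \<gamma>bar" and "\<gamma> \<longlonglongrightarrow> 0"
    and "w0 \<ge> 0"
    and "\<And>n. prob_space (Pn n)"
    and "\<And>n k. X n k \<in> borel_measurable (Pn n)"
    and "\<And>n \<omega>. \<omega> \<in> space (Pn n) \<Longrightarrow> X n 0 \<omega> = w0"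
    and "\<And>n k A B. A \<in> sets borel \<Longrightarrow>
           B \<in> sigma_sets (space (Pn n))
                 {X n i -` D \<inter> space (Pn n) | i D. i \<le> k \<and> D \<in> sets borel} \<Longrightarrow>
           measure (Pn n) (B \<inter> {\<omega> \<in> space (Pn n). X n (Suc k) \<omega> \<in> A})
             = (\<integral>\<omega>\<in>B. Qk \<sigma> c \<kappa> (\<gamma> n) (X n k \<omega>) A \<partial>Pn n)"
    and "prob_space \<mu>inf" and "sets \<mu>inf = sets Wborel"
    and "\<exists>r. strict_mono r \<and>
           weak_conv_top Wtop
             (\<lambda>j. distr (Pn (r j)) Wborel (\<lambda>\<omega>. interp (\<gamma> (r j)) (\<lambda>k. X (r j) k \<omega>)))
             \<mu>inf"
  shows "is_martingale \<mu>inf Wfilt (\<lambda>t. Mproc c \<kappa> t)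
       \<and> is_martingale \<mu>inf Wfilt (\<lambda>t. Nproc \<sigma> c \<kappa> t)"
proof -
  obtain r where r: "strict_mono r" and conv: "weak_conv_top Wtop
      (\<lambda>j. distr (Pn (r j)) Wborel (\<lambda>\<omega>. interp (\<gamma> (r j)) (\<lambda>k. X (r j) k \<omega>))) \<mu>inf"
    using assms(16) by blast
  have g0: "(\<lambda>j. \<gamma> (r j)) \<longlonglongrightarrow> 0" using LIMSEQ_subseq_LIMSEQ[OF assms(8) r] by (simp add: o_def)
  then have "(\<lambda>j. \<gamma> (r j) * L) \<longlonglongrightarrow> 0 * L" by (intro tendsto_mult tendsto_const)
  then have "\<forall>\<^sub>F j in sequentially. \<gamma> (r j) < 1 \<and> \<gamma> (r j) * L < 1"
    using g0 by (intro eventually_conj order_tendstoD(2)) auto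
  \<comment> \<open>From \<open>N\<close> on the step sizes meet the conditions of
    \<open>sticky_chain\<close>; discarding finitely many members of the subsequence keeps its
    limit.\<close>
  then obtain N where N: "\<And>j. j \<ge> N \<Longrightarrow> \<gamma> (r j) < 1 \<and> \<gamma> (r j) * L < 1"
    unfolding eventually_sequentially by blast
  define q where "q j = r (j + N)" for j
  have chain: "sticky_chain (Pn (q j)) \<sigma> c L w0 (\<gamma> (q j)) \<kappa> (X (q j))" for j
  proof -
    interpret prob_space "Pn (q j)" by (rule assms(10))
    show ?thesis
    proof
      show "\<gamma> (q j) \<le> 1" "\<gamma> (q j) * L \<le> 1" using N[of "j + N"] by (auto simp: q_def)
    qed (use assms(1,3-7,9,11-13) in auto)
  qed
  interpret sticky_limit \<sigma> c L w0 \<kappa> "\<lambda>j. \<gamma> (q j)" "\<lambda>j. Pn (q j)" "\<lambda>j. X (q j)" \<mu>inf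
  proof (intro sticky_limit.intro chain assms(14,15))
    show "(\<lambda>j. \<gamma> (q j)) \<longlonglongrightarrow> 0" using LIMSEQ_ignore_initial_segment[OF g0, of N] by (simp add: q_def)
    fix f assume f: "continuous_map Wtop euclideanreal f" "bounded (f ` topspace Wtop)"
    have eq: "(\<integral>w. f w \<partial>distr (Pn (r j)) Wborel (\<lambda>\<omega>. interp (\<gamma> (r j)) (\<lambda>k. X (r j) k \<omega>))) =
      (\<integral>\<omega>. f (interp (\<gamma> (r j)) (\<lambda>k. X (r j) k \<omega>)) \<partial>Pn (r j))" for j
      using assms(7,11)
      by (intro integral_distr measurable_interp continuous_map_measurable_Wborel f) auto
    have "(\<lambda>j. \<integral>w. f w \<partial>distr (Pn (r j)) Wborel (\<lambda>\<omega>. interp (\<gamma> (r j)) (\<lambda>k. X (r j) k \<omega>))) \<longlonglongrightarrow> (\<integral>w. f w \<partial>\<mu>inf)"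
      using conv f unfolding weak_conv_top_def by blast
    from LIMSEQ_ignore_initial_segment[OF this, of N, unfolded eq]
    show "(\<lambda>j. \<integral>\<omega>. f (sticky_chain.path (\<gamma> (q j)) (X (q j)) \<omega>) \<partial>Pn (q j)) \<longlonglongrightarrow> (\<integral>w. f w \<partial>\<mu>inf)"
      unfolding sticky_chain.path_def[OF chain] unfolding q_def .
  qed
  show ?thesis by (intro conjI martingales)
qed

end
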